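(* Let $T$ be a first-order theory, $\mathcal{U}$ a monster model of $T$, $x$ a finite tuple of variables, and $\mu\in\mathfrak{M}_x(\mathcal{U})$. (1) If $\mu$ is finitely satisfiable, then $\mu$ is invariantly supported. (2) If $\mu$ is invariantly supported, then $\mu$ is invariant. (3) If $T$ is NIP, then $\mu$ is invariant if and only if it is invariantly supported. (4) In some theory, there exist a definable measure $\mu\in\mathfrak{M}_x(\mathcal{U})$ and $p\in S(\mu)$ such that $p$ is not invariant (over any small set).
   Context: "Small" means small relative to the saturation of $\mathcal{U}$. $\mathcal{L}$ is the language of $T$; $\mathcal{L}_x(\mathcal{U})$ is the Boolean algebra of formulas in $x$ with parameters from $\mathcal{U}$ (up to equivalence); $\mathfrak{M}_x(\mathcal{U})$ is the set of global Keisler measures, i.e. finitely additive probability measures on $\mathcal{L}_x(\mathcal{U})$. The support of $\mu$ is $S(\mu)=\{p\in S_x(\mathcal{U}):\mu(\varphi(x))>0\text{ for all }\varphi(x)\in p\}$. $\mu\in\mathfrak{M}_x(\mathcal{U})$ is: - invariant if there is a small $M\prec\mathcal{U}$ such that for every $\mathcal{L}(M)$-formula $\varphi(x;y)$ and $b\equiv_M b'$ in $\mathcal{U}^y$, $\mu(\varphi(x;b))=\mu(\varphi(x;b'))$ ($M$-invariant); - definable if there is a small $M\prec\mathcal{U}$ such that $\mu$ is $M$-invariant and for every $\mathcal{L}(M)$-formula $\varphi(x;y)$ the map $S_y(M)\to[0,1]$, $\mathrm{tp}(b/M)\mapsto\mu(\varphi(x;b))$, is continuous; - finitely satisfiable if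 there is a small $M\prec\mathcal{U}$ such that whenever $\mu(\varphi(x))>0$ for $\varphi(x)\in\mathcal{L}_x(\mathcal{U})$, $\mathcal{U}\models\varphi(a)$ for some $a\in M^x$; - invariantly supported if there is a small $M\prec\mathcal{U}$ such that every $p\in S(\mu)$ is $M$-invariant. *)

theory Defs
  imports "HOL-Analysis.Analysis"
begin

unbundle cardinal_syntax

section \<open>First-order languages, formulas and structures\<close>

text \<open>A language consists of sets of function symbols and relation symbols together with their
arities; constants are function symbols of arity 0.\<close>

record ('f, 'r) lang =
  fsyms :: "'f set"
  farity :: "'f \<Rightarrow> nat"
  rsyms :: "'r set"
  rarity :: "'r \<Rightarrow> nat"

datatype 'f trm = Var nat | App 'f "'f trm list"

datatype ('f, 'r) fm =
    Eq "'f trm" "'f trm"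
  | Rel 'r "'f trm list"
  | Neg "('f, 'r) fm"
  | Conj "('f, 'r) fm" "('f, 'r) fm"
  | Ex nat "('f, 'r) fm"

definition Disj :: "('f, 'r) fm \<Rightarrow> ('f, 'r) fm \<Rightarrow> ('f, 'r) fm" where
  "Disj \<phi> \<psi> = Neg (Conj (Neg \<phi>) (Neg \<psi>))"

primrec fvt :: "'f trm \<Rightarrow> nat set" where
  "fvt (Var n) = {n}"
| "fvt (App f ts) = \<Union> (set (map fvt ts))"

primrec fv :: "('f, 'r) fm \<Rightarrow> nat set" where
  "fv (Eq s t) = fvt s \<union> fvt t"
| "fv (Rel r ts) = \<Union> (set (map fvt ts))"
| "fv (Neg \<phi>) = fv \<phi>"
| "fv (Conj \<phi> \<psi>) = fv \<phi> \<union> fv \<psi>"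
| "fv (Ex n \<phi>) = fv \<phi> - {n}"

primrec wf_trm :: "('f, 'r) lang \<Rightarrow> 'f trm \<Rightarrow> bool" where
  "wf_trm L (Var n) \<longleftrightarrow> True"
| "wf_trm L (App f ts) \<longleftrightarrow>
     f \<in> fsyms L \<and> length ts = farity L f \<and> list_all id (map (wf_trm L) ts)"

primrec wf_fm :: "('f, 'r) lang \<Rightarrow> ('f, 'r) fm \<Rightarrow> bool" where
  "wf_fm L (Eq s t) \<longleftrightarrow> wf_trm L s \<and> wf_trm L t"
| "wf_fm L (Rel r ts) \<longleftrightarrow> r \<in> rsyms L \<and> length ts = rarity L r \<and> list_all (wf_trm L) ts"
| "wf_fm L (Neg \<phi>) \<longleftrightarrow> wf_fm L \<phi>"
| "wf_fm L (Conj \<phi> \<psi>) \<longleftrightarrow> wf_fm L \<phi> \<and> wf_fm L \<psi>"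
| "wf_fm L (Ex n \<phi>) \<longleftrightarrow> wf_fm L \<phi>"

record ('f, 'r, 'a) struct =
  dom :: "'a set"
  fint :: "'f \<Rightarrow> 'a list \<Rightarrow> 'a"
  rint :: "'r \<Rightarrow> 'a list \<Rightarrow> bool"

definition is_struct :: "('f, 'r) lang \<Rightarrow> ('f, 'r, 'a) struct \<Rightarrow> bool" where
  "is_struct L U \<longleftrightarrow> dom U \<noteq> {} \<and>
     (\<forall>f\<in>fsyms L. \<forall>as. length as = farity L f \<and> set as \<subseteq> dom U \<longrightarrow> fint U f as \<in> dom U)"

primrec tval :: "('f, 'r, 'a) struct \<Rightarrow> (nat \<Rightarrow> 'a) \<Rightarrow> 'f trm \<Rightarrow> 'a" where
  "tval U e (Var n) = e n"
| "tval U e (App f ts) = fint U f (map (tval U e) ts)"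

primrec sat :: "('f, 'r, 'a) struct \<Rightarrow> (nat \<Rightarrow> 'a) \<Rightarrow> ('f, 'r) fm \<Rightarrow> bool" where
  "sat U e (Eq s t) \<longleftrightarrow> tval U e s = tval U e t"
| "sat U e (Rel r ts) \<longleftrightarrow> rint U r (map (tval U e) ts)"
| "sat U e (Neg \<phi>) \<longleftrightarrow> \<not> sat U e \<phi>"
| "sat U e (Conj \<phi> \<psi>) \<longleftrightarrow> sat U e \<phi> \<and> sat U e \<psi>"
| "sat U e (Ex n \<phi>) \<longleftrightarrow> (\<exists>a\<in>dom U. sat U (e(n := a)) \<phi>)"

definition is_theory :: "('f, 'r) lang \<Rightarrow> ('f, 'r) fm set \<Rightarrow> bool" where
  "is_theory L T \<longleftrightarrow> (\<forall>\<sigma>\<in>T. wf_fm L \<sigma> \<and> fv \<sigma> = {})"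

definition models :: "('f, 'r) lang \<Rightarrow> ('f, 'r, 'a) struct \<Rightarrow> ('f, 'r) fm set \<Rightarrow> bool" where
  "models L U T \<longleftrightarrow> is_struct L U \<and> (\<forall>\<sigma>\<in>T. \<forall>e. sat U e \<sigma>)"

text \<open>The substructure with universe \<open>M\<close> keeps the interpretations of \<open>U\<close>, so an elementary
substructure is determined by its universe.\<close>

definition elem_sub :: "('f, 'r) lang \<Rightarrow> 'a set \<Rightarrow> ('f, 'r, 'a) struct \<Rightarrow> bool" where
  "elem_sub L M U \<longleftrightarrow> M \<subseteq> dom U \<and> is_struct L (U\<lparr>dom := M\<rparr>) \<and>
     (\<forall>\<phi>. wf_fm L \<phi> \<longrightarrow>
        (\<forall>e \<in> fv \<phi> \<rightarrow>\<^sub>E M. sat (U\<lparr>dom := M\<rparr>) e \<phi> \<longleftrightarrow> sat U e \<phi>))"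

section \<open>Parameters\<close>

text \<open>\<open>L(A)\<close> adds a new constant \<open>Inr a\<close> for each \<open>a \<in> A\<close>, interpreted as \<open>a\<close> itself.

A tuple of variables is a set \<open>X\<close> of variable indices, and \<open>U\<^sup>X\<close> is \<open>X \<rightarrow>\<^sub>E dom U\<close>.\<close>

definition lang_par :: "('f, 'r) lang \<Rightarrow> 'a set \<Rightarrow> ('f + 'a, 'r) lang" where
  "lang_par L A = \<lparr>fsyms = fsyms L <+> A, farity = case_sum (farity L) (\<lambda>_. 0),
                   rsyms = rsyms L, rarity = rarity L\<rparr>"

definition struct_par :: "('f, 'r, 'a) struct \<Rightarrow> ('f + 'a, 'r, 'a) struct" where
  "struct_par U = \<lparr>dom = dom U, fint = case_sum (fint U) (\<lambda>a _. a), rint = rint U\<rparr>"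

abbreviation satp :: "('f, 'r, 'a) struct \<Rightarrow> (nat \<Rightarrow> 'a) \<Rightarrow> ('f + 'a, 'r) fm \<Rightarrow> bool" where
  "satp U \<equiv> sat (struct_par U)"

definition fms_over :: "('f, 'r) lang \<Rightarrow> 'a set \<Rightarrow> nat set \<Rightarrow> ('f + 'a, 'r) fm set" where
  "fms_over L A X = {\<phi>. wf_fm (lang_par L A) \<phi> \<and> fv \<phi> \<subseteq> X}"

primrec inst_trm :: "nat set \<Rightarrow> (nat \<Rightarrow> 'a) \<Rightarrow> ('f + 'a) trm \<Rightarrow> ('f + 'a) trm" where
  "inst_trm Y b (Var n) = (if n \<in> Y then App (Inr (b n)) [] else Var n)"
| "inst_trm Y b (App f ts) = App f (map (inst_trm Y b) ts)"

text \<open>\<open>inst Y b \<phi>\<close> is \<open>\<phi>(x;b)\<close>: each free \<open>n \<in> Y\<close> is replaced by the constant naming \<open>b n\<close>.\<close>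

primrec inst :: "nat set \<Rightarrow> (nat \<Rightarrow> 'a) \<Rightarrow> ('f + 'a, 'r) fm \<Rightarrow> ('f + 'a, 'r) fm" where
  "inst Y b (Eq s t) = Eq (inst_trm Y b s) (inst_trm Y b t)"
| "inst Y b (Rel r ts) = Rel r (map (inst_trm Y b) ts)"
| "inst Y b (Neg \<phi>) = Neg (inst Y b \<phi>)"
| "inst Y b (Conj \<phi> \<psi>) = Conj (inst Y b \<phi>) (inst Y b \<psi>)"
| "inst Y b (Ex n \<phi>) = Ex n (inst (Y - {n}) b \<phi>)"

section \<open>Types and monster models\<close>

definition fin_sat :: "('f, 'r, 'a) struct \<Rightarrow> nat set \<Rightarrow> ('f + 'a, 'r) fm set \<Rightarrow> bool" where
  "fin_sat U X p \<longleftrightarrow>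
     (\<forall>\<Delta>. finite \<Delta> \<and> \<Delta> \<subseteq> p \<longrightarrow> (\<exists>a \<in> X \<rightarrow>\<^sub>E dom U. \<forall>\<phi>\<in>\<Delta>. satp U a \<phi>))"

text \<open>\<open>S\<^sub>X(A)\<close>: the complete types over \<open>A\<close>, with consistency taken relative to the theory of \<open>U\<close>
with all parameters named.\<close>

definition types :: "('f, 'r) lang \<Rightarrow> ('f, 'r, 'a) struct \<Rightarrow> 'a set \<Rightarrow> nat set
    \<Rightarrow> ('f + 'a, 'r) fm set set" where
  "types L U A X = {p. p \<subseteq> fms_over L A X \<and> fin_sat U X p \<and>
                       (\<forall>\<phi>\<in>fms_over L A X. \<phi> \<in> p \<or> Neg \<phi> \<in> p)}"

definition tp :: "('f, 'r) lang \<Rightarrow> ('f, 'r, 'a) struct \<Rightarrow> 'a set \<Rightarrow> nat set \<Rightarrow> (nat \<Rightarrow> 'a)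
    \<Rightarrow> ('f + 'a, 'r) fm set" where
  "tp L U A Y b = {\<psi> \<in> fms_over L A Y. satp U b \<psi>}"

definition saturated :: "'k rel \<Rightarrow> ('f, 'r) lang \<Rightarrow> ('f, 'r, 'a) struct \<Rightarrow> bool" where
  "saturated \<kappa> L U \<longleftrightarrow>
     (\<forall>A X. A \<subseteq> dom U \<and> |A| <o \<kappa> \<and> finite X \<longrightarrow>
        (\<forall>p\<in>types L U A X. \<exists>a \<in> X \<rightarrow>\<^sub>E dom U. tp L U A X a = p))"

definition large_for :: "'k rel \<Rightarrow> ('f, 'r) lang \<Rightarrow> bool" where
  "large_for \<kappa> L \<longleftrightarrow> Card_order \<kappa> \<and> natLeq <o \<kappa> \<and> |fsyms L <+> rsyms L| <o \<kappa>"

text \<open>A monster model is a \<open>\<kappa>\<close>-saturated model with \<open>\<kappa> > |L| + \<aleph>\<^sub>0\<close>, and \<open>small\<close> means of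
cardinality less than \<open>\<kappa>\<close>. Strong homogeneity, which is often required as well, is not part of
the definition.\<close>

definition monster :: "'k rel \<Rightarrow> ('f, 'r) lang \<Rightarrow> ('f, 'r) fm set \<Rightarrow> ('f, 'r, 'a) struct \<Rightarrow> bool"
  where "monster \<kappa> L T U \<longleftrightarrow> large_for \<kappa> L \<and> is_theory L T \<and> models L U T \<and> saturated \<kappa> L U"

definition small_model :: "'k rel \<Rightarrow> ('f, 'r) lang \<Rightarrow> 'a set \<Rightarrow> ('f, 'r, 'a) struct \<Rightarrow> bool" where
  "small_model \<kappa> L M U \<longleftrightarrow> elem_sub L M U \<and> |M| <o \<kappa>"

text \<open>The open sets of \<open>S\<^sub>Y(A)\<close> are generated by the sets \<open>[\<psi>]\<close> for \<open>\<psi> \<in> L\<^sub>Y(A)\<close>.\<close>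

definition type_space :: "('f, 'r) lang \<Rightarrow> ('f, 'r, 'a) struct \<Rightarrow> 'a set \<Rightarrow> nat set
    \<Rightarrow> ('f + 'a, 'r) fm set topology" where
  "type_space L U A Y =
     topology_generated_by ((\<lambda>\<psi>. {q \<in> types L U A Y. \<psi> \<in> q}) ` fms_over L A Y)"

section \<open>NIP\<close>

text \<open>\<open>shatters N X Y n \<phi>\<close>: some \<open>n\<close> tuples in \<open>N\<^sup>X\<close> are shattered by \<open>\<phi>(x;y)\<close>.\<close>

definition shatters :: "('f, 'r, 'a) struct \<Rightarrow> nat set \<Rightarrow> nat set \<Rightarrow> nat \<Rightarrow> ('f, 'r) fm \<Rightarrow> bool"
  where "shatters N X Y n \<phi> \<longleftrightarrow>
     (\<exists>a. (\<forall>i<n. a i \<in> X \<rightarrow>\<^sub>E dom N) \<and>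
        (\<forall>I \<subseteq> {..<n}. \<exists>b \<in> Y \<rightarrow>\<^sub>E dom N. \<forall>i<n. sat N (override_on (a i) b Y) \<phi> \<longleftrightarrow> i \<in> I))"

text \<open>HOL cannot quantify over the models of \<open>T\<close> on all types at once; the first argument fixes the
type \<open>'a\<close> of the universes considered. If \<open>T\<close> is complete, any one model decides NIP, since shattering
\<open>n\<close> tuples is a first-order sentence.\<close>

definition nip :: "'a itself \<Rightarrow> ('f, 'r) lang \<Rightarrow> ('f, 'r) fm set \<Rightarrow> bool" where
  "nip _ L T \<longleftrightarrow>
     (\<forall>N :: ('f, 'r, 'a) struct. models L N T \<longrightarrow>
        (\<forall>X Y \<phi>. finite X \<and> finite Y \<and> X \<inter> Y = {} \<and> wf_fm L \<phi> \<and> fv \<phi> \<subseteq> X \<union> Y \<longrightarrow>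
           (\<exists>n. \<not> shatters N X Y n \<phi>)))"

section \<open>Keisler measures\<close>

text \<open>A measure on \<open>L\<^sub>X(U)\<close> is a function on formulas which respects equivalence in \<open>U\<close>; its values
outside \<open>fms_over L (dom U) X\<close> are irrelevant.\<close>

definition keisler :: "('f, 'r) lang \<Rightarrow> ('f, 'r, 'a) struct \<Rightarrow> nat set
    \<Rightarrow> (('f + 'a, 'r) fm \<Rightarrow> real) \<Rightarrow> bool" where
  "keisler L U X \<mu> \<longleftrightarrow>
     (\<forall>\<phi>\<in>fms_over L (dom U) X. 0 \<le> \<mu> \<phi>) \<and>
     (\<forall>\<phi>\<in>fms_over L (dom U) X. (\<forall>a \<in> X \<rightarrow>\<^sub>E dom U. satp U a \<phi>) \<longrightarrow> \<mu> \<phi> = 1) \<and>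
     (\<forall>\<phi>\<in>fms_over L (dom U) X. \<forall>\<psi>\<in>fms_over L (dom U) X.
        (\<forall>a \<in> X \<rightarrow>\<^sub>E dom U. satp U a \<phi> \<longleftrightarrow> satp U a \<psi>) \<longrightarrow> \<mu> \<phi> = \<mu> \<psi>) \<and>
     (\<forall>\<phi>\<in>fms_over L (dom U) X. \<forall>\<psi>\<in>fms_over L (dom U) X.
        (\<forall>a \<in> X \<rightarrow>\<^sub>E dom U. \<not> satp U a (Conj \<phi> \<psi>)) \<longrightarrow> \<mu> (Disj \<phi> \<psi>) = \<mu> \<phi> + \<mu> \<psi>)"

definition support :: "('f, 'r) lang \<Rightarrow> ('f, 'r, 'a) struct \<Rightarrow> nat set
    \<Rightarrow> (('f + 'a, 'r) fm \<Rightarrow> real) \<Rightarrow> ('f + 'a, 'r) fm set set" where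
  "support L U X \<mu> = {p \<in> types L U (dom U) X. \<forall>\<phi>\<in>p. \<mu> \<phi> > 0}"

definition invariant_over :: "('f, 'r) lang \<Rightarrow> ('f, 'r, 'a) struct \<Rightarrow> nat set \<Rightarrow> 'a set
    \<Rightarrow> (('f + 'a, 'r) fm \<Rightarrow> real) \<Rightarrow> bool" where
  "invariant_over L U X A \<mu> \<longleftrightarrow>
     (\<forall>Y \<phi> b b'. finite Y \<and> X \<inter> Y = {} \<and> \<phi> \<in> fms_over L A (X \<union> Y) \<and>
        b \<in> Y \<rightarrow>\<^sub>E dom U \<and> b' \<in> Y \<rightarrow>\<^sub>E dom U \<and> tp L U A Y b = tp L U A Y b' \<longrightarrow>
        \<mu> (inst Y b \<phi>) = \<mu> (inst Y b' \<phi>))"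

definition type_invariant_over :: "('f, 'r) lang \<Rightarrow> ('f, 'r, 'a) struct \<Rightarrow> nat set \<Rightarrow> 'a set
    \<Rightarrow> ('f + 'a, 'r) fm set \<Rightarrow> bool" where
  "type_invariant_over L U X A p \<longleftrightarrow>
     (\<forall>Y \<phi> b b'. finite Y \<and> X \<inter> Y = {} \<and> \<phi> \<in> fms_over L A (X \<union> Y) \<and>
        b \<in> Y \<rightarrow>\<^sub>E dom U \<and> b' \<in> Y \<rightarrow>\<^sub>E dom U \<and> tp L U A Y b = tp L U A Y b' \<longrightarrow>
        (inst Y b \<phi> \<in> p \<longleftrightarrow> inst Y b' \<phi> \<in> p))"

definition invariant :: "'k rel \<Rightarrow> ('f, 'r) lang \<Rightarrow> ('f, 'r, 'a) struct \<Rightarrow> nat set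
    \<Rightarrow> (('f + 'a, 'r) fm \<Rightarrow> real) \<Rightarrow> bool" where
  "invariant \<kappa> L U X \<mu> \<longleftrightarrow> (\<exists>M. small_model \<kappa> L M U \<and> invariant_over L U X M \<mu>)"

definition definable :: "'k rel \<Rightarrow> ('f, 'r) lang \<Rightarrow> ('f, 'r, 'a) struct \<Rightarrow> nat set
    \<Rightarrow> (('f + 'a, 'r) fm \<Rightarrow> real) \<Rightarrow> bool" where
  "definable \<kappa> L U X \<mu> \<longleftrightarrow>
     (\<exists>M. small_model \<kappa> L M U \<and> invariant_over L U X M \<mu> \<and>
        (\<forall>Y \<phi>. finite Y \<and> X \<inter> Y = {} \<and> \<phi> \<in> fms_over L M (X \<union> Y) \<longrightarrow>
           (\<exists>F. continuous_map (type_space L U M Y) (top_of_set {0..1}) F \<and>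
                (\<forall>b \<in> Y \<rightarrow>\<^sub>E dom U. F (tp L U M Y b) = \<mu> (inst Y b \<phi>)))))"

definition finitely_satisfiable :: "'k rel \<Rightarrow> ('f, 'r) lang \<Rightarrow> ('f, 'r, 'a) struct \<Rightarrow> nat set
    \<Rightarrow> (('f + 'a, 'r) fm \<Rightarrow> real) \<Rightarrow> bool" where
  "finitely_satisfiable \<kappa> L U X \<mu> \<longleftrightarrow>
     (\<exists>M. small_model \<kappa> L M U \<and>
        (\<forall>\<phi>\<in>fms_over L (dom U) X. \<mu> \<phi> > 0 \<longrightarrow> (\<exists>a \<in> X \<rightarrow>\<^sub>E M. satp U a \<phi>)))"

definition invariantly_supported :: "'k rel \<Rightarrow> ('f, 'r) lang \<Rightarrow> ('f, 'r, 'a) struct \<Rightarrow> nat set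
    \<Rightarrow> (('f + 'a, 'r) fm \<Rightarrow> real) \<Rightarrow> bool" where
  "invariantly_supported \<kappa> L U X \<mu> \<longleftrightarrow>
     (\<exists>M. small_model \<kappa> L M U \<and> (\<forall>p\<in>support L U X \<mu>. type_invariant_over L U X M p))"

text \<open>A definable measure with a type in its support that is invariant over no small set.\<close>

definition definable_with_noninvariant_support ::
    "'k rel \<Rightarrow> ('f, 'r) lang \<Rightarrow> ('f, 'r, 'a) struct \<Rightarrow> bool" where
  "definable_with_noninvariant_support \<kappa> L U \<longleftrightarrow>
     (\<exists>X \<mu> p. finite X \<and> keisler L U X \<mu> \<and> definable \<kappa> L U X \<mu> \<and> p \<in> support L U X \<mu> \<and>
        (\<forall>A. A \<subseteq> dom U \<and> |A| <o \<kappa> \<longrightarrow> \<not> type_invariant_over L U X A p))"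

end

theory Submission
  imports Defs
begin

text \<open>
If \<open>\<mu>\<close> is finitely satisfiable in \<open>M\<close>, then a type \<open>p\<close> in its support cannot separate two tuples
\<open>b\<close>, \<open>b'\<close> of the same type over \<open>M\<close>: the formula \<open>\<phi>(x;b) \<and> \<not> \<phi>(x;b')\<close> would lie in \<open>p\<close>, hence have
positive measure, hence a solution in \<open>M\<close>, and that solution would tell \<open>b\<close> from \<open>b'\<close>. If all types in
the support are \<open>M\<close>-invariant, then \<open>\<phi>(x;b) \<and> \<not> \<phi>(x;b')\<close> has measure zero, because a formula of positive
measure lies in some type of the support (\<open>positive_formula_in_support\<close>); so \<open>\<mu>\<close> is \<open>M\<close>-invariant.

Now let \<open>\<mu>\<close> be \<open>M\<close>-invariant and \<open>T\<close> NIP, and let \<open>b\<close>, \<open>b'\<close> have the same type over \<open>M\<close>. That type is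
finitely satisfiable in \<open>M\<close>, so it is given by an ultrafilter on the tuples of \<open>M\<close>, and this ultrafilter
defines a coheir over every larger set. Realizing it again and again yields a
sequence \<open>c\<close> such that both \<open>b, c 0, c 1, \<dots>\<close> and \<open>b', c 0, c 1, \<dots>\<close> are coheir sequences. These
are indiscernible over \<open>M\<close> (\<open>coheir_sequence_indiscernible\<close>). If a type in the support separated the
first two terms of such a sequence \<open>d\<close>, then all differences \<open>\<phi>(x; d (2 i)) \<triangle> \<phi>(x; d (2 i + 1))\<close>
would have one and the same positive measure. By averaging, some point would satisfy as many of them as
desired (\<open>keisler_frequently\<close>), so the truth value of \<open>\<phi>\<close> would alternate many times along \<open>d\<close>, and
indiscernibility would turn the alternation into a shattered set (\<open>nip_alternation_bound\<close>). Hence a type in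
the support treats \<open>b\<close> like \<open>c 0\<close> and \<open>c 0\<close> like \<open>b'\<close>.

For the last claim take the generic ternary relation \<open>R\<close>. In its models a type over a set is determined by
its quantifier-free part, by back-and-forth (\<open>back_and_forth\<close>). Decide \<open>R(x,b,c)\<close> by an independent
fair coin for each pair \<open>(b,c)\<close>, and let \<open>R\<close> fail at all other triples in which the new point \<open>x\<close>
occurs. The measure of a formula with finitely many parameters is then a count of outcomes divided by a power
of two, which depends only on the quantifier-free type of the parameters; so this measure is definable. Every
outcome, that is, every binary relation \<open>\<omega>\<close> on the model, gives a type in the support. Choose for \<open>\<omega>\<close> a
well-order: it treats \<open>(b,b')\<close> and \<open>(b',b)\<close> differently for all \<open>b \<noteq> b'\<close>, while over each small set there
are \<open>b \<noteq> b'\<close> that can be exchanged without changing their joint type (\<open>swappable_pair\<close>). Finally, monster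
models of this theory exist: if every element of the model codes a small set together with
the behaviour of \<open>R\<close> between this set and the element itself, then every behaviour over every small set
occurs, and this is saturation (\<open>saturated_if_generic\<close>).
\<close>

section \<open>Parameters and variables\<close>

lemma tval_cong: "(\<And>v. v \<in> fvt t \<Longrightarrow> e v = e' v) \<Longrightarrow> tval U e t = tval U e' t"
proof (induction t)
  case (App f ts)
  then have "map (tval U e) ts = map (tval U e') ts"
    by (auto intro!: map_cong)
  then show ?case by (simp only: tval.simps)
qed simp

lemma sat_cong: "(\<And>v. v \<in> fv \<phi> \<Longrightarrow> e v = e' v) \<Longrightarrow> sat U e \<phi> = sat U e' \<phi>"
proof (induction \<phi> arbitrary: e e')
  case (Eq s t)
  then show ?case using tval_cong[of s e e' U] tval_cong[of t e e' U] by simp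
next
  case (Rel r ts)
  then have "map (tval U e) ts = map (tval U e') ts"
    by (auto intro!: map_cong tval_cong)
  then show ?case by (simp only: sat.simps)
next
  case (Conj \<phi> \<psi>)
  then show ?case by (metis UnI1 UnI2 fv.simps(4) sat.simps(4))
next
  case (Ex n \<phi>)
  have "sat U (e(n := a)) \<phi> = sat U (e'(n := a)) \<phi>" for a
    using Ex.prems by (intro Ex.IH) auto
  then show ?case by (simp only: sat.simps)
next
  case (Neg \<phi>)
  then show ?case by (metis fv.simps(3) sat.simps(3))
qed

lemma sat_Disj [simp]: "sat U e (Disj \<phi> \<psi>) \<longleftrightarrow> sat U e \<phi> \<or> sat U e \<psi>"
  by (simp add: Disj_def)

lemma lang_par_simps [simp]:
  "fsyms (lang_par L A) = fsyms L <+> A" "farity (lang_par L A) (Inl f) = farity L f"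
  "farity (lang_par L A) (Inr a) = 0"
  "rsyms (lang_par L A) = rsyms L" "rarity (lang_par L A) = rarity L"
  by (simp_all add: lang_par_def)

lemma struct_par_simps [simp]:
  "dom (struct_par U) = dom U" "fint (struct_par U) (Inl f) = fint U f"
  "fint (struct_par U) (Inr a) as = a" "rint (struct_par U) = rint U"
  by (simp_all add: struct_par_def)

lemma wf_trm_App [simp]:
  "wf_trm L (App f ts) \<longleftrightarrow> f \<in> fsyms L \<and> length ts = farity L f \<and> (\<forall>t\<in>set ts. wf_trm L t)"
  by (simp add: list_all_iff)

declare wf_trm.simps(2) [simp del]

lemma fms_simps [simp]:
  "Neg \<phi> \<in> fms_over L A X \<longleftrightarrow> \<phi> \<in> fms_over L A X"
  "Conj \<phi> \<psi> \<in> fms_over L A X \<longleftrightarrow> \<phi> \<in> fms_over L A X \<and> \<psi> \<in> fms_over L A X"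
  "Disj \<phi> \<psi> \<in> fms_over L A X \<longleftrightarrow> \<phi> \<in> fms_over L A X \<and> \<psi> \<in> fms_over L A X"
  by (auto simp: fms_over_def Disj_def)

lemma wf_trm_mono: "wf_trm (lang_par L A) t \<Longrightarrow> A \<subseteq> B \<Longrightarrow> wf_trm (lang_par L B) t"
proof (induction t)
  case (App f ts)
  then show ?case by (cases f) auto
qed simp

lemma wf_fm_mono: "wf_fm (lang_par L A) \<phi> \<Longrightarrow> A \<subseteq> B \<Longrightarrow> wf_fm (lang_par L B) \<phi>"
  by (induction \<phi>) (auto simp: list_all_iff intro: wf_trm_mono)

lemma fms_over_mono:
  "\<phi> \<in> fms_over L A X \<Longrightarrow> A \<subseteq> B \<Longrightarrow> X \<subseteq> Y \<Longrightarrow> \<phi> \<in> fms_over L B Y"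
  by (auto simp: fms_over_def intro: wf_fm_mono)

lemma tval_inst:
  "tval (struct_par U) e (inst_trm Y b t) = tval (struct_par U) (override_on e b Y) t"
proof (induction t)
  case (App f ts)
  then have "map (tval (struct_par U) e) (map (inst_trm Y b) ts)
      = map (tval (struct_par U) (override_on e b Y)) ts" by simp
  then show ?case by (simp only: tval.simps inst_trm.simps)
qed simp

lemma satp_inst: "satp U e (inst Y b \<phi>) \<longleftrightarrow> satp U (override_on e b Y) \<phi>"
proof (induction \<phi> arbitrary: e Y)
  case (Rel r ts)
  have "map (tval (struct_par U) e) (map (inst_trm Y b) ts)
      = map (tval (struct_par U) (override_on e b Y)) ts" by (simp add: tval_inst)
  then show ?case by (simp only: sat.simps inst.simps)
next
  case (Ex n \<phi>)
  have "override_on (e(n := a)) b (Y - {n}) = (override_on e b Y)(n := a)" for a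
    by (auto simp: override_on_def)
  with Ex show ?case by (simp only: inst.simps sat.simps)
qed (simp_all add: tval_inst)

lemma wf_inst_trm:
  "wf_trm (lang_par L A) t \<Longrightarrow> A \<subseteq> B \<Longrightarrow> b ` (Y \<inter> fvt t) \<subseteq> B \<Longrightarrow> wf_trm (lang_par L B) (inst_trm Y b t)"
proof (induction t)
  case (App f ts)
  have "wf_trm (lang_par L B) (inst_trm Y b t)" if "t \<in> set ts" for t
    using App.prems that by (intro App.IH; cases f; fastforce)
  with App.prems show ?case by (cases f) auto
qed auto

lemma fvt_inst: "fvt (inst_trm Y b t) = fvt t - Y"
  by (induction t) auto

lemma wf_inst:
  "wf_fm (lang_par L A) \<phi> \<Longrightarrow> A \<subseteq> B \<Longrightarrow> b ` (Y \<inter> fv \<phi>) \<subseteq> B \<Longrightarrow> wf_fm (lang_par L B) (inst Y b \<phi>)"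
proof (induction \<phi> arbitrary: Y)
  case (Rel r ts)
  then have "wf_trm (lang_par L B) (inst_trm Y b t)" if "t \<in> set ts" for t
    using that by (intro wf_inst_trm[of L A]) (auto simp: list_all_iff)
  with Rel show ?case by (auto simp: list_all_iff)
next
  case (Conj \<phi> \<psi>)
  have "b ` (Y \<inter> fv \<phi>) \<subseteq> B" "b ` (Y \<inter> fv \<psi>) \<subseteq> B" using Conj.prems by auto
  with Conj show ?case by simp
next
  case (Ex n \<phi>)
  show ?case using Ex.prems by (simp, intro Ex.IH) auto
qed (auto intro!: wf_inst_trm)

lemma fv_inst: "fv (inst Y b \<phi>) = fv \<phi> - Y"
  by (induction \<phi> arbitrary: Y) (auto simp: fvt_inst)

lemma inst_in_fms_over:
  assumes "\<phi> \<in> fms_over L A (X \<union> Y)" "A \<subseteq> B" "b ` Y \<subseteq> B"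
  shows "inst Y b \<phi> \<in> fms_over L B X"
  using assms wf_inst[of L A \<phi> B b Y] by (auto simp: fms_over_def fv_inst)

definition Top :: "('f, 'r) fm" where
  "Top = Neg (Ex 0 (Neg (Eq (Var 0) (Var 0))))"

primrec conjs :: "('f, 'r) fm list \<Rightarrow> ('f, 'r) fm" where
  "conjs [] = Top"
| "conjs (\<phi> # \<phi>s) = Conj \<phi> (conjs \<phi>s)"

definition exs :: "nat list \<Rightarrow> ('f, 'r) fm \<Rightarrow> ('f, 'r) fm" where
  "exs ns \<phi> = foldr Ex ns \<phi>"

lemma sat_Top [simp]: "sat U e Top" by (simp add: Top_def)

lemma sat_conjs [simp]: "sat U e (conjs \<phi>s) \<longleftrightarrow> (\<forall>\<phi>\<in>set \<phi>s. sat U e \<phi>)"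
  by (induction \<phi>s) auto

lemma wf_conjs [simp]: "wf_fm L (conjs \<phi>s) \<longleftrightarrow> (\<forall>\<phi>\<in>set \<phi>s. wf_fm L \<phi>)"
  by (induction \<phi>s) (auto simp: Top_def)

lemma fv_conjs [simp]: "fv (conjs \<phi>s) = (\<Union>\<phi>\<in>set \<phi>s. fv \<phi>)"
  by (induction \<phi>s) (auto simp: Top_def)

lemma wf_exs [simp]: "wf_fm L (exs ns \<phi>) \<longleftrightarrow> wf_fm L \<phi>"
  by (induction ns) (auto simp: exs_def)

lemma fv_exs [simp]: "fv (exs ns \<phi>) = fv \<phi> - set ns"
  by (induction ns) (auto simp: exs_def)

lemma sat_exs:
  "sat U e (exs ns \<phi>) \<longleftrightarrow> (\<exists>a. a \<in> set ns \<rightarrow> dom U \<and> sat U (override_on e a (set ns)) \<phi>)"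
proof (induction ns arbitrary: e)
  case Nil
  then show ?case by (simp add: exs_def)
next
  case (Cons n ns)
  have "sat U e (exs (n # ns) \<phi>) \<longleftrightarrow> (\<exists>c\<in>dom U. sat U (e(n := c)) (exs ns \<phi>))"
    by (simp add: exs_def)
  also have "\<dots> \<longleftrightarrow> (\<exists>c\<in>dom U. \<exists>a. a \<in> set ns \<rightarrow> dom U \<and>
      sat U (override_on (e(n := c)) a (set ns)) \<phi>)"
    by (simp only: Cons.IH)
  also have "\<dots> \<longleftrightarrow> (\<exists>a. a \<in> set (n # ns) \<rightarrow> dom U \<and> sat U (override_on e a (set (n # ns))) \<phi>)"
    (is "?l = ?r")
  proof
    assume ?l
    then obtain c a where c: "c \<in> dom U" "a \<in> set ns \<rightarrow> dom U"
      "sat U (override_on (e(n := c)) a (set ns)) \<phi>" by blast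
    have "override_on (e(n := c)) a (set ns)
        = override_on e (if n \<in> set ns then a else a(n := c)) (set (n # ns))"
      by (auto simp: override_on_def)
    with c show ?r
      by (intro exI[of _ "if n \<in> set ns then a else a(n := c)"]) auto
  next
    assume ?r
    then obtain a where a: "a \<in> set (n # ns) \<rightarrow> dom U" "sat U (override_on e a (set (n # ns))) \<phi>"
      by blast
    have "override_on (e(n := a n)) a (set ns) = override_on e a (set (n # ns))"
      by (auto simp: override_on_def)
    with a show ?l by (intro bexI[of _ "a n"] exI[of _ a]) auto
  qed
  finally show ?case .
qed

text \<open>Renaming by syntactic substitution would have to avoid capture. The formula
\<open>\<exists>y. y = \<pi>(y) \<and> \<phi>(x,y)\<close> renames without touching \<open>\<phi>\<close>: the new variables occur only in equations in
front of \<open>\<phi>\<close>, outside the scope of its quantifiers. This needs the new variables to be different from the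
old ones.\<close>

lemma rename_variables:
  assumes "\<phi> \<in> fms_over L A (X \<union> Y)" "finite Y" "X \<inter> Y = {}" "\<pi> ` Y \<inter> Y = {}"
  obtains \<phi>' where "\<phi>' \<in> fms_over L A (X \<union> \<pi> ` Y)"
    "\<forall>U e. (\<forall>y\<in>Y. e (\<pi> y) \<in> dom U)
        \<longrightarrow> (satp U e \<phi>' \<longleftrightarrow> satp U (override_on e (e \<circ> \<pi>) Y) \<phi>)"
proof -
  obtain ys where ys: "set ys = Y" using finite_list[OF assms(2)] by blast
  define \<phi>' where "\<phi>' = exs ys (Conj (conjs (map (\<lambda>y. Eq (Var y) (Var (\<pi> y))) ys)) \<phi>)"
  show thesis
  proof
    show "\<phi>' \<in> fms_over L A (X \<union> \<pi> ` Y)"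
      using assms(1,3,4) ys by (auto simp: \<phi>'_def fms_over_def)
  next
    show "\<forall>U e. (\<forall>y\<in>Y. e (\<pi> y) \<in> dom U)
        \<longrightarrow> (satp U e \<phi>' \<longleftrightarrow> satp U (override_on e (e \<circ> \<pi>) Y) \<phi>)"
    proof (intro allI impI)
    fix U :: "('a, 'c, 'b) struct" and e
    assume e: "\<forall>y\<in>Y. e (\<pi> y) \<in> dom U"
    have fresh: "\<pi> y \<notin> Y" if "y \<in> Y" for y using assms(4) that by blast
    have "satp U e \<phi>' \<longleftrightarrow> (\<exists>a. a \<in> Y \<rightarrow> dom U \<and> (\<forall>y\<in>Y. a y = e (\<pi> y))
        \<and> satp U (override_on e a Y) \<phi>)"
      unfolding \<phi>'_def sat_exs using ys fresh by (auto simp: override_on_def)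
    also have "\<dots> \<longleftrightarrow> satp U (override_on e (e \<circ> \<pi>) Y) \<phi>"
    proof
      assume "\<exists>a. a \<in> Y \<rightarrow> dom U \<and> (\<forall>y\<in>Y. a y = e (\<pi> y)) \<and> satp U (override_on e a Y) \<phi>"
      then obtain a where a: "\<forall>y\<in>Y. a y = e (\<pi> y)" "satp U (override_on e a Y) \<phi>" by blast
      then have "override_on e a Y = override_on e (e \<circ> \<pi>) Y" by (auto simp: override_on_def)
      with a show "satp U (override_on e (e \<circ> \<pi>) Y) \<phi>" by simp
    next
      assume "satp U (override_on e (e \<circ> \<pi>) Y) \<phi>"
      with e show "\<exists>a. a \<in> Y \<rightarrow> dom U \<and> (\<forall>y\<in>Y. a y = e (\<pi> y)) \<and> satp U (override_on e a Y) \<phi>"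
        by (intro exI[of _ "e \<circ> \<pi>"]) auto
    qed
    finally show "satp U e \<phi>' \<longleftrightarrow> satp U (override_on e (e \<circ> \<pi>) Y) \<phi>" .
    qed
  qed
qed

text \<open>NIP speaks about formulas of \<open>L\<close>, and so does the definition of an elementary substructure, whereas measures and
types involve formulas of \<open>L(A)\<close>. The functions below replace the constant naming \<open>a\<close> by the variable
\<open>g a\<close>; this inverts \<^const>\<open>inst\<close> as long as no \<open>g a\<close> is bound in the formula.\<close>

primrec abs_trm :: "('a \<Rightarrow> nat) \<Rightarrow> ('f + 'a) trm \<Rightarrow> 'f trm" where
  "abs_trm g (Var n) = Var n"
| "abs_trm g (App f ts) =
     (case f of Inl f' \<Rightarrow> App f' (map (abs_trm g) ts) | Inr a \<Rightarrow> Var (g a))"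

primrec abs_fm :: "('a \<Rightarrow> nat) \<Rightarrow> ('f + 'a, 'r) fm \<Rightarrow> ('f, 'r) fm" where
  "abs_fm g (Eq s t) = Eq (abs_trm g s) (abs_trm g t)"
| "abs_fm g (Rel r ts) = Rel r (map (abs_trm g) ts)"
| "abs_fm g (Neg \<phi>) = Neg (abs_fm g \<phi>)"
| "abs_fm g (Conj \<phi> \<psi>) = Conj (abs_fm g \<phi>) (abs_fm g \<psi>)"
| "abs_fm g (Ex n \<phi>) = Ex n (abs_fm g \<phi>)"

primrec bound_vars :: "('f, 'r) fm \<Rightarrow> nat set" where
  "bound_vars (Eq s t) = {}"
| "bound_vars (Rel r ts) = {}"
| "bound_vars (Neg \<phi>) = bound_vars \<phi>"
| "bound_vars (Conj \<phi> \<psi>) = bound_vars \<phi> \<union> bound_vars \<psi>"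
| "bound_vars (Ex n \<phi>) = insert n (bound_vars \<phi>)"

lemma finite_bound_vars: "finite (bound_vars \<phi>)" by (induction \<phi>) auto

lemma finite_parameters_trm:
  "wf_trm (lang_par L A) t \<Longrightarrow> \<exists>C. finite C \<and> C \<subseteq> A \<and> wf_trm (lang_par L C) t"
proof (induction t)
  case (Var n)
  then show ?case by (intro exI[of _ "{}"]) simp
next
  case (App f ts)
  then have "\<forall>t\<in>set ts. \<exists>C. finite C \<and> C \<subseteq> A \<and> wf_trm (lang_par L C) t" by simp
  then obtain C where C: "\<And>t. t \<in> set ts \<Longrightarrow> finite (C t) \<and> C t \<subseteq> A \<and> wf_trm (lang_par L (C t)) t"
    by metis
  define D where "D = (\<Union>t\<in>set ts. C t) \<union> (case f of Inl _ \<Rightarrow> {} | Inr a \<Rightarrow> {a})"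
  have "wf_trm (lang_par L D) t" if "t \<in> set ts" for t
    using C[OF that] that by (auto simp: D_def intro: wf_trm_mono)
  then have "finite D \<and> D \<subseteq> A \<and> wf_trm (lang_par L D) (App f ts)"
    using C App.prems by (cases f) (auto simp: D_def)
  then show ?case by blast
qed

lemma finite_parameters_wf:
  "wf_fm (lang_par L A) \<phi> \<Longrightarrow> \<exists>C. finite C \<and> C \<subseteq> A \<and> wf_fm (lang_par L C) \<phi>"
proof (induction \<phi>)
  case (Eq s t)
  then obtain C D where "finite C" "C \<subseteq> A" "wf_trm (lang_par L C) s"
    "finite D" "D \<subseteq> A" "wf_trm (lang_par L D) t"
    using finite_parameters_trm[of L A] by (metis wf_fm.simps(1))
  then show ?case by (intro exI[of _ "C \<union> D"]) (auto intro: wf_trm_mono)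
next
  case (Rel r ts)
  then have "\<forall>t\<in>set ts. \<exists>C. finite C \<and> C \<subseteq> A \<and> wf_trm (lang_par L C) t"
    by (auto simp: list_all_iff intro!: finite_parameters_trm)
  then obtain C where C: "\<And>t. t \<in> set ts \<Longrightarrow> finite (C t) \<and> C t \<subseteq> A \<and> wf_trm (lang_par L (C t)) t"
    by metis
  have "wf_trm (lang_par L (\<Union>t\<in>set ts. C t)) t" if "t \<in> set ts" for t
    using C[OF that] that by (auto intro: wf_trm_mono)
  with Rel C show ?case
    by (intro exI[of _ "\<Union>t\<in>set ts. C t"]) (auto simp: list_all_iff)
next
  case (Conj \<phi> \<psi>)
  then obtain C D where "finite C" "C \<subseteq> A" "wf_fm (lang_par L C) \<phi>"
    "finite D" "D \<subseteq> A" "wf_fm (lang_par L D) \<psi>" by auto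
  then show ?case by (intro exI[of _ "C \<union> D"]) (auto intro: wf_fm_mono)
qed auto

lemma finite_parameters:
  assumes "\<phi> \<in> fms_over L A X"
  obtains C where "finite C" "C \<subseteq> A" "\<phi> \<in> fms_over L C X"
  using assms finite_parameters_wf[of L A \<phi>] by (auto simp: fms_over_def)

text \<open>A conjunction puts finitely many formulas over one finite set of parameters.\<close>

lemma finite_parameters_set:
  assumes "finite \<Delta>" "\<Delta> \<subseteq> fms_over L A X"
  obtains C where "finite C" "C \<subseteq> A" "\<Delta> \<subseteq> fms_over L C X"
proof -
  obtain \<phi>s where \<phi>s: "set \<phi>s = \<Delta>" using finite_list[OF assms(1)] by auto
  then have "conjs \<phi>s \<in> fms_over L A X" using assms(2) by (auto simp: fms_over_def)
  then obtain C where "finite C" "C \<subseteq> A" "conjs \<phi>s \<in> fms_over L C X" by (rule finite_parameters)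
  then show thesis using \<phi>s by (intro that[of C]) (auto simp: fms_over_def)
qed

lemma tval_abs:
  assumes "wf_trm (lang_par L A) t" "\<And>a. a \<in> A \<Longrightarrow> e (g a) = a"
  shows "tval U e (abs_trm g t) = tval (struct_par U) e t"
  using assms(1)
proof (induction t)
  case (App f ts)
  then have "map (tval U e) (map (abs_trm g) ts) = map (tval (struct_par U) e) ts" by auto
  with App.prems assms(2) show ?case by (cases f) (auto simp del: map_map)
qed simp

lemma sat_abs:
  assumes "wf_fm (lang_par L A) \<phi>" "\<And>a. a \<in> A \<Longrightarrow> e (g a) = a" "g ` A \<inter> bound_vars \<phi> = {}"
  shows "sat U e (abs_fm g \<phi>) = satp U e \<phi>"
  using assms
proof (induction \<phi> arbitrary: e)
  case (Eq s t)
  then show ?case by (simp add: tval_abs[of L A])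
next
  case (Rel r ts)
  then have "map (tval U e) (map (abs_trm g) ts) = map (tval (struct_par U) e) ts"
    by (auto simp: tval_abs[of L A] list_all_iff)
  then show ?case by (simp del: map_map)
next
  case (Conj \<phi> \<psi>)
  then show ?case by (simp add: Int_Un_distrib)
next
  case (Ex n \<phi>)
  have "sat U (e(n := c)) (abs_fm g \<phi>) = satp U (e(n := c)) \<phi>" for c
    using Ex.prems by (intro Ex.IH) auto
  then show ?case by simp
qed simp_all

lemma wf_abs_trm:
  "wf_trm (lang_par L A) t \<Longrightarrow> wf_trm L (abs_trm g t) \<and> fvt (abs_trm g t) \<subseteq> fvt t \<union> g ` A"
proof (induction t)
  case (App f ts)
  then show ?case by (cases f) fastforce+
qed simp

lemma wf_abs:
  "wf_fm (lang_par L A) \<phi> \<Longrightarrow> wf_fm L (abs_fm g \<phi>) \<and> fv (abs_fm g \<phi>) \<subseteq> fv \<phi> \<union> g ` A"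
proof (induction \<phi>)
  case (Eq s t)
  then show ?case using wf_abs_trm[of L A s g] wf_abs_trm[of L A t g] by auto
next
  case (Rel r ts)
  then show ?case using wf_abs_trm[of L A _ g] by (fastforce simp: list_all_iff)
qed auto

lemma abstract_parameters:
  assumes "\<phi> \<in> fms_over L A X" "finite W"
  obtains Z m \<phi>' where "finite Z" "Z \<inter> W = {}" "m \<in> Z \<rightarrow>\<^sub>E A" "wf_fm L \<phi>'" "fv \<phi>' \<subseteq> X \<union> Z"
    "\<forall>U e. sat U (override_on e m Z) \<phi>' \<longleftrightarrow> satp U (override_on e m Z) \<phi>"
proof -
  obtain C where C: "finite C" "C \<subseteq> A" "\<phi> \<in> fms_over L C X"
    using finite_parameters[OF assms(1)] .
  obtain h :: "'b \<Rightarrow> nat" where h: "inj_on h C"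
    using finite_imp_inj_to_nat_seg[OF C(1)] by blast
  define N where "N = Suc (Max (insert 0 (W \<union> bound_vars \<phi>)))"
  have N: "v < N" if "v \<in> W \<union> bound_vars \<phi>" for v
    using that assms(2) finite_bound_vars[of \<phi>] by (auto simp: N_def less_Suc_eq_le intro!: Max_ge)
  define g where "g = (\<lambda>a. N + h a)"
  have g: "inj_on g C" using h by (auto simp: g_def inj_on_def)
  define m where "m = restrict (inv_into C g) (g ` C)"
  have m: "m (g a) = a" if "a \<in> C" for a using g that by (simp add: m_def)
  show thesis
  proof
    show "finite (g ` C)" using C by simp
    show "g ` C \<inter> W = {}" using N by (fastforce simp: g_def)
    show "m \<in> g ` C \<rightarrow>\<^sub>E A" using m C(2) by (auto simp: m_def PiE_iff extensional_def)
    show "wf_fm L (abs_fm g \<phi>)" "fv (abs_fm g \<phi>) \<subseteq> X \<union> g ` C"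
      using wf_abs[of L C \<phi> g] C(3) by (auto simp: fms_over_def)
    have "sat U (override_on e m (g ` C)) (abs_fm g \<phi>) \<longleftrightarrow> satp U (override_on e m (g ` C)) \<phi>"
      for U :: "('a, 'c, 'b) struct" and e
    proof (rule sat_abs)
      show "wf_fm (lang_par L C) \<phi>" using C(3) by (simp add: fms_over_def)
      show "override_on e m (g ` C) (g a) = a" if "a \<in> C" for a using m that by simp
      show "g ` C \<inter> bound_vars \<phi> = {}" using N by (fastforce simp: g_def)
    qed
    then show "\<forall>U e. sat U (override_on e m (g ` C)) (abs_fm g \<phi>)
        \<longleftrightarrow> satp U (override_on e m (g ` C)) \<phi>" by blast
  qed
qed

section \<open>Ultrafilters and types\<close>

text \<open>Ultrafilters on a whole type. An ultrafilter on a set \<open>S\<close> is one that contains \<open>S\<close>.\<close>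

definition ultra :: "'b set set \<Rightarrow> bool" where
  "ultra W \<longleftrightarrow> {} \<notin> W \<and> (\<forall>A\<in>W. \<forall>B\<in>W. A \<inter> B \<in> W) \<and> (\<forall>A. A \<in> W \<or> - A \<in> W)"

definition fip :: "'b set set \<Rightarrow> bool" where
  "fip F \<longleftrightarrow> (\<forall>G. finite G \<and> G \<subseteq> F \<longrightarrow> \<Inter> G \<noteq> {})"

lemma ultra_superset:
  assumes "ultra W" "A \<in> W" "A \<subseteq> B"
  shows "B \<in> W"
proof (rule ccontr)
  assume "B \<notin> W"
  with assms have "A \<inter> - B \<in> W" by (auto simp: ultra_def)
  moreover have "A \<inter> - B = {}" using assms by auto
  ultimately show False using assms by (simp add: ultra_def)
qed

lemma ultra_Compl: "ultra W \<Longrightarrow> - A \<in> W \<longleftrightarrow> A \<notin> W"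
  unfolding ultra_def by (metis Compl_disjoint)

lemma ultra_Int: "ultra W \<Longrightarrow> A \<inter> B \<in> W \<longleftrightarrow> A \<in> W \<and> B \<in> W"
  using ultra_superset[of W "A \<inter> B" A] ultra_superset[of W "A \<inter> B" B]
  by (metis Int_lower1 Int_lower2 ultra_def)

lemma ultra_Inter: "finite G \<Longrightarrow> ultra W \<Longrightarrow> G \<subseteq> W \<Longrightarrow> \<Inter> G \<in> W"
proof (induction G rule: finite_induct)
  case empty
  then have "{} \<in> W \<or> - {} \<in> W" "{} \<notin> W" unfolding ultra_def by blast+
  then show ?case by simp
next
  case (insert A G)
  then show ?case by (simp add: ultra_Int)
qed

text \<open>By Zorn's lemma there is a maximal family with the finite intersection property; it contains every set that meets all
its finite intersections, and this makes it an ultrafilter.\<close>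

lemma ultrafilter_exists:
  assumes "fip F"
  obtains W where "ultra W" "F \<subseteq> W"
proof -
  let ?P = "{G. F \<subseteq> G \<and> fip G}"
  have "\<exists>W\<in>?P. \<forall>G\<in>?P. W \<subseteq> G \<longrightarrow> G = W"
  proof (rule subset_Zorn_nonempty)
    show "?P \<noteq> {}" using assms by blast
  next
    fix \<C> assume \<C>: "\<C> \<noteq> {}" "subset.chain ?P \<C>"
    have "fip (\<Union>\<C>)"
      unfolding fip_def
    proof (intro allI impI)
      fix G assume G: "finite G \<and> G \<subseteq> \<Union>\<C>"
      then obtain B where "B \<in> \<C>" "G \<subseteq> B"
        using finite_subset_Union_chain[of G \<C> ?P] \<C> by blast
      moreover from this have "fip B" using \<C> by (auto simp: subset.chain_def)
      ultimately show "\<Inter> G \<noteq> {}" using G by (simp add: fip_def)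
    qed
    have "F \<subseteq> B" if "B \<in> \<C>" for B using \<C> that by (auto simp: subset.chain_def)
    then have "F \<subseteq> \<Union>\<C>" using \<C>(1) by blast
    with \<open>fip (\<Union>\<C>)\<close> show "\<Union>\<C> \<in> ?P" by simp
  qed
  then obtain W where W: "F \<subseteq> W" "fip W" and max: "\<And>G. fip G \<Longrightarrow> W \<subseteq> G \<Longrightarrow> G = W" by auto
  have mem: "A \<in> W" if "\<And>G. finite G \<Longrightarrow> G \<subseteq> W \<Longrightarrow> A \<inter> \<Inter> G \<noteq> {}" for A
  proof -
    have "fip (insert A W)"
      unfolding fip_def
    proof (intro allI impI)
      fix G assume G: "finite G \<and> G \<subseteq> insert A W"
      then have "A \<inter> \<Inter> (G - {A}) \<noteq> {}" by (intro that) auto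
      then show "\<Inter> G \<noteq> {}" by blast
    qed
    then show ?thesis using max[of "insert A W"] by blast
  qed
  have "ultra W"
    unfolding ultra_def
  proof (intro conjI ballI allI)
    show "{} \<notin> W" using W(2)[unfolded fip_def, rule_format, of "{{}}"] by auto
  next
    fix A B assume AB: "A \<in> W" "B \<in> W"
    show "A \<inter> B \<in> W"
    proof (rule mem)
      fix G assume "finite G" "G \<subseteq> W"
      then have "\<Inter> (insert A (insert B G)) \<noteq> {}"
        using AB by (intro W(2)[unfolded fip_def, rule_format]) auto
      then show "A \<inter> B \<inter> \<Inter> G \<noteq> {}" by (simp add: Int_assoc)
    qed
  next
    fix A
    show "A \<in> W \<or> - A \<in> W"
    proof (rule ccontr)
      assume neg: "\<not> (A \<in> W \<or> - A \<in> W)"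
      obtain G where G: "finite G" "G \<subseteq> W" "A \<inter> \<Inter> G = {}" using mem[of A] neg by blast
      obtain H where H: "finite H" "H \<subseteq> W" "- A \<inter> \<Inter> H = {}" using mem[of "- A"] neg by blast
      have "\<Inter> (G \<union> H) \<noteq> {}" using G H by (intro W(2)[unfolded fip_def, rule_format]) auto
      then show False using G(3) H(3) by blast
    qed
  qed
  with W(1) show thesis by (rule that[rotated])
qed

definition sols :: "('f, 'r, 'a) struct \<Rightarrow> nat set \<Rightarrow> ('f + 'a, 'r) fm \<Rightarrow> (nat \<Rightarrow> 'a) set" where
  "sols U X \<phi> = {a \<in> X \<rightarrow>\<^sub>E dom U. satp U a \<phi>}"

text \<open>An ultrafilter on tuples decides every formula, over every set of parameters at once. Both the
coheirs of a type and the types in the support of a measure are obtained in this way.\<close>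

lemma type_of_ultrafilter:
  assumes "ultra W" "(X \<rightarrow>\<^sub>E dom U) \<in> W"
  shows "{\<psi> \<in> fms_over L A X. sols U X \<psi> \<in> W} \<in> types L U A X"
  unfolding types_def
proof (intro CollectI conjI)
  let ?p = "{\<psi> \<in> fms_over L A X. sols U X \<psi> \<in> W}"
  show "fin_sat U X ?p"
    unfolding fin_sat_def
  proof (intro allI impI)
    fix \<Delta> assume \<Delta>: "finite \<Delta> \<and> \<Delta> \<subseteq> ?p"
    have "\<Inter> (insert (X \<rightarrow>\<^sub>E dom U) (sols U X ` \<Delta>)) \<in> W"
      using assms \<Delta> by (intro ultra_Inter) auto
    then have "\<Inter> (insert (X \<rightarrow>\<^sub>E dom U) (sols U X ` \<Delta>)) \<noteq> {}"
      using assms(1) unfolding ultra_def by metis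
    then show "\<exists>a\<in>X \<rightarrow>\<^sub>E dom U. \<forall>\<phi>\<in>\<Delta>. satp U a \<phi>" by (auto simp: sols_def)
  qed
  show "\<forall>\<phi>\<in>fms_over L A X. \<phi> \<in> ?p \<or> Neg \<phi> \<in> ?p"
  proof
    fix \<phi> assume \<phi>: "\<phi> \<in> fms_over L A X"
    have "sols U X (Neg \<phi>) = (X \<rightarrow>\<^sub>E dom U) \<inter> - sols U X \<phi>" by (auto simp: sols_def)
    with \<phi> assms show "\<phi> \<in> ?p \<or> Neg \<phi> \<in> ?p" by (auto simp: ultra_Int ultra_Compl)
  qed
qed auto

lemma fin_satD:
  "fin_sat U X p \<Longrightarrow> finite \<Delta> \<Longrightarrow> \<Delta> \<subseteq> p \<Longrightarrow> \<exists>a\<in>X \<rightarrow>\<^sub>E dom U. \<forall>\<phi>\<in>\<Delta>. satp U a \<phi>"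
  by (simp add: fin_sat_def)

lemma type_finitely_satisfied:
  assumes "p \<in> types L U A X" "finite \<Delta>" "\<Delta> \<subseteq> p"
  obtains a where "a \<in> X \<rightarrow>\<^sub>E dom U" "\<And>\<phi>. \<phi> \<in> \<Delta> \<Longrightarrow> satp U a \<phi>"
proof -
  have "fin_sat U X p" using assms(1) by (simp add: types_def)
  from fin_satD[OF this assms(2,3)] that show thesis by blast
qed

lemma Neg_in_type:
  assumes "p \<in> types L U A X" "\<phi> \<in> fms_over L A X"
  shows "Neg \<phi> \<in> p \<longleftrightarrow> \<phi> \<notin> p"
proof -
  have "\<not> (\<phi> \<in> p \<and> Neg \<phi> \<in> p)"
  proof
    assume "\<phi> \<in> p \<and> Neg \<phi> \<in> p"
    then have "finite {\<phi>, Neg \<phi>}" "{\<phi>, Neg \<phi>} \<subseteq> p" by auto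
    then obtain a where "\<And>\<psi>. \<psi> \<in> {\<phi>, Neg \<phi>} \<Longrightarrow> satp U a \<psi>"
      using type_finitely_satisfied[OF assms(1)] by metis
    from this[of \<phi>] this[of "Neg \<phi>"] show False by simp
  qed
  then show ?thesis using assms by (auto simp: types_def)
qed

lemma type_deductively_closed:
  assumes p: "p \<in> types L U A X" and \<Delta>: "finite \<Delta>" "\<Delta> \<subseteq> p" and \<psi>: "\<psi> \<in> fms_over L A X"
    and imp: "\<And>a. a \<in> X \<rightarrow>\<^sub>E dom U \<Longrightarrow> (\<And>\<phi>. \<phi> \<in> \<Delta> \<Longrightarrow> satp U a \<phi>) \<Longrightarrow> satp U a \<psi>"
  shows "\<psi> \<in> p"
proof (rule ccontr)
  assume "\<psi> \<notin> p"
  then have "Neg \<psi> \<in> p" using Neg_in_type[OF p \<psi>] by simp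
  with \<Delta> have "finite (insert (Neg \<psi>) \<Delta>)" "insert (Neg \<psi>) \<Delta> \<subseteq> p" by auto
  then obtain a where a: "a \<in> X \<rightarrow>\<^sub>E dom U" "\<And>\<phi>. \<phi> \<in> insert (Neg \<psi>) \<Delta> \<Longrightarrow> satp U a \<phi>"
    using type_finitely_satisfied[OF p] by metis
  have "satp U a \<psi>" using a by (intro imp) auto
  with a(2)[of "Neg \<psi>"] show False by simp
qed

lemma type_Conj:
  assumes "p \<in> types L U A X" "\<phi> \<in> p" "\<psi> \<in> p"
  shows "Conj \<phi> \<psi> \<in> p"
proof (rule type_deductively_closed[OF assms(1), of "{\<phi>, \<psi>}"])
  show "Conj \<phi> \<psi> \<in> fms_over L A X" using assms by (auto simp: types_def)
  show "satp U a (Conj \<phi> \<psi>)" if "\<And>\<theta>. \<theta> \<in> {\<phi>, \<psi>} \<Longrightarrow> satp U a \<theta>" for a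
    using that[of \<phi>] that[of \<psi>] by simp
qed (use assms in auto)

text \<open>The set \<open>S\<close> is all of \<open>U\<^sup>X\<close> when a type is completed, and \<open>M\<^sup>X\<close> when a coheir is formed.\<close>

lemma ultrafilter_of_finitely_satisfiable:
  assumes "\<And>\<Delta>. finite \<Delta> \<Longrightarrow> \<Delta> \<subseteq> \<Gamma> \<Longrightarrow> \<exists>a\<in>S. \<forall>\<phi>\<in>\<Delta>. satp U a \<phi>" "S \<subseteq> X \<rightarrow>\<^sub>E dom U"
  obtains W where "ultra W" "S \<in> W" "sols U X ` \<Gamma> \<subseteq> W"
proof -
  have "fip (insert S (sols U X ` \<Gamma>))"
    unfolding fip_def
  proof (intro allI impI)
    fix G assume G: "finite G \<and> G \<subseteq> insert S (sols U X ` \<Gamma>)"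
    then have "finite (G - {S})" "G - {S} \<subseteq> sols U X ` \<Gamma>" by auto
    from finite_subset_image[OF this]
    obtain \<Delta> where \<Delta>: "\<Delta> \<subseteq> \<Gamma>" "finite \<Delta>" "G - {S} = sols U X ` \<Delta>"
      by (elim exE conjE)
    obtain a where a: "a \<in> S" "\<forall>\<phi>\<in>\<Delta>. satp U a \<phi>"
      using assms(1)[OF \<Delta>(2,1)] by blast
    then have "\<forall>B \<in> sols U X ` \<Delta>. a \<in> B" using assms(2) by (auto simp: sols_def)
    then have "a \<in> \<Inter> (insert S (G - {S}))" using a(1) \<Delta>(3) by simp
    then show "\<Inter> G \<noteq> {}" by blast
  qed
  then obtain W where "ultra W" "insert S (sols U X ` \<Gamma>) \<subseteq> W"
    by (rule ultrafilter_exists)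
  then show thesis by (intro that[of W]) auto
qed

lemma partial_type_realized:
  assumes sat: "saturated \<kappa> L U" and A: "A \<subseteq> dom U" "|A| <o \<kappa>" "finite X"
    and \<Gamma>: "\<Gamma> \<subseteq> fms_over L A X" "fin_sat U X \<Gamma>"
  obtains a where "a \<in> X \<rightarrow>\<^sub>E dom U" "\<forall>\<phi>\<in>\<Gamma>. satp U a \<phi>"
proof -
  obtain W where W: "ultra W" "(X \<rightarrow>\<^sub>E dom U) \<in> W" "sols U X ` \<Gamma> \<subseteq> W"
    using fin_satD[OF \<Gamma>(2)] by (rule ultrafilter_of_finitely_satisfiable[OF _ order_refl])
  define p where "p = {\<psi> \<in> fms_over L A X. sols U X \<psi> \<in> W}"
  have "p \<in> types L U A X" unfolding p_def using W(1,2) by (rule type_of_ultrafilter)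
  then obtain a where a: "a \<in> X \<rightarrow>\<^sub>E dom U" "tp L U A X a = p"
    using sat[unfolded saturated_def, rule_format, of A X p] A by auto
  have "\<forall>\<phi>\<in>\<Gamma>. satp U a \<phi>"
  proof
    fix \<phi> assume "\<phi> \<in> \<Gamma>"
    then have "\<phi> \<in> p" using W(3) \<Gamma>(1) by (auto simp: p_def)
    then show "satp U a \<phi>" using a(2) by (auto simp: tp_def)
  qed
  with a(1) show thesis by (rule that)
qed

lemma small_union_finite:
  assumes "Card_order \<kappa>" "natLeq <o \<kappa>" "|A| <o \<kappa>" "finite B"
  shows "|A \<union> B| <o \<kappa>"
proof (rule card_of_Un_ordLess_infinite_Field)
  show "\<not> finite (Field \<kappa>)"
    using cinfinite_mono[OF ordLess_imp_ordLeq[OF assms(2)] natLeq_cinfinite] by (simp add: cinfinite_def)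
  show "|B| <o \<kappa>"
    using ordLess_transitive[OF _ assms(2)] assms(4) by (simp add: finite_iff_ordLess_natLeq)
qed fact+

lemma countable_small:
  assumes "natLeq <o \<kappa>" "countable A"
  shows "|A| <o \<kappa>"
proof -
  have "|A| \<le>o |UNIV :: nat set|"
    using assms(2) by (auto simp: countable_def card_of_ordLeq[symmetric])
  then have "|A| \<le>o natLeq" using card_of_nat by (rule ordLeq_ordIso_trans)
  then show ?thesis using assms(1) by (rule ordLeq_ordLess_trans)
qed

section \<open>Keisler measures\<close>

context
  fixes L :: "('f, 'r) lang" and U :: "('f, 'r, 'a) struct" and X \<mu>
  assumes keisler: "keisler L U X \<mu>"
begin

abbreviation "DX \<equiv> fms_over L (dom U) X"

lemma keisler_nonneg: "\<phi> \<in> DX \<Longrightarrow> 0 \<le> \<mu> \<phi>"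
  by (rule keisler[unfolded keisler_def, THEN conjunct1, rule_format])

lemma keisler_valid: "\<phi> \<in> DX \<Longrightarrow> (\<And>a. a \<in> X \<rightarrow>\<^sub>E dom U \<Longrightarrow> satp U a \<phi>) \<Longrightarrow> \<mu> \<phi> = 1"
  by (rule keisler[unfolded keisler_def, THEN conjunct2, THEN conjunct1, rule_format])

lemma keisler_equiv:
  "\<phi> \<in> DX \<Longrightarrow> \<psi> \<in> DX \<Longrightarrow> (\<And>a. a \<in> X \<rightarrow>\<^sub>E dom U \<Longrightarrow> satp U a \<phi> \<longleftrightarrow> satp U a \<psi>) \<Longrightarrow> \<mu> \<phi> = \<mu> \<psi>"
  by (rule keisler[unfolded keisler_def, THEN conjunct2, THEN conjunct2, THEN conjunct1, rule_format])

lemma keisler_add: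
  assumes "\<phi> \<in> DX" "\<psi> \<in> DX" "\<And>a. a \<in> X \<rightarrow>\<^sub>E dom U \<Longrightarrow> \<not> (satp U a \<phi> \<and> satp U a \<psi>)"
  shows "\<mu> (Disj \<phi> \<psi>) = \<mu> \<phi> + \<mu> \<psi>"
proof -
  have "\<forall>a \<in> X \<rightarrow>\<^sub>E dom U. \<not> satp U a (Conj \<phi> \<psi>)" using assms(3) by simp
  then show ?thesis
    using keisler[unfolded keisler_def, THEN conjunct2, THEN conjunct2, THEN conjunct2] assms(1,2)
    by blast
qed

lemma keisler_split:
  assumes "\<phi> \<in> DX" "\<psi> \<in> DX"
  shows "\<mu> \<phi> = \<mu> (Conj \<phi> \<psi>) + \<mu> (Conj \<phi> (Neg \<psi>))"
proof -
  have "\<mu> \<phi> = \<mu> (Disj (Conj \<phi> \<psi>) (Conj \<phi> (Neg \<psi>)))"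
    by (rule keisler_equiv) (use assms in auto)
  also have "\<dots> = \<mu> (Conj \<phi> \<psi>) + \<mu> (Conj \<phi> (Neg \<psi>))"
    by (rule keisler_add) (use assms in auto)
  finally show ?thesis .
qed

lemma keisler_unsat:
  assumes "\<phi> \<in> DX" "\<And>a. a \<in> X \<rightarrow>\<^sub>E dom U \<Longrightarrow> \<not> satp U a \<phi>"
  shows "\<mu> \<phi> = 0"
proof -
  have "\<mu> (Disj \<phi> \<phi>) = \<mu> \<phi> + \<mu> \<phi>" by (rule keisler_add) (use assms in auto)
  moreover have "\<mu> (Disj \<phi> \<phi>) = \<mu> \<phi>" by (rule keisler_equiv) (use assms in auto)
  ultimately show ?thesis by simp
qed

lemma keisler_mono:
  assumes "\<phi> \<in> DX" "\<psi> \<in> DX" "\<And>a. a \<in> X \<rightarrow>\<^sub>E dom U \<Longrightarrow> satp U a \<phi> \<Longrightarrow> satp U a \<psi>"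
  shows "\<mu> \<phi> \<le> \<mu> \<psi>"
proof -
  have "\<mu> \<psi> = \<mu> (Conj \<psi> \<phi>) + \<mu> (Conj \<psi> (Neg \<phi>))" using assms by (intro keisler_split)
  moreover have "\<mu> (Conj \<psi> \<phi>) = \<mu> \<phi>" by (rule keisler_equiv) (use assms in auto)
  ultimately show ?thesis using keisler_nonneg[of "Conj \<psi> (Neg \<phi>)"] assms by simp
qed

lemma keisler_satisfiable:
  assumes "\<phi> \<in> DX" "\<mu> \<phi> > 0"
  obtains a where "a \<in> X \<rightarrow>\<^sub>E dom U" "satp U a \<phi>"
proof -
  have "\<exists>a \<in> X \<rightarrow>\<^sub>E dom U. satp U a \<phi>" using keisler_unsat[OF assms(1)] assms(2) by (metis less_irrefl)
  with that show thesis by blast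
qed

lemma null_conjs:
  assumes "\<theta> \<in> DX" "set \<phi>s \<subseteq> DX" "\<And>\<phi>. \<phi> \<in> set \<phi>s \<Longrightarrow> \<mu> (Conj \<theta> (Neg \<phi>)) = 0"
  shows "\<mu> (Conj \<theta> (conjs \<phi>s)) = \<mu> \<theta>"
  using assms(2,3)
proof (induction \<phi>s)
  case Nil
  have "Top \<in> DX" by (simp add: fms_over_def Top_def)
  then show ?case using assms(1) by (intro keisler_equiv) auto
next
  case (Cons \<phi> \<phi>s)
  have c: "conjs \<phi>s \<in> DX" using Cons.prems by (auto simp: fms_over_def)
  have "\<mu> \<theta> = \<mu> (Conj \<theta> (conjs \<phi>s))" using Cons by simp
  also have "\<dots> = \<mu> (Conj (Conj \<theta> (conjs \<phi>s)) \<phi>) + \<mu> (Conj (Conj \<theta> (conjs \<phi>s)) (Neg \<phi>))"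
    using assms(1) c Cons.prems by (intro keisler_split) auto
  also have "\<mu> (Conj (Conj \<theta> (conjs \<phi>s)) \<phi>) = \<mu> (Conj \<theta> (conjs (\<phi> # \<phi>s)))"
    using assms(1) c Cons.prems by (intro keisler_equiv) auto
  also have "\<mu> (Conj (Conj \<theta> (conjs \<phi>s)) (Neg \<phi>)) = 0"
  proof -
    have "\<mu> (Conj (Conj \<theta> (conjs \<phi>s)) (Neg \<phi>)) \<le> \<mu> (Conj \<theta> (Neg \<phi>))"
      using assms(1) c Cons.prems by (intro keisler_mono) auto
    then show ?thesis using Cons.prems assms(1) c
      keisler_nonneg[of "Conj (Conj \<theta> (conjs \<phi>s)) (Neg \<phi>)"] by simp
  qed
  finally show ?case by simp
qed

text \<open>The formulas containing \<open>\<theta>\<close> up to measure zero are closed under conjunction and satisfiable together with \<open>\<theta>\<close>.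
A type that contains all of them contains no formula \<open>\<psi>\<close> of measure zero, since \<open>\<not> \<psi>\<close> is among them.\<close>

lemma positive_formula_in_support:
  assumes \<theta>: "\<theta> \<in> DX" "\<mu> \<theta> > 0"
  obtains p where "p \<in> support L U X \<mu>" "\<theta> \<in> p"
proof -
  let ?\<Gamma> = "{\<psi> \<in> DX. \<mu> (Conj \<theta> (Neg \<psi>)) = 0}"
  have "\<exists>a\<in>X \<rightarrow>\<^sub>E dom U. \<forall>\<phi>\<in>\<Delta>. satp U a \<phi>" if \<Delta>: "finite \<Delta>" "\<Delta> \<subseteq> ?\<Gamma>" for \<Delta>
  proof -
    obtain \<phi>s where \<phi>s: "set \<phi>s = \<Delta>" using finite_list[OF \<Delta>(1)] by auto
    have "\<mu> (Conj \<theta> (conjs \<phi>s)) = \<mu> \<theta>" using \<theta> \<phi>s \<Delta> by (intro null_conjs) auto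
    moreover have "Conj \<theta> (conjs \<phi>s) \<in> DX" using \<theta> \<phi>s \<Delta> by (auto simp: fms_over_def)
    ultimately obtain a where "a \<in> X \<rightarrow>\<^sub>E dom U" "satp U a (Conj \<theta> (conjs \<phi>s))"
      using keisler_satisfiable \<theta>(2) by metis
    then show "\<exists>a\<in>X \<rightarrow>\<^sub>E dom U. \<forall>\<phi>\<in>\<Delta>. satp U a \<phi>" using \<phi>s by auto
  qed
  then obtain W where W: "ultra W" "(X \<rightarrow>\<^sub>E dom U) \<in> W" "sols U X ` ?\<Gamma> \<subseteq> W"
    by (rule ultrafilter_of_finitely_satisfiable[OF _ order_refl])
  define p where "p = {\<psi> \<in> DX. sols U X \<psi> \<in> W}"
  have p: "p \<in> types L U (dom U) X" unfolding p_def using W(1,2) by (rule type_of_ultrafilter)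
  have \<Gamma>: "\<psi> \<in> p" if "\<psi> \<in> ?\<Gamma>" for \<psi> 
    using that W(3) by (auto simp: p_def simp del: fms_simps)
  have "\<mu> (Conj \<theta> (Neg \<theta>)) = 0" by (rule keisler_unsat) (use \<theta> in auto)
  then have "\<theta> \<in> p" using \<theta> by (intro \<Gamma>) simp
  moreover have "\<mu> \<psi> > 0" if "\<psi> \<in> p" for \<psi>
  proof (rule ccontr)
    assume "\<not> \<mu> \<psi> > 0"
    have \<psi>: "\<psi> \<in> DX" using that by (simp add: p_def)
    have "\<mu> (Conj \<theta> (Neg (Neg \<psi>))) \<le> \<mu> \<psi>" using \<theta> \<psi> by (intro keisler_mono) auto
    then have "\<mu> (Conj \<theta> (Neg (Neg \<psi>))) = 0"
      using \<open>\<not> \<mu> \<psi> > 0\<close> keisler_nonneg[of "Conj \<theta> (Neg (Neg \<psi>))"] \<theta> \<psi> by simp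
    then have "Neg \<psi> \<in> p" using \<psi> by (intro \<Gamma>) simp
    then show False using Neg_in_type[OF p \<psi>] that by simp
  qed
  ultimately show thesis using p by (intro that[of p]) (auto simp: support_def)
qed

text \<open>This is the inequality between the integral of a counting function bounded by \<open>k\<close> on \<open>\<psi>\<close> and
\<open>k \<mu>(\<psi>)\<close>. Induction on the number of formulas avoids integration: split \<open>\<psi>\<close> along the last formula; on the
part where it holds, at most \<open>k - 1\<close> of the others hold.\<close>

lemma keisler_count_bound:
  fixes N :: nat
  assumes "\<And>i. i < N \<Longrightarrow> \<theta> i \<in> DX" "\<psi> \<in> DX"
    "\<And>a. a \<in> X \<rightarrow>\<^sub>E dom U \<Longrightarrow> satp U a \<psi> \<Longrightarrow> card {i. i < N \<and> satp U a (\<theta> i)} \<le> k"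
  shows "(\<Sum>i<N. \<mu> (Conj \<psi> (\<theta> i))) \<le> real k * \<mu> \<psi>"
  using assms
proof (induction N arbitrary: \<psi> k)
  case 0
  then show ?case using keisler_nonneg by simp
next
  case (Suc N)
  have \<theta>: "\<theta> i \<in> DX" if "i \<le> N" for i using Suc.prems(1) that by simp
  define \<psi>1 \<psi>2 where "\<psi>1 = Conj \<psi> (\<theta> N)" and "\<psi>2 = Conj \<psi> (Neg (\<theta> N))"
  have \<psi>12: "\<psi>1 \<in> DX" "\<psi>2 \<in> DX" using \<theta> Suc.prems(2) by (auto simp: \<psi>1_def \<psi>2_def)
  have sub: "{i. i < N \<and> satp U a (\<theta> i)} \<subseteq> {i. i < Suc N \<and> satp U a (\<theta> i)}" for a by auto
  have "(\<Sum>i<N. \<mu> (Conj \<psi> (\<theta> i))) = (\<Sum>i<N. \<mu> (Conj \<psi>1 (\<theta> i)) + \<mu> (Conj \<psi>2 (\<theta> i)))"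
  proof (rule sum.cong)
    fix i assume "i \<in> {..<N}"
    then have i: "\<theta> i \<in> DX" using \<theta> by simp
    have "\<mu> (Conj \<psi> (\<theta> i)) = \<mu> (Conj (Conj \<psi> (\<theta> i)) (\<theta> N)) + \<mu> (Conj (Conj \<psi> (\<theta> i)) (Neg (\<theta> N)))"
      using i \<theta> Suc.prems(2) by (intro keisler_split) auto
    moreover have "\<mu> (Conj (Conj \<psi> (\<theta> i)) (\<theta> N)) = \<mu> (Conj \<psi>1 (\<theta> i))"
      using i \<theta> Suc.prems(2) by (intro keisler_equiv) (auto simp: \<psi>1_def)
    moreover have "\<mu> (Conj (Conj \<psi> (\<theta> i)) (Neg (\<theta> N))) = \<mu> (Conj \<psi>2 (\<theta> i))"
      using i \<theta> Suc.prems(2) by (intro keisler_equiv) (auto simp: \<psi>2_def)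
    ultimately show "\<mu> (Conj \<psi> (\<theta> i)) = \<mu> (Conj \<psi>1 (\<theta> i)) + \<mu> (Conj \<psi>2 (\<theta> i))" by simp
  qed simp
  also have "\<dots> = (\<Sum>i<N. \<mu> (Conj \<psi>1 (\<theta> i))) + (\<Sum>i<N. \<mu> (Conj \<psi>2 (\<theta> i)))"
    by (rule sum.distrib)
  also have "(\<Sum>i<N. \<mu> (Conj \<psi>1 (\<theta> i))) + \<mu> \<psi>1 \<le> real k * \<mu> \<psi>1"
  proof (cases k)
    case 0
    have "\<not> satp U a \<psi>1" if "a \<in> X \<rightarrow>\<^sub>E dom U" for a
    proof
      assume a: "satp U a \<psi>1"
      then have "{i. i < Suc N \<and> satp U a (\<theta> i)} = {}"
        using Suc.prems(3)[OF that] 0 by (simp add: \<psi>1_def)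
      with a show False by (auto simp: \<psi>1_def)
    qed
    then have "\<mu> \<psi>1 = 0" "\<And>i. i < N \<Longrightarrow> \<mu> (Conj \<psi>1 (\<theta> i)) = 0"
      using \<theta> \<psi>12 by (auto intro!: keisler_unsat)
    then show ?thesis by simp
  next
    case (Suc k')
    have "(\<Sum>i<N. \<mu> (Conj \<psi>1 (\<theta> i))) \<le> real k' * \<mu> \<psi>1"
    proof (rule Suc.IH)
      fix a assume a: "a \<in> X \<rightarrow>\<^sub>E dom U" "satp U a \<psi>1"
      have "{i. i < Suc N \<and> satp U a (\<theta> i)} = insert N {i. i < N \<and> satp U a (\<theta> i)}"
        using a by (auto simp: \<psi>1_def less_Suc_eq)
      then have "Suc (card {i. i < N \<and> satp U a (\<theta> i)}) \<le> k"
        using Suc.prems(3)[OF a(1)] a(2) by (simp add: \<psi>1_def)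
      with Suc show "card {i. i < N \<and> satp U a (\<theta> i)} \<le> k'" by simp
    qed (use \<theta> \<psi>12 in auto)
    with Suc show ?thesis by (simp add: algebra_simps)
  qed
  moreover have "(\<Sum>i<N. \<mu> (Conj \<psi>2 (\<theta> i))) \<le> real k * \<mu> \<psi>2"
  proof (rule Suc.IH)
    fix a assume a: "a \<in> X \<rightarrow>\<^sub>E dom U" "satp U a \<psi>2"
    then have "card {i. i < Suc N \<and> satp U a (\<theta> i)} \<le> k" using Suc.prems(3) by (simp add: \<psi>2_def)
    moreover have "card {i. i < N \<and> satp U a (\<theta> i)} \<le> card {i. i < Suc N \<and> satp U a (\<theta> i)}"
      by (intro card_mono sub) auto
    ultimately show "card {i. i < N \<and> satp U a (\<theta> i)} \<le> k" by simp
  qed (use \<theta> \<psi>12 in auto)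
  moreover have "\<mu> \<psi> = \<mu> \<psi>1 + \<mu> \<psi>2"
    unfolding \<psi>1_def \<psi>2_def using \<theta> Suc.prems(2) by (intro keisler_split) auto
  ultimately show ?case by (simp add: \<psi>1_def algebra_simps)
qed

text \<open>The averaging principle: if \<open>N\<close> events have probability at least \<open>\<epsilon>\<close> each, then at some point at least
\<open>N \<epsilon>\<close> of them occur.\<close>

lemma keisler_frequently:
  assumes "\<And>i. i < N \<Longrightarrow> \<theta> i \<in> DX" "\<And>i. i < N \<Longrightarrow> \<mu> (\<theta> i) \<ge> \<epsilon>" "real N * \<epsilon> > real k"
  obtains a where "a \<in> X \<rightarrow>\<^sub>E dom U" "card {i. i < N \<and> satp U a (\<theta> i)} > k"
proof (rule ccontr)
  assume *: "\<not> thesis"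
  have T: "Top \<in> DX" by (auto simp: fms_over_def Top_def)
  have "(\<Sum>i<N. \<mu> (Conj Top (\<theta> i))) \<le> real k * \<mu> Top"
    using assms T * that by (intro keisler_count_bound) (auto simp: not_less[symmetric])
  moreover have "\<mu> Top = 1" by (rule keisler_valid) (use T in auto)
  moreover have "\<mu> (Conj Top (\<theta> i)) = \<mu> (\<theta> i)" if "i < N" for i
    by (rule keisler_equiv) (use assms that T in auto)
  ultimately have "(\<Sum>i<N. \<mu> (\<theta> i)) \<le> real k" by simp
  moreover have "(\<Sum>i<N. \<epsilon>) \<le> (\<Sum>i<N. \<mu> (\<theta> i))" using assms by (intro sum_mono) auto
  ultimately show False using assms(3) by simp
qed

section \<open>Finite satisfiability, invariant support and invariance\<close>

lemma finitely_satisfiable_imp_invariantly_supported: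
  assumes "finitely_satisfiable \<kappa> L U X \<mu>"
  shows "invariantly_supported \<kappa> L U X \<mu>"
proof -
  obtain M where M: "small_model \<kappa> L M U"
    and fs: "\<And>\<phi>. \<phi> \<in> DX \<Longrightarrow> \<mu> \<phi> > 0 \<Longrightarrow> \<exists>a \<in> X \<rightarrow>\<^sub>E M. satp U a \<phi>"
    using assms by (auto simp: finitely_satisfiable_def)
  have MU: "M \<subseteq> dom U" using M by (simp add: small_model_def elem_sub_def)
  have imp: "inst Y b' \<phi> \<in> p"
    if p: "p \<in> support L U X \<mu>" and \<phi>: "\<phi> \<in> fms_over L M (X \<union> Y)" and XY: "X \<inter> Y = {}"
      and b: "b \<in> Y \<rightarrow>\<^sub>E dom U" "b' \<in> Y \<rightarrow>\<^sub>E dom U" "tp L U M Y b = tp L U M Y b'"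
      and b_in: "inst Y b \<phi> \<in> p"
    for p Y \<phi> b b'
  proof (rule ccontr)
    assume neg: "inst Y b' \<phi> \<notin> p"
    have pt: "p \<in> types L U (dom U) X" using p by (simp add: support_def)
    have in_DX: "inst Y b \<phi> \<in> DX" "inst Y b' \<phi> \<in> DX"
      using \<phi> MU b by (auto intro!: inst_in_fms_over[where A = M])
    let ?\<theta> = "Conj (inst Y b \<phi>) (Neg (inst Y b' \<phi>))"
    have "?\<theta> \<in> p"
      using neg b_in by (intro type_Conj[OF pt]) (simp_all add: Neg_in_type[OF pt in_DX(2)])
    then have "\<mu> ?\<theta> > 0" using p by (simp add: support_def)
    then obtain a where a: "a \<in> X \<rightarrow>\<^sub>E M" "satp U a ?\<theta>" using fs[of ?\<theta>] in_DX by auto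
    \<comment> \<open>The variables of \<open>X\<close> and \<open>Y\<close> change roles: \<open>\<phi>(a;y)\<close> is a formula over \<open>M\<close>, true of both or neither of \<open>b\<close>, \<open>b'\<close>.\<close>
    have swap: "override_on a c Y v = override_on c a X v"
      if "c \<in> Y \<rightarrow>\<^sub>E dom U" "v \<in> X \<union> Y" for c v
      using a(1) that XY by (auto simp: override_on_def)
    have *: "satp U a (inst Y c \<phi>) \<longleftrightarrow> satp U c (inst X a \<phi>)" if "c \<in> Y \<rightarrow>\<^sub>E dom U" for c
      unfolding satp_inst using \<phi> swap[OF that] by (intro sat_cong) (auto simp: fms_over_def)
    have "inst X a \<phi> \<in> fms_over L M Y"
      using \<phi> a(1) by (intro inst_in_fms_over[where A = M]) (auto simp: Un_commute)
    then have "satp U b (inst X a \<phi>) \<longleftrightarrow> satp U b' (inst X a \<phi>)" using b(3) by (auto simp: tp_def)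
    with a(2) *[OF b(1)] *[OF b(2)] show False by simp
  qed
  have "type_invariant_over L U X M p" if "p \<in> support L U X \<mu>" for p
    unfolding type_invariant_over_def using imp[OF that] by metis
  with M show ?thesis by (auto simp: invariantly_supported_def)
qed

lemma invariantly_supported_imp_invariant:
  assumes "invariantly_supported \<kappa> L U X \<mu>"
  shows "invariant \<kappa> L U X \<mu>"
proof -
  obtain M where M: "small_model \<kappa> L M U"
    and inv: "\<And>p. p \<in> support L U X \<mu> \<Longrightarrow> type_invariant_over L U X M p"
    using assms by (auto simp: invariantly_supported_def)
  have MU: "M \<subseteq> dom U" using M by (simp add: small_model_def elem_sub_def)
  have le: "\<mu> (inst Y b \<phi>) \<le> \<mu> (inst Y b' \<phi>)"
    if Y: "finite Y" "X \<inter> Y = {}" and \<phi>: "\<phi> \<in> fms_over L M (X \<union> Y)"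
      and b: "b \<in> Y \<rightarrow>\<^sub>E dom U" "b' \<in> Y \<rightarrow>\<^sub>E dom U" "tp L U M Y b = tp L U M Y b'"
    for Y \<phi> b b'
  proof (rule ccontr)
    assume neg: "\<not> \<mu> (inst Y b \<phi>) \<le> \<mu> (inst Y b' \<phi>)"
    have in_DX: "inst Y b \<phi> \<in> DX" "inst Y b' \<phi> \<in> DX"
      using \<phi> MU b by (auto intro!: inst_in_fms_over[where A = M])
    let ?\<theta> = "Conj (inst Y b \<phi>) (Neg (inst Y b' \<phi>))"
    have "\<mu> (inst Y b \<phi>) = \<mu> (Conj (inst Y b \<phi>) (inst Y b' \<phi>)) + \<mu> ?\<theta>"
      using in_DX by (intro keisler_split)
    moreover have "\<mu> (Conj (inst Y b \<phi>) (inst Y b' \<phi>)) \<le> \<mu> (inst Y b' \<phi>)"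
      using in_DX by (intro keisler_mono) auto
    ultimately have "\<mu> ?\<theta> > 0" using neg by linarith
    then obtain p where p: "p \<in> support L U X \<mu>" "?\<theta> \<in> p"
      using positive_formula_in_support[of ?\<theta>] in_DX by auto
    then have pt: "p \<in> types L U (dom U) X" by (simp add: support_def)
    have "inst Y b \<phi> \<in> p" "Neg (inst Y b' \<phi>) \<in> p"
      by (rule type_deductively_closed[OF pt, of "{?\<theta>}"]; use in_DX p in auto)+
    moreover have "inst Y b \<phi> \<in> p \<longleftrightarrow> inst Y b' \<phi> \<in> p"
      using inv[OF p(1)] Y \<phi> b unfolding type_invariant_over_def by blast
    ultimately show False using Neg_in_type[OF pt in_DX(2)] by simp
  qed
  have "invariant_over L U X M \<mu>"
    unfolding invariant_over_def by (intro allI impI order.antisym le) auto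
  with M show ?thesis by (auto simp: invariant_def)
qed

end

section \<open>Coheir sequences\<close>

lemma elem_sub_sat:
  fixes U :: "('f, 'r, 'a) struct"
  assumes "elem_sub L M U" "wf_fm L \<phi>" "\<And>v. v \<in> fv \<phi> \<Longrightarrow> e v \<in> M"
  shows "sat (U\<lparr>dom := M\<rparr>) e \<phi> \<longleftrightarrow> sat U e \<phi>"
proof -
  have "restrict e (fv \<phi>) \<in> fv \<phi> \<rightarrow>\<^sub>E M" using assms(3) by auto
  then have "sat (U\<lparr>dom := M\<rparr>) (restrict e (fv \<phi>)) \<phi> \<longleftrightarrow> sat U (restrict e (fv \<phi>)) \<phi>"
    using assms(1,2) by (simp add: elem_sub_def)
  moreover have "sat N (restrict e (fv \<phi>)) \<phi> \<longleftrightarrow> sat N e \<phi>" for N :: "('f, 'r, 'a) struct"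
    by (rule sat_cong) simp
  ultimately show ?thesis by simp
qed

text \<open>The Tarski--Vaught property for several variables at once, with parameters in \<open>M\<close>.\<close>

lemma elem_sub_satisfiable:
  fixes U :: "('f, 'r, 'a) struct"
  assumes M: "elem_sub L M U" and \<xi>: "\<xi> \<in> fms_over L M Y" "finite Y" and b: "b \<in> Y \<rightarrow>\<^sub>E dom U" "satp U b \<xi>"
  shows "\<exists>a \<in> Y \<rightarrow>\<^sub>E M. satp U a \<xi>"
proof -
  obtain Z m \<xi>' where Z: "finite Z" "Z \<inter> Y = {}" "m \<in> Z \<rightarrow>\<^sub>E M"
    and \<xi>': "wf_fm L \<xi>'" "fv \<xi>' \<subseteq> Y \<union> Z"
    and abs: "\<forall>U e. sat U (override_on e m Z) \<xi>' \<longleftrightarrow> satp U (override_on e m Z) \<xi>"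
    by (rule abstract_parameters[OF \<xi>])
  obtain ys where ys: "set ys = Y" using finite_list[OF \<xi>(2)] by auto
  have noZ: "satp U (override_on e m Z) \<xi> \<longleftrightarrow> satp U e \<xi>" for e
    using Z(2) \<xi>(1) by (intro sat_cong) (auto simp: fms_over_def override_on_def)
  have fv: "fv (exs ys \<xi>') \<subseteq> Z" using \<xi>'(2) ys by auto
  have swap: "override_on m a Y v = override_on a m Z v" if "v \<in> Y \<union> Z" for a v
    using that Z(2) by (auto simp: override_on_def)
  have swap': "sat N (override_on m a Y) \<xi>' \<longleftrightarrow> sat N (override_on a m Z) \<xi>'"
    for N :: "('f, 'r, 'a) struct" and a
    using swap \<xi>'(2) by (intro sat_cong) auto
  have "sat U (override_on m b Y) \<xi>'" using b(2) by (simp add: swap' abs noZ)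
  then have "sat U m (exs ys \<xi>')" using b(1) ys unfolding sat_exs by (auto intro: exI[of _ b])
  then have "sat (U\<lparr>dom := M\<rparr>) m (exs ys \<xi>')"
    using elem_sub_sat[OF M, of "exs ys \<xi>'" m] \<xi>'(1) fv Z(3) by auto
  then obtain a where a: "a \<in> Y \<rightarrow> M" "sat (U\<lparr>dom := M\<rparr>) (override_on m a Y) \<xi>'"
    using ys by (auto simp: sat_exs)
  have "override_on m a Y v \<in> M" if "v \<in> fv \<xi>'" for v
    using that \<xi>'(2) a(1) Z(2,3) by (auto simp: override_on_def)
  then have "sat U (override_on m a Y) \<xi>'"
    using elem_sub_sat[OF M \<xi>'(1)] a(2) by blast
  then have "satp U a \<xi>" by (simp add: swap' abs noZ)
  moreover have "satp U (restrict a Y) \<xi> \<longleftrightarrow> satp U a \<xi>"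
    using \<xi>(1) by (intro sat_cong) (auto simp: fms_over_def)
  ultimately show ?thesis using a(1) by (intro bexI[of _ "restrict a Y"]) auto
qed

text \<open>By elementarity the type of \<open>b\<close> over \<open>M\<close> is finitely satisfiable in \<open>M\<close>, so the ultrafilter may be
chosen on \<open>M\<^sup>Y\<close>.\<close>

lemma coheir_exists:
  assumes M: "elem_sub L M U" and "finite Y" and b: "b \<in> Y \<rightarrow>\<^sub>E dom U"
  obtains W where "ultra W" "(Y \<rightarrow>\<^sub>E M) \<in> W"
    "\<forall>\<psi>\<in>fms_over L M Y. satp U b \<psi> \<longleftrightarrow> sols U Y \<psi> \<in> W"
proof -
  have MU: "M \<subseteq> dom U" using M by (simp add: elem_sub_def)
  have "\<exists>a\<in>Y \<rightarrow>\<^sub>E M. \<forall>\<phi>\<in>\<Delta>. satp U a \<phi>" if \<Delta>: "finite \<Delta>" "\<Delta> \<subseteq> tp L U M Y b" for \<Delta>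
  proof -
    obtain \<phi>s where \<phi>s: "set \<phi>s = \<Delta>" using finite_list[OF \<Delta>(1)] by auto
    have "conjs \<phi>s \<in> fms_over L M Y" "satp U b (conjs \<phi>s)"
      using \<Delta>(2) \<phi>s by (auto simp: fms_over_def tp_def)
    then have "\<exists>a\<in>Y \<rightarrow>\<^sub>E M. satp U a (conjs \<phi>s)" by (intro elem_sub_satisfiable[OF M _ assms(2) b])
    then show ?thesis using \<phi>s by simp
  qed
  moreover have "(Y \<rightarrow>\<^sub>E M) \<subseteq> (Y \<rightarrow>\<^sub>E dom U)" using MU by (rule PiE_mono)
  ultimately obtain W where W: "ultra W" "(Y \<rightarrow>\<^sub>E M) \<in> W" "sols U Y ` tp L U M Y b \<subseteq> W"
    by (rule ultrafilter_of_finitely_satisfiable)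
  have "satp U b \<psi> \<longleftrightarrow> sols U Y \<psi> \<in> W" if \<psi>: "\<psi> \<in> fms_over L M Y" for \<psi>
  proof
    assume "satp U b \<psi>"
    then show "sols U Y \<psi> \<in> W" using W(3) \<psi> by (auto simp: tp_def)
  next
    assume *: "sols U Y \<psi> \<in> W"
    show "satp U b \<psi>"
    proof (rule ccontr)
      assume "\<not> satp U b \<psi>"
      then have "Neg \<psi> \<in> tp L U M Y b" using \<psi> by (simp add: tp_def)
      then have "sols U Y (Neg \<psi>) \<inter> sols U Y \<psi> \<in> W" using W(1,3) * by (auto simp: ultra_Int)
      moreover have "sols U Y (Neg \<psi>) \<inter> sols U Y \<psi> = {}" by (auto simp: sols_def)
      ultimately show False using W(1) by (simp add: ultra_def)
    qed
  qed
  with W(1,2) show thesis by (intro that) auto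
qed

text \<open>Each term realizes the type which the ultrafilter \<open>W\<close> defines over \<open>M\<close> and the previous terms.\<close>

definition coheir_sequence ::
    "('f, 'r) lang \<Rightarrow> ('f, 'r, 'a) struct \<Rightarrow> 'a set \<Rightarrow> nat set \<Rightarrow> (nat \<Rightarrow> 'a) set set
      \<Rightarrow> (nat \<Rightarrow> nat \<Rightarrow> 'a) \<Rightarrow> bool" where
  "coheir_sequence L U M Y W d \<longleftrightarrow> (\<forall>i. d i \<in> Y \<rightarrow>\<^sub>E dom U \<and>
     (\<forall>\<psi>\<in>fms_over L (M \<union> (\<Union>j<i. d j ` Y)) Y. satp U (d i) \<psi> \<longleftrightarrow> sols U Y \<psi> \<in> W))"

text \<open>One sequence \<open>c\<close> serves all starting points \<open>b \<in> S\<close>, because all of \<open>S\<close> is put among the parameters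
from the beginning.\<close>

lemma coheir_sequences_exist:
  assumes \<kappa>: "Card_order \<kappa>" "natLeq <o \<kappa>" and sat: "saturated \<kappa> L U"
    and M: "M \<subseteq> dom U" "|M| <o \<kappa>" and Y: "finite Y" and W: "ultra W" "(Y \<rightarrow>\<^sub>E M) \<in> W"
    and b: "\<And>b. b \<in> S \<Longrightarrow> b \<in> Y \<rightarrow>\<^sub>E dom U"
      "\<And>b \<psi>. b \<in> S \<Longrightarrow> \<psi> \<in> fms_over L M Y \<Longrightarrow> satp U b \<psi> \<longleftrightarrow> sols U Y \<psi> \<in> W"
    and S: "finite S"
  obtains c where "\<forall>b\<in>S. coheir_sequence L U M Y W (case_nat b c)"
proof -
  have "(Y \<rightarrow>\<^sub>E dom U) \<in> W" using ultra_superset[OF W] M(1) by (meson PiE_mono)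
  then have "{\<psi> \<in> fms_over L B Y. sols U Y \<psi> \<in> W} \<in> types L U B Y" for B
    by (rule type_of_ultrafilter[OF W(1)])
  then have "\<exists>a \<in> Y \<rightarrow>\<^sub>E dom U. tp L U B Y a = {\<psi> \<in> fms_over L B Y. sols U Y \<psi> \<in> W}"
    if "B \<subseteq> dom U" "|B| <o \<kappa>" for B
    using sat[unfolded saturated_def] that Y by blast
  then have "\<forall>B. \<exists>a. B \<subseteq> dom U \<and> |B| <o \<kappa> \<longrightarrow> a \<in> Y \<rightarrow>\<^sub>E dom U \<and>
      tp L U B Y a = {\<psi> \<in> fms_over L B Y. sols U Y \<psi> \<in> W}" by blast
  from choice[OF this] obtain R where "\<forall>B. B \<subseteq> dom U \<and> |B| <o \<kappa> \<longrightarrow> R B \<in> Y \<rightarrow>\<^sub>E dom U \<and>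
      tp L U B Y (R B) = {\<psi> \<in> fms_over L B Y. sols U Y \<psi> \<in> W}" by (rule exE)
  then have R: "R B \<in> Y \<rightarrow>\<^sub>E dom U" "tp L U B Y (R B) = {\<psi> \<in> fms_over L B Y. sols U Y \<psi> \<in> W}"
    if "B \<subseteq> dom U" "|B| <o \<kappa>" for B
    using that by simp_all
  define B where "B = rec_nat (M \<union> (\<Union>b\<in>S. b ` Y)) (\<lambda>_ B. B \<union> R B ` Y)"
  define c where "c n = R (B n)" for n
  have B0: "B 0 = M \<union> (\<Union>b\<in>S. b ` Y)" and BSuc: "B (Suc n) = B n \<union> c n ` Y" for n
    by (simp_all add: B_def c_def)
  have "B n \<subseteq> dom U \<and> |B n| <o \<kappa>" for n
  proof (induction n)
    case 0
    have "(\<Union>b\<in>S. b ` Y) \<subseteq> dom U" using b(1) by (fastforce simp: PiE_iff)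
    moreover have "finite (\<Union>b\<in>S. b ` Y)" using S Y by simp
    ultimately show ?case unfolding B0 using M by (simp add: small_union_finite[OF \<kappa> M(2)])
  next
    case (Suc n)
    then have "c n \<in> Y \<rightarrow>\<^sub>E dom U" using R(1) by (simp add: c_def)
    then have "c n ` Y \<subseteq> dom U" by auto
    with Suc show ?case unfolding BSuc using Y by (simp add: small_union_finite[OF \<kappa>])
  qed
  then have c: "c n \<in> Y \<rightarrow>\<^sub>E dom U" "tp L U (B n) Y (c n) = {\<psi> \<in> fms_over L (B n) Y. sols U Y \<psi> \<in> W}" for n
    using R by (simp_all add: c_def)
  have Bmono: "B j \<subseteq> B i" if "j \<le> i" for i j
    using that by (induction rule: dec_induct) (auto simp: BSuc)
  show thesis
  proof (rule that, rule ballI)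
    fix b0 assume b0: "b0 \<in> S"
    have "satp U (c i) \<psi> \<longleftrightarrow> sols U Y \<psi> \<in> W"
      if \<psi>: "\<psi> \<in> fms_over L (M \<union> (\<Union>j<Suc i. case_nat b0 c j ` Y)) Y" for i \<psi>
    proof -
      have "case_nat b0 c j ` Y \<subseteq> B i" if "j < Suc i" for j
      proof (cases j)
        case 0
        then show ?thesis using b0 Bmono[of 0 i] by (auto simp: B0)
      next
        case (Suc k)
        then show ?thesis using that Bmono[of "Suc k" i] by (auto simp: BSuc)
      qed
      moreover have "M \<subseteq> B i" using Bmono[of 0 i] by (auto simp: B0)
      ultimately have "M \<union> (\<Union>j<Suc i. case_nat b0 c j ` Y) \<subseteq> B i" by auto
      then have "\<psi> \<in> fms_over L (B i) Y" by (rule fms_over_mono[OF \<psi> _ order_refl])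
      moreover from this have "\<psi> \<in> tp L U (B i) Y (c i) \<longleftrightarrow> satp U (c i) \<psi>" by (simp add: tp_def)
      ultimately show ?thesis by (simp add: c(2))
    qed
    then show "coheir_sequence L U M Y W (case_nat b0 c)"
      using b[OF b0] c(1) unfolding coheir_sequence_def by (auto split: nat.split)
  qed
qed

text \<open>A formula about several terms of a sequence of \<open>Y\<close>-tuples needs a copy of \<open>Y\<close> for each term. The variable
\<open>enc s i y\<close> is the copy of \<open>y\<close> for the \<open>i\<close>-th term; all copies are at least \<open>s\<close>, so that they are
fresh if \<open>s\<close> bounds the variables in use. The assignment \<open>asg s c\<close> gives the copies the values
prescribed by the sequence \<open>c\<close>.\<close>

definition enc :: "nat \<Rightarrow> nat \<Rightarrow> nat \<Rightarrow> nat" where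
  "enc s i y = s + prod_encode (i, y)"

definition asg :: "nat \<Rightarrow> (nat \<Rightarrow> nat \<Rightarrow> 'a) \<Rightarrow> nat \<Rightarrow> 'a" where
  "asg s c v = (case prod_decode (v - s) of (i, y) \<Rightarrow> c i y)"

lemma asg_enc [simp]: "asg s c (enc s i y) = c i y"
  by (simp add: asg_def enc_def)

lemma enc_eq_iff [simp]: "enc s i y = enc s j z \<longleftrightarrow> i = j \<and> y = z"
  by (simp add: enc_def prod_encode_eq)

lemma enc_ge: "s \<le> enc s i y" by (simp add: enc_def)

abbreviation blocks :: "nat \<Rightarrow> nat set \<Rightarrow> nat \<Rightarrow> nat set" where
  "blocks s Y k \<equiv> (\<Union>i<k. enc s i ` Y)"

lemma blocks_Suc: "blocks s Y (Suc k) = enc s k ` Y \<union> blocks s Y k"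
  by (simp add: lessThan_Suc)

text \<open>The last block of variables can be quantified away by the ultrafilter: \<open>\<psi>\<close> holds with \<open>d (f k)\<close> in its
last block iff it holds with \<open>m\<close> there for almost all \<open>m \<in> M\<^sup>Y\<close>. The formula on the right has one block less
and parameters in \<open>M\<close> only, which makes induction on the number of blocks possible.\<close>

lemma coheir_step:
  assumes MU: "M \<subseteq> dom U" and Y: "finite Y" "\<And>y. y \<in> Y \<Longrightarrow> y < s"
    and W: "ultra W" "(Y \<rightarrow>\<^sub>E M) \<in> W" and d: "coheir_sequence L U M Y W d"
    and f: "\<And>i. i < k \<Longrightarrow> f i < f k" and \<psi>: "\<psi> \<in> fms_over L M (blocks s Y (Suc k))"
  shows "satp U (asg s (d \<circ> f)) \<psi> \<longleftrightarrow>
    {m \<in> Y \<rightarrow>\<^sub>E M. satp U (asg s (d \<circ> f)) (inst (enc s k ` Y) (m \<circ> inv_into Y (enc s k)) \<psi>)} \<in> W"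
proof -
  let ?e = "asg s (d \<circ> f)" and ?V = "blocks s Y k" and ?B = "M \<union> (\<Union>j<f k. d j ` Y)"
  let ?\<pi> = "inv_into Y (enc s k)"
  have \<pi>: "?\<pi> (enc s k y) = y" if "y \<in> Y" for y
    using that by (intro inv_into_f_f) (auto simp: inj_on_def)
  have \<pi>_im: "?\<pi> ` enc s k ` Y = Y" using \<pi> by (force simp: image_image)
  have fv: "fv \<psi> \<subseteq> enc s k ` Y \<union> ?V" using \<psi> unfolding blocks_Suc by (auto simp: fms_over_def)
  have disj: "?V \<inter> enc s k ` Y = {}" by auto
  have "?e ` ?V \<subseteq> ?B" using f by fastforce
  then have 1: "inst ?V ?e \<psi> \<in> fms_over L ?B ({} \<union> enc s k ` Y)"
    using \<psi> unfolding blocks_Suc by (intro inst_in_fms_over[where A = M]) auto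
  have 2: "finite (enc s k ` Y)" "{} \<inter> enc s k ` Y = {}" using Y(1) by auto
  have 3: "?\<pi> ` enc s k ` Y \<inter> enc s k ` Y = {}"
    unfolding \<pi>_im using Y(2) enc_ge by (force dest: leD)
  obtain \<psi>2 where \<psi>2: "\<psi>2 \<in> fms_over L ?B ({} \<union> ?\<pi> ` enc s k ` Y)"
    and sat2: "\<forall>U e. (\<forall>y\<in>enc s k ` Y. e (?\<pi> y) \<in> dom U) \<longrightarrow>
      (satp U e \<psi>2 \<longleftrightarrow> satp U (override_on e (e \<circ> ?\<pi>) (enc s k ` Y)) (inst ?V ?e \<psi>))"
    by (rule rename_variables[OF 1 2 3])
  have sat2': "satp U a \<psi>2 \<longleftrightarrow> satp U ?e (inst (enc s k ` Y) (a \<circ> ?\<pi>) \<psi>)"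
    if "a \<in> Y \<rightarrow>\<^sub>E dom U" for a
  proof -
    have "satp U a \<psi>2 \<longleftrightarrow> satp U (override_on a (a \<circ> ?\<pi>) (enc s k ` Y)) (inst ?V ?e \<psi>)"
      using that \<pi> by (intro sat2[rule_format]) auto
    also have "\<dots> \<longleftrightarrow> satp U ?e (inst (enc s k ` Y) (a \<circ> ?\<pi>) \<psi>)"
      unfolding satp_inst using fv disj by (intro sat_cong) (auto simp: override_on_def)
    finally show ?thesis .
  qed
  have dk: "d (f k) \<in> Y \<rightarrow>\<^sub>E dom U" using d by (simp add: coheir_sequence_def)
  have "satp U ?e \<psi> \<longleftrightarrow> satp U ?e (inst (enc s k ` Y) (d (f k) \<circ> ?\<pi>) \<psi>)"
    unfolding satp_inst using \<pi> by (intro sat_cong) (auto simp: override_on_def)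
  also have "\<dots> \<longleftrightarrow> satp U (d (f k)) \<psi>2" using sat2'[OF dk] by simp
  also have "\<dots> \<longleftrightarrow> sols U Y \<psi>2 \<in> W"
    using d \<psi>2 unfolding coheir_sequence_def \<pi>_im by simp
  also have "\<dots> \<longleftrightarrow> (Y \<rightarrow>\<^sub>E M) \<inter> sols U Y \<psi>2 \<in> W" using W by (simp add: ultra_Int)
  also have "(Y \<rightarrow>\<^sub>E M) \<inter> sols U Y \<psi>2 =
      {m \<in> Y \<rightarrow>\<^sub>E M. satp U ?e (inst (enc s k ` Y) (m \<circ> ?\<pi>) \<psi>)}"
  proof -
    have "m \<in> Y \<rightarrow>\<^sub>E dom U" if "m \<in> Y \<rightarrow>\<^sub>E M" for m using that MU by (auto simp: PiE_iff)
    then show ?thesis using sat2' by (auto simp: sols_def)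
  qed
  finally show ?thesis .
qed

text \<open>The ultrafilter \<open>W\<close> and \<open>M\<close> do not depend on the indices, so quantifying away one block after the other
leads from every increasing choice of indices to the same condition.\<close>

lemma coheir_sequence_indiscernible:
  assumes MU: "M \<subseteq> dom U" and Y: "finite Y" "\<And>y. y \<in> Y \<Longrightarrow> y < s"
    and W: "ultra W" "(Y \<rightarrow>\<^sub>E M) \<in> W" and d: "coheir_sequence L U M Y W d"
    and f: "strict_mono_on {..<k} f" and \<psi>: "\<psi> \<in> fms_over L M (blocks s Y k)"
  shows "satp U (asg s (d \<circ> f)) \<psi> \<longleftrightarrow> satp U (asg s d) \<psi>"
  using f \<psi>
proof (induction k arbitrary: \<psi>)
  case 0
  then have "fv \<psi> = {}" by (simp add: fms_over_def)
  then show ?case by (intro sat_cong) simp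
next
  case (Suc k)
  let ?\<psi> = "\<lambda>m. inst (enc s k ` Y) (m \<circ> inv_into Y (enc s k)) \<psi>"
  have f: "f i < f k" if "i < k" for i
    using Suc.prems(1) that by (auto simp: strict_mono_on_def)
  have inv: "inv_into Y (enc s k) (enc s k y) = y" if "y \<in> Y" for y
    using that by (intro inv_into_f_f) (auto simp: inj_on_def)
  have "satp U (asg s (d \<circ> f)) (?\<psi> m) \<longleftrightarrow> satp U (asg s d) (?\<psi> m)" if "m \<in> Y \<rightarrow>\<^sub>E M" for m
  proof (rule Suc.IH)
    show "strict_mono_on {..<k} f" using Suc.prems(1) by (auto simp: strict_mono_on_def)
    show "?\<psi> m \<in> fms_over L M (blocks s Y k)"
      using Suc.prems(2) that inv unfolding blocks_Suc
      by (intro inst_in_fms_over[where A = M]) (auto simp: Un_commute)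
  qed
  then have eq: "{m \<in> Y \<rightarrow>\<^sub>E M. satp U (asg s (d \<circ> f)) (?\<psi> m)} = {m \<in> Y \<rightarrow>\<^sub>E M. satp U (asg s d) (?\<psi> m)}"
    by auto
  have "satp U (asg s (d \<circ> f)) \<psi> \<longleftrightarrow> {m \<in> Y \<rightarrow>\<^sub>E M. satp U (asg s (d \<circ> f)) (?\<psi> m)} \<in> W"
    using f Suc.prems(2) by (intro coheir_step[OF MU Y W d])
  moreover have "satp U (asg s (d \<circ> id)) \<psi> \<longleftrightarrow> {m \<in> Y \<rightarrow>\<^sub>E M. satp U (asg s (d \<circ> id)) (?\<psi> m)} \<in> W"
    using Suc.prems(2) by (intro coheir_step[OF MU Y W d]) auto
  ultimately show ?case unfolding eq comp_id by (simp only:)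
qed

section \<open>NIP\<close>

lemma block_copies:
  fixes \<phi> :: "('f + 'a, 'r) fm"
  assumes \<phi>: "\<phi> \<in> fms_over L M (X \<union> Y)" and Y: "finite Y" "X \<inter> Y = {}"
    and s: "\<And>v. v \<in> X \<union> Y \<Longrightarrow> v < s"
  obtains ren where "\<forall>j. ren j \<in> fms_over L M (X \<union> enc s j ` Y)"
    "\<forall>(U :: ('f, 'r, 'a) struct) e j. (\<forall>y\<in>Y. e (enc s j y) \<in> dom U) \<longrightarrow>
       (satp U e (ren j) \<longleftrightarrow> satp U (override_on e (e \<circ> enc s j) Y) \<phi>)"
proof -
  have "enc s j ` Y \<inter> Y = {}" for j using s enc_ge by (force dest: leD)
  from rename_variables[OF \<phi> Y this]
  have "\<exists>\<phi>'. \<phi>' \<in> fms_over L M (X \<union> enc s j ` Y) \<and> (\<forall>(U :: ('f, 'r, 'a) struct) e.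
      (\<forall>y\<in>Y. e (enc s j y) \<in> dom U) \<longrightarrow> (satp U e \<phi>' \<longleftrightarrow> satp U (override_on e (e \<circ> enc s j) Y) \<phi>))" for j
    by metis
  from choice[OF allI[OF this]] obtain ren where "\<forall>j. ren j \<in> fms_over L M (X \<union> enc s j ` Y) \<and>
      (\<forall>(U :: ('f, 'r, 'a) struct) e. (\<forall>y\<in>Y. e (enc s j y) \<in> dom U) \<longrightarrow>
        (satp U e (ren j) \<longleftrightarrow> satp U (override_on e (e \<circ> enc s j) Y) \<phi>))" by (rule exE)
  then show thesis by (intro that[of ren]) blast+
qed

text \<open>Suppose the truth value of \<open>\<phi>(a;d i)\<close> changes between \<open>2 i\<close> and \<open>2 i + 1\<close> for all \<open>i\<close> in a set \<open>K\<close> of size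
\<open>n\<close>. For every \<open>I \<subseteq> {..<n}\<close>, choosing the right element of each pair gives an increasing sequence of \<open>n\<close>
indices along which \<open>\<phi>(a;\<cdot>)\<close> holds exactly at the positions in \<open>I\<close>. That such an \<open>a\<close> exists is a property
of the type of these \<open>n\<close> terms over \<open>M\<close>, so by indiscernibility a point with the same pattern exists for the first
\<open>n\<close> terms. Hence these are shattered by \<open>x\<close>: NIP is applied to \<open>\<phi>\<close> with the roles of \<open>x\<close> and \<open>y\<close>
exchanged, the parameters of \<open>\<phi>\<close> being appended to \<open>y\<close>.\<close>

lemma nip_alternation_bound:
  fixes U :: "('f, 'r, 'a) struct"
  assumes nip: "nip TYPE('a) L T" "models L U T"
    and MU: "M \<subseteq> dom U" and X: "finite X" and Y: "finite Y" "X \<inter> Y = {}"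
    and W: "ultra W" "(Y \<rightarrow>\<^sub>E M) \<in> W" and d: "coheir_sequence L U M Y W d"
    and \<phi>: "\<phi> \<in> fms_over L M (X \<union> Y)"
  obtains n where "\<forall>a \<in> X \<rightarrow>\<^sub>E dom U. \<forall>K. finite K \<and> (\<forall>i\<in>K. satp U (override_on a (d (2 * i)) Y) \<phi>
      \<noteq> satp U (override_on a (d (2 * i + 1)) Y) \<phi>) \<longrightarrow> card K \<noteq> n"
proof -
  have XY: "finite (X \<union> Y)" using X Y by simp
  obtain Z m \<phi>' where Z: "finite Z" "Z \<inter> (X \<union> Y) = {}" "m \<in> Z \<rightarrow>\<^sub>E M"
    and \<phi>': "wf_fm L \<phi>'" "fv \<phi>' \<subseteq> X \<union> Y \<union> Z"
    and abs: "\<forall>U e. sat U (override_on e m Z) \<phi>' \<longleftrightarrow> satp U (override_on e m Z) \<phi>"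
    by (rule abstract_parameters[OF \<phi> XY])
  have "\<exists>n. \<not> shatters U (Y \<union> Z) X n \<phi>'"
  proof -
    have "finite (Y \<union> Z) \<and> finite X \<and> (Y \<union> Z) \<inter> X = {} \<and> wf_fm L \<phi>' \<and> fv \<phi>' \<subseteq> (Y \<union> Z) \<union> X"
      using X Y Z(1,2) \<phi>' by auto
    then show ?thesis
      by (rule nip(1)[unfolded nip_def, rule_format, OF nip(2), of "Y \<union> Z" X \<phi>'])
  qed
  then obtain n where n: "\<not> shatters U (Y \<union> Z) X n \<phi>'" by blast
  have d_dom: "d i \<in> Y \<rightarrow>\<^sub>E dom U" for i using d by (simp add: coheir_sequence_def)
  define s where "s = Suc (Max (insert 0 (X \<union> Y)))"
  have s: "v < s" if "v \<in> X \<union> Y" for v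
    using that XY unfolding s_def by (intro le_imp_less_Suc Max_ge) auto
  have fresh: "enc s j y \<notin> X \<union> Y" for j y using s[of "enc s j y"] enc_ge[of s j y] by linarith
  obtain ren where ren_all: "\<forall>j. ren j \<in> fms_over L M (X \<union> enc s j ` Y)"
    and ren: "\<forall>(U :: ('f, 'r, 'a) struct) e j. (\<forall>y\<in>Y. e (enc s j y) \<in> dom U) \<longrightarrow>
       (satp U e (ren j) \<longleftrightarrow> satp U (override_on e (e \<circ> enc s j) Y) \<phi>)"
    by (rule block_copies[OF \<phi> Y s])
  have ren_in: "ren j \<in> fms_over L M (X \<union> enc s j ` Y)" for j using ren_all by blast
  have satp_ren: "satp U (override_on (asg s c) a X) (ren j) \<longleftrightarrow> satp U (override_on a (c j) Y) \<phi>"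
    if "c j \<in> Y \<rightarrow>\<^sub>E dom U" for c a j
  proof -
    let ?e = "override_on (asg s c) a X"
    have e: "?e (enc s j y) = c j y" for y using fresh by (auto simp: override_on_def)
    have "\<forall>y\<in>Y. ?e (enc s j y) \<in> dom U" using that e by (auto simp: PiE_iff)
    then have "satp U ?e (ren j) \<longleftrightarrow> satp U (override_on ?e (?e \<circ> enc s j) Y) \<phi>"
      using ren by blast
    also have "\<dots> \<longleftrightarrow> satp U (override_on a (c j) Y) \<phi>"
      using \<phi> e by (intro sat_cong) (auto simp: fms_over_def override_on_def)
    finally show ?thesis .
  qed
  obtain xs where xs: "set xs = X" using finite_list[OF X] by auto
  have "card K \<noteq> n"
    if a: "a \<in> X \<rightarrow>\<^sub>E dom U" and K: "finite K"
      and alt: "\<forall>i\<in>K. satp U (override_on a (d (2 * i)) Y) \<phi> \<noteq> satp U (override_on a (d (2 * i + 1)) Y) \<phi>"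
    for a K
  proof
    assume cardK: "card K = n"
    obtain h where h: "strict_mono_on {..<n} h" "\<forall>j<n. h j \<in> K"
      using finite_enumerate[OF K] cardK by auto
    have pattern: "\<exists>b \<in> X \<rightarrow>\<^sub>E dom U. \<forall>j<n. satp U (override_on b (d j) Y) \<phi> \<longleftrightarrow> j \<in> I" for I
    proof -
      define lit where "lit j = (if j \<in> I then ren j else Neg (ren j))" for j
      let ?\<psi> = "exs xs (conjs (map lit [0..<n]))"
      define f where "f j = (if satp U (override_on a (d (2 * h j)) Y) \<phi> \<longleftrightarrow> j \<in> I then 2 * h j else 2 * h j + 1)" for j
      have f_sat: "satp U (override_on a (d (f j)) Y) \<phi> \<longleftrightarrow> j \<in> I" if "j < n" for j
        using alt h(2) that by (auto simp: f_def)
      have f_mono: "strict_mono_on {..<n} f"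
      proof (rule strict_mono_onI)
        fix i j assume "i \<in> {..<n}" "j \<in> {..<n}" "i < j"
        then have "h i < h j" using h(1) by (simp add: strict_mono_on_def)
        then show "f i < f j" by (auto simp: f_def)
      qed
      have "lit j \<in> fms_over L M (X \<union> enc s j ` Y)" for j using ren_in by (simp add: lit_def)
      then have "lit j \<in> fms_over L M (X \<union> blocks s Y n)" if "j < n" for j
        by (rule fms_over_mono) (use that in auto)
      then have "?\<psi> \<in> fms_over L M (blocks s Y n)"
        using xs unfolding fms_over_def by fastforce
      from coheir_sequence_indiscernible[OF MU Y(1) _ W d f_mono this]
      have eq: "satp U (asg s (d \<circ> f)) ?\<psi> \<longleftrightarrow> satp U (asg s d) ?\<psi>" using s by blast
      have sat_\<psi>: "satp U (asg s c) ?\<psi> \<longleftrightarrow>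
          (\<exists>b. b \<in> X \<rightarrow> dom U \<and> (\<forall>j<n. satp U (override_on b (c j) Y) \<phi> \<longleftrightarrow> j \<in> I))"
        if "\<forall>j. c j \<in> Y \<rightarrow>\<^sub>E dom U" for c
      proof -
        have "satp U (override_on (asg s c) b X) (lit j)
            \<longleftrightarrow> (satp U (override_on b (c j) Y) \<phi> \<longleftrightarrow> j \<in> I)" for b j
          using that by (simp add: satp_ren lit_def)
        then show ?thesis by (simp add: sat_exs xs) (simp add: Ball_def)
      qed
      have "satp U (asg s (d \<circ> f)) ?\<psi>"
        using d_dom f_sat a by (subst sat_\<psi>) (auto intro!: exI[of _ a])
      then have "satp U (asg s d) ?\<psi>" using eq by simp
      then obtain b where b: "b \<in> X \<rightarrow> dom U" "\<forall>j<n. satp U (override_on b (d j) Y) \<phi> \<longleftrightarrow> j \<in> I"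
        using sat_\<psi>[of d] d_dom by blast
      have "satp U (override_on (restrict b X) (d j) Y) \<phi> \<longleftrightarrow> satp U (override_on b (d j) Y) \<phi>" for j
        using \<phi> by (intro sat_cong) (auto simp: fms_over_def override_on_def)
      with b show ?thesis by (intro bexI[of _ "restrict b X"]) auto
    qed
    have "shatters U (Y \<union> Z) X n \<phi>'"
      unfolding shatters_def
    proof (intro exI conjI allI impI)
      let ?c = "\<lambda>j. restrict (override_on (d j) m Z) (Y \<union> Z)"
      show "?c j \<in> (Y \<union> Z) \<rightarrow>\<^sub>E dom U" for j
        using d_dom[of j] Z(3) MU by (auto simp: override_on_def PiE_iff)
      have *: "sat U (override_on (?c j) b X) \<phi>' \<longleftrightarrow> satp U (override_on b (d j) Y) \<phi>" for j b
      proof -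
        have "sat U (override_on (?c j) b X) \<phi>' \<longleftrightarrow> sat U (override_on (override_on b (d j) Y) m Z) \<phi>'"
          using \<phi>'(2) Y(2) Z(2) by (intro sat_cong) (auto simp: override_on_def)
        also have "\<dots> \<longleftrightarrow> satp U (override_on (override_on b (d j) Y) m Z) \<phi>" using abs by blast
        also have "\<dots> \<longleftrightarrow> satp U (override_on b (d j) Y) \<phi>"
          using \<phi> Z(2) by (intro sat_cong) (auto simp: fms_over_def override_on_def)
        finally show ?thesis .
      qed
      show "\<exists>b \<in> X \<rightarrow>\<^sub>E dom U. \<forall>i<n. sat U (override_on (?c i) b X) \<phi>' \<longleftrightarrow> i \<in> I" for I
        unfolding * by (rule pattern)
    qed
    with n show False by simp
  qed
  then show thesis by (intro that[of n]) blast
qed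

text \<open>If \<open>p\<close> separated \<open>d 0\<close> and \<open>d 1\<close>, then \<open>\<phi>(x;d 0) \<triangle> \<phi>(x;d 1)\<close> would have positive measure \<open>\<epsilon>\<close>. The
pairs \<open>(d (2 i), d (2 i + 1))\<close> all have the same type over \<open>M\<close>, so by invariance their differences
have measure \<open>\<epsilon>\<close> as well, and averaging contradicts the bound on alternation.\<close>

lemma support_type_constant_on_coheir_sequence:
  fixes U :: "('f, 'r, 'a) struct"
  assumes nip: "nip TYPE('a) L T" "models L U T" and \<mu>: "keisler L U X \<mu>"
    and inv: "invariant_over L U X M \<mu>"
    and MU: "M \<subseteq> dom U" and X: "finite X" and Y: "finite Y" "X \<inter> Y = {}"
    and W: "ultra W" "(Y \<rightarrow>\<^sub>E M) \<in> W" and d: "coheir_sequence L U M Y W d"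
    and \<phi>: "\<phi> \<in> fms_over L M (X \<union> Y)"
    and p: "p \<in> support L U X \<mu>"
  shows "inst Y (d 0) \<phi> \<in> p \<longleftrightarrow> inst Y (d 1) \<phi> \<in> p"
proof (rule ccontr)
  assume neg: "\<not> (inst Y (d 0) \<phi> \<in> p \<longleftrightarrow> inst Y (d 1) \<phi> \<in> p)"
  have XY: "finite (X \<union> Y)" using X Y by simp
  have d_dom: "d i \<in> Y \<rightarrow>\<^sub>E dom U" for i using d by (simp add: coheir_sequence_def)
  have pt: "p \<in> types L U (dom U) X" using p by (simp add: support_def)
  have in_DX: "inst Y (d i) \<phi> \<in> fms_over L (dom U) X" for i
    using \<phi> MU d_dom by (intro inst_in_fms_over[where A = M]) auto
  obtain n where n: "\<forall>a \<in> X \<rightarrow>\<^sub>E dom U. \<forall>K. finite K \<and> (\<forall>i\<in>K. satp U (override_on a (d (2 * i)) Y) \<phi>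
      \<noteq> satp U (override_on a (d (2 * i + 1)) Y) \<phi>) \<longrightarrow> card K \<noteq> n"
    by (rule nip_alternation_bound[OF nip MU X Y W d \<phi>])
  define s where "s = Suc (Max (insert 0 (X \<union> Y)))"
  have s: "v < s" if "v \<in> X \<union> Y" for v
    using that XY unfolding s_def by (intro le_imp_less_Suc Max_ge) auto
  have fresh: "enc s j y \<notin> X \<union> Y" for j y using s[of "enc s j y"] enc_ge[of s j y] by linarith
  obtain ren where ren_all: "\<forall>j. ren j \<in> fms_over L M (X \<union> enc s j ` Y)"
    and ren: "\<forall>(U :: ('f, 'r, 'a) struct) e j. (\<forall>y\<in>Y. e (enc s j y) \<in> dom U) \<longrightarrow>
       (satp U e (ren j) \<longleftrightarrow> satp U (override_on e (e \<circ> enc s j) Y) \<phi>)"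
    by (rule block_copies[OF \<phi> Y s])
  have ren_in: "ren j \<in> fms_over L M (X \<union> enc s j ` Y)" for j using ren_all by blast
  let ?B = "blocks s Y 2"
  \<comment> \<open>The symmetric difference, with \<open>d 0\<close> and \<open>d 1\<close> replaced by two blocks of variables.\<close>
  define \<theta> where "\<theta> = Neg (Disj (Conj (ren 0) (ren 1)) (Conj (Neg (ren 0)) (Neg (ren 1))))"
  have "ren j \<in> fms_over L M (X \<union> ?B)" if "j < 2" for j
    using that by (intro fms_over_mono[OF ren_in]) auto
  then have \<theta>: "\<theta> \<in> fms_over L M (X \<union> ?B)" by (simp add: \<theta>_def)
  define \<beta> where "\<beta> i = restrict (asg s (d \<circ> (\<lambda>j. 2 * i + j))) ?B" for i
  have \<beta>_enc: "\<beta> i (enc s j y) = d (2 * i + j) y" if "j < 2" "y \<in> Y" for i j y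
    using that by (auto simp: \<beta>_def)
  have \<beta>_dom: "\<beta> i \<in> ?B \<rightarrow>\<^sub>E dom U" for i using d_dom by (auto simp: \<beta>_def PiE_iff)
  have XB: "X \<inter> ?B = {}" using fresh by auto
  have tp_\<beta>: "tp L U M ?B (\<beta> i) = tp L U M ?B (\<beta> 0)" for i
  proof -
    have "satp U (\<beta> i) \<psi> \<longleftrightarrow> satp U (asg s d) \<psi>" if \<psi>: "\<psi> \<in> fms_over L M ?B" for i \<psi>
    proof -
      have "satp U (\<beta> i) \<psi> \<longleftrightarrow> satp U (asg s (d \<circ> (\<lambda>j. 2 * i + j))) \<psi>"
        using \<psi> by (intro sat_cong) (auto simp: fms_over_def \<beta>_def)
      also have "\<dots> \<longleftrightarrow> satp U (asg s d) \<psi>"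
        using s \<psi> by (intro coheir_sequence_indiscernible[OF MU Y(1) _ W d, where k = 2])
          (auto simp: strict_mono_on_def)
      finally show ?thesis .
    qed
    then show ?thesis by (auto simp: tp_def)
  qed
  have sat_\<theta>: "satp U a (inst ?B (\<beta> i) \<theta>) \<longleftrightarrow>
      satp U (override_on a (d (2 * i)) Y) \<phi> \<noteq> satp U (override_on a (d (2 * i + 1)) Y) \<phi>" for a i
  proof -
    let ?e = "override_on a (\<beta> i) ?B"
    have e: "?e (enc s j y) = d (2 * i + j) y" if "j < 2" "y \<in> Y" for j y
      using that \<beta>_enc by (auto simp: override_on_def)
    have "satp U ?e (ren j) \<longleftrightarrow> satp U (override_on a (d (2 * i + j)) Y) \<phi>" if j: "j < 2" for j
    proof -
      have "\<forall>y\<in>Y. ?e (enc s j y) \<in> dom U" using e[OF j] d_dom by (auto simp: PiE_iff)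
      then have "satp U ?e (ren j) \<longleftrightarrow> satp U (override_on ?e (?e \<circ> enc s j) Y) \<phi>" using ren by blast
      also have "\<dots> \<longleftrightarrow> satp U (override_on a (d (2 * i + j)) Y) \<phi>"
      proof (rule sat_cong)
        fix v assume "v \<in> fv \<phi>"
        then have "v \<in> X \<union> Y" using \<phi> by (auto simp: fms_over_def)
        moreover from this have "v \<notin> ?B" using fresh by auto
        ultimately show "override_on ?e (?e \<circ> enc s j) Y v = override_on a (d (2 * i + j)) Y v"
          using e[OF j] by (auto simp: override_on_def)
      qed
      finally show ?thesis .
    qed
    from this[of 0] this[of 1] show ?thesis unfolding satp_inst by (auto simp: \<theta>_def)
  qed
  have \<theta>_DX: "inst ?B (\<beta> i) \<theta> \<in> fms_over L (dom U) X" for i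
    using \<theta> MU \<beta>_dom[of i] by (intro inst_in_fms_over[where A = M]) auto
  have \<theta>_const: "\<mu> (inst ?B (\<beta> i) \<theta>) = \<mu> (inst ?B (\<beta> 0) \<theta>)" for i
  proof (rule inv[unfolded invariant_over_def, rule_format], intro conjI)
    show "finite ?B" using Y(1) by simp
  qed (use XB \<theta> \<beta>_dom tp_\<beta> in auto)
  define \<epsilon> where "\<epsilon> = \<mu> (inst ?B (\<beta> 0) \<theta>)"
  have satp_inst_\<phi>: "satp U a (inst Y (d i) \<phi>) \<longleftrightarrow> satp U (override_on a (d i) Y) \<phi>" for a i
    by (rule satp_inst)
  have "inst ?B (\<beta> 0) \<theta> \<in> p"
  proof -
    obtain \<psi> where \<psi>: "\<psi> \<in> p" "\<forall>a. satp U a \<psi> \<longrightarrow> satp U a (inst ?B (\<beta> 0) \<theta>)"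
    proof (cases "inst Y (d 0) \<phi> \<in> p")
      case True
      then have "Conj (inst Y (d 0) \<phi>) (Neg (inst Y (d 1) \<phi>)) \<in> p"
        using neg by (intro type_Conj[OF pt]) (auto simp: Neg_in_type[OF pt in_DX])
      then show thesis by (rule that) (auto simp: sat_\<theta> satp_inst_\<phi>)
    next
      case False
      then have "Conj (Neg (inst Y (d 0) \<phi>)) (inst Y (d 1) \<phi>) \<in> p"
        using neg by (intro type_Conj[OF pt]) (auto simp: Neg_in_type[OF pt in_DX])
      then show thesis by (rule that) (auto simp: sat_\<theta> satp_inst_\<phi>)
    qed
    then show ?thesis by (intro type_deductively_closed[OF pt, of "{\<psi>}"] \<theta>_DX) auto
  qed
  then have "\<epsilon> > 0" using p by (simp add: support_def \<epsilon>_def)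
  then obtain N :: nat where N: "real N * \<epsilon> > real n" using reals_Archimedean3 by blast
  have "\<epsilon> \<le> \<mu> (inst ?B (\<beta> i) \<theta>)" for i using \<theta>_const[of i] by (simp add: \<epsilon>_def)
  then obtain a where a: "a \<in> X \<rightarrow>\<^sub>E dom U" "card {i. i < N \<and> satp U a (inst ?B (\<beta> i) \<theta>)} > n"
    by (rule keisler_frequently[OF \<mu> \<theta>_DX _ N])
  then obtain K where K: "K \<subseteq> {i. i < N \<and> satp U a (inst ?B (\<beta> i) \<theta>)}" "card K = n" "finite K"
    using obtain_subset_with_card_n[of n "{i. i < N \<and> satp U a (inst ?B (\<beta> i) \<theta>)}"] by auto
  then have "\<forall>i\<in>K. satp U (override_on a (d (2 * i)) Y) \<phi> \<noteq> satp U (override_on a (d (2 * i + 1)) Y) \<phi>"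
    using sat_\<theta> by blast
  with n a(1) K(2,3) show False by blast
qed

lemma nip_invariant_imp_invariantly_supported:
  fixes U :: "('f, 'r, 'a) struct"
  assumes nip: "nip TYPE('a) L T" and U: "monster \<kappa> L T U" and X: "finite X"
    and \<mu>: "keisler L U X \<mu>" and inv: "invariant \<kappa> L U X \<mu>"
  shows "invariantly_supported \<kappa> L U X \<mu>"
proof -
  obtain M where M: "small_model \<kappa> L M U" and inv: "invariant_over L U X M \<mu>"
    using inv by (auto simp: invariant_def)
  have sat: "saturated \<kappa> L U" "Card_order \<kappa>" "natLeq <o \<kappa>" "models L U T"
    using U by (auto simp: monster_def large_for_def)
  have elem: "elem_sub L M U" "|M| <o \<kappa>" and MU: "M \<subseteq> dom U"
    using M by (auto simp: small_model_def elem_sub_def)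
  have "type_invariant_over L U X M p" if p: "p \<in> support L U X \<mu>" for p
    unfolding type_invariant_over_def
  proof (intro allI impI, elim conjE)
    fix Y \<phi> b b'
    assume Y: "finite Y" "X \<inter> Y = {}" and \<phi>: "\<phi> \<in> fms_over L M (X \<union> Y)"
      and b: "b \<in> Y \<rightarrow>\<^sub>E dom U" "b' \<in> Y \<rightarrow>\<^sub>E dom U" and tp: "tp L U M Y b = tp L U M Y b'"
    obtain W where W: "ultra W" "(Y \<rightarrow>\<^sub>E M) \<in> W"
      and bW: "\<forall>\<psi>\<in>fms_over L M Y. satp U b \<psi> \<longleftrightarrow> sols U Y \<psi> \<in> W"
      by (rule coheir_exists[OF elem(1) Y(1) b(1)])
    have b'W: "satp U b' \<psi> \<longleftrightarrow> sols U Y \<psi> \<in> W" if "\<psi> \<in> fms_over L M Y" for \<psi>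
      using tp that bW by (auto simp: tp_def)
    \<comment> \<open>The sequence \<open>c\<close> is a common continuation, and \<open>p\<close> cannot distinguish \<open>c 0\<close> from \<open>b\<close> nor from \<open>b'\<close>.\<close>
    have S: "\<And>b0. b0 \<in> {b, b'} \<Longrightarrow> b0 \<in> Y \<rightarrow>\<^sub>E dom U" "finite {b, b'}"
      "\<And>b0 \<psi>. b0 \<in> {b, b'} \<Longrightarrow> \<psi> \<in> fms_over L M Y \<Longrightarrow> satp U b0 \<psi> \<longleftrightarrow> sols U Y \<psi> \<in> W"
      using b bW b'W by auto
    obtain c where "\<forall>b0\<in>{b, b'}. coheir_sequence L U M Y W (case_nat b0 c)"
      by (rule coheir_sequences_exist[OF sat(2,3,1) MU elem(2) Y(1) W S(1,3,2)])
    then have c: "coheir_sequence L U M Y W (case_nat b c)"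
      "coheir_sequence L U M Y W (case_nat b' c)" by auto
    show "inst Y b \<phi> \<in> p \<longleftrightarrow> inst Y b' \<phi> \<in> p"
      using support_type_constant_on_coheir_sequence[OF nip sat(4) \<mu> inv MU X Y W c(1) \<phi> p]
        support_type_constant_on_coheir_sequence[OF nip sat(4) \<mu> inv MU X Y W c(2) \<phi> p] by simp
  qed
  with M show ?thesis by (auto simp: invariantly_supported_def)
qed

section \<open>The generic ternary relation\<close>

definition tern_lang :: "(nat, nat) lang" where
  "tern_lang = \<lparr>fsyms = {}, farity = (\<lambda>_. 0), rsyms = {0}, rarity = (\<lambda>_. 3)\<rparr>"

lemma tern_lang_simps [simp]:
  "fsyms tern_lang = {}" "rsyms tern_lang = {0}" "rarity tern_lang r = 3"
  by (simp_all add: tern_lang_def)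

text \<open>The relation of a new point \<open>x\<close> to a set \<open>C\<close> is described before \<open>x\<close> is known, by a predicate \<open>G\<close> on
triples from \<open>C\<close> extended by a placeholder: \<^const>\<open>None\<close> stands for \<open>x\<close>, and \<open>Some c\<close> for \<open>c \<in> C\<close>.\<close>

definition new_pt :: "'a \<Rightarrow> 'a \<Rightarrow> 'a option" where
  "new_pt x a = (if a = x then None else Some a)"

definition realizes ::
    "('f, nat, 'a) struct \<Rightarrow> 'a set \<Rightarrow> ('a option \<Rightarrow> 'a option \<Rightarrow> 'a option \<Rightarrow> bool) \<Rightarrow> 'a \<Rightarrow> bool" where
  "realizes N C G x \<longleftrightarrow> x \<in> dom N \<and> x \<notin> C \<and>
     (\<forall>a\<in>insert x C. \<forall>b\<in>insert x C. \<forall>c\<in>insert x C. x \<in> {a, b, c} \<longrightarrow>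
        (rint N 0 [a, b, c] \<longleftrightarrow> G (new_pt x a) (new_pt x b) (new_pt x c)))"

definition generic_over :: "('f, nat, 'a) struct \<Rightarrow> 'a set \<Rightarrow> bool" where
  "generic_over N C \<longleftrightarrow> (\<forall>G. \<exists>x. realizes N C G x)"

definition generic :: "('f, nat, 'a) struct \<Rightarrow> bool" where
  "generic N \<longleftrightarrow> (\<forall>C. finite C \<and> C \<subseteq> dom N \<longrightarrow> generic_over N C)"

definition piso :: "('f, nat, 'a) struct \<Rightarrow> ('f, nat, 'a) struct \<Rightarrow> ('a \<times> 'a) set \<Rightarrow> bool" where
  "piso N N' P \<longleftrightarrow> P \<subseteq> dom N \<times> dom N' \<and>
     (\<forall>(a, a')\<in>P. \<forall>(b, b')\<in>P. a = b \<longleftrightarrow> a' = b') \<and>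
     (\<forall>(a, a')\<in>P. \<forall>(b, b')\<in>P. \<forall>(c, c')\<in>P. rint N 0 [a, b, c] \<longleftrightarrow> rint N' 0 [a', b', c'])"

lemma piso_dom: "piso N N' P \<Longrightarrow> (a, a') \<in> P \<Longrightarrow> a \<in> dom N \<and> a' \<in> dom N'"
  by (auto simp: piso_def)

lemma piso_eq: "piso N N' P \<Longrightarrow> (a, a') \<in> P \<Longrightarrow> (b, b') \<in> P \<Longrightarrow> a = b \<longleftrightarrow> a' = b'"
  unfolding piso_def by fast

lemma piso_rint:
  "piso N N' P \<Longrightarrow> (a, a') \<in> P \<Longrightarrow> (b, b') \<in> P \<Longrightarrow> (c, c') \<in> P
    \<Longrightarrow> rint N 0 [a, b, c] \<longleftrightarrow> rint N' 0 [a', b', c']"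
  unfolding piso_def by fast

lemma pisoI:
  assumes "\<And>a a'. (a, a') \<in> P \<Longrightarrow> a \<in> dom N \<and> a' \<in> dom N'"
    "\<And>a a' b b'. (a, a') \<in> P \<Longrightarrow> (b, b') \<in> P \<Longrightarrow> a = b \<longleftrightarrow> a' = b'"
    "\<And>a a' b b' c c'. (a, a') \<in> P \<Longrightarrow> (b, b') \<in> P \<Longrightarrow> (c, c') \<in> P
      \<Longrightarrow> rint N 0 [a, b, c] \<longleftrightarrow> rint N' 0 [a', b', c']"
  shows "piso N N' P"
  unfolding piso_def using assms by fast

lemma piso_converse: "piso N N' P \<Longrightarrow> piso N' N (P\<inverse>)"
  by (rule pisoI) (auto dest: piso_dom piso_eq piso_rint)

lemma realizes_rint:
  "realizes N C G x \<Longrightarrow> a \<in> insert x C \<Longrightarrow> b \<in> insert x C \<Longrightarrow> c \<in> insert x C \<Longrightarrow> x = a \<or> x = b \<or> x = c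
    \<Longrightarrow> rint N 0 [a, b, c] \<longleftrightarrow> G (new_pt x a) (new_pt x b) (new_pt x c)"
  unfolding realizes_def by (elim conjE) (drule (1) bspec, drule (1) bspec, drule (1) bspec, auto)

lemma piso_insert:
  assumes P: "piso N N' P" and x: "realizes N (Domain P) G x" and x': "realizes N' (Range P) G' x'"
    and G: "\<And>a a' b b' c c'. (a, a') \<in> insert (x, x') P \<Longrightarrow> (b, b') \<in> insert (x, x') P
      \<Longrightarrow> (c, c') \<in> insert (x, x') P
      \<Longrightarrow> G (new_pt x a) (new_pt x b) (new_pt x c) \<longleftrightarrow> G' (new_pt x' a') (new_pt x' b') (new_pt x' c')"
  shows "piso N N' (insert (x, x') P)"
proof (rule pisoI)
  have new: "x \<in> dom N" "x' \<in> dom N'" "x \<notin> Domain P" "x' \<notin> Range P"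
    using x x' by (auto simp: realizes_def)
  show "a \<in> dom N \<and> a' \<in> dom N'" if "(a, a') \<in> insert (x, x') P" for a a'
    using that new P by (auto dest: piso_dom)
  show "a = b \<longleftrightarrow> a' = b'" if "(a, a') \<in> insert (x, x') P" "(b, b') \<in> insert (x, x') P" for a a' b b'
    using that new piso_eq[OF P] by blast
  fix a a' b b' c c'
  assume abc: "(a, a') \<in> insert (x, x') P" "(b, b') \<in> insert (x, x') P" "(c, c') \<in> insert (x, x') P"
  show "rint N 0 [a, b, c] \<longleftrightarrow> rint N' 0 [a', b', c']"
  proof (cases "x = a \<or> x = b \<or> x = c")
    case True
    then have "x' = a' \<or> x' = b' \<or> x' = c'" using abc new by blast
    then have "rint N' 0 [a', b', c'] \<longleftrightarrow> G' (new_pt x' a') (new_pt x' b') (new_pt x' c')"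
      using abc by (intro realizes_rint[OF x']) auto
    moreover have "rint N 0 [a, b, c] \<longleftrightarrow> G (new_pt x a) (new_pt x b) (new_pt x c)"
      using abc True by (intro realizes_rint[OF x]) auto
    ultimately show ?thesis using G[OF abc] by simp
  next
    case False
    then show ?thesis using abc by (intro piso_rint[OF P]) auto
  qed
qed

lemma piso_extend:
  assumes P: "piso N N' P" "finite P" and N': "generic N'" and a: "a \<in> dom N"
  shows "\<exists>a'\<in>dom N'. piso N N' (insert (a, a') P)"
proof (cases "a \<in> Domain P")
  case True
  then obtain a' where "(a, a') \<in> P" by blast
  then show ?thesis using P piso_dom[OF P(1)] by (intro bexI[of _ a']) (auto simp: insert_absorb)
next
  case False
  define pull where "pull v = (case v of None \<Rightarrow> a | Some c' \<Rightarrow> (SOME c. (c, c') \<in> P))" for v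
  have pull: "pull (Some c') = c" if "(c, c') \<in> P" for c c'
  proof -
    have "(SOME c. (c, c') \<in> P, c') \<in> P" using that by (rule someI)
    then show ?thesis using piso_eq[OF P(1)] that by (auto simp: pull_def)
  qed
  define G' where "G' u v w = rint N 0 [pull u, pull v, pull w]" for u v w
  have "Range P \<subseteq> dom N'" using piso_dom[OF P(1)] by blast
  then obtain a' where a': "realizes N' (Range P) G' a'"
    using N' P(2) unfolding generic_def generic_over_def by (meson finite_Range)
  have new: "a' \<notin> Range P" "a' \<in> dom N'" using a' by (auto simp: realizes_def)
  have pull_new: "pull (new_pt a' c') = c" if "(c, c') \<in> insert (a, a') P" for c c'
  proof (cases "c' = a'")
    case True
    then have "c = a" using that new by auto
    then show ?thesis using True by (simp add: new_pt_def pull_def)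
  next
    case False
    then show ?thesis using that pull by (auto simp: new_pt_def)
  qed
  let ?G = "\<lambda>u v w. rint N 0 [case u of None \<Rightarrow> a | Some u \<Rightarrow> u, case v of None \<Rightarrow> a | Some v \<Rightarrow> v,
    case w of None \<Rightarrow> a | Some w \<Rightarrow> w]"
  have "(case new_pt a c of None \<Rightarrow> a | Some u \<Rightarrow> u) = c" for c by (simp add: new_pt_def)
  then have "piso N N' (insert (a, a') P)"
    using a False by (intro piso_insert[OF P(1) _ a', of ?G]) (auto simp: realizes_def G'_def pull_new)
  with new show ?thesis by blast
qed

lemma tval_piso:
  assumes "\<forall>f\<in>fsyms L. farity L f = 0 \<and> (fint N f [], fint N' f []) \<in> P"
    and "wf_trm L t" "\<And>v. v \<in> fvt t \<Longrightarrow> (e v, e' v) \<in> P"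
  shows "(tval N e t, tval N' e' t) \<in> P"
  using assms by (cases t) auto

text \<open>Genericity lets a finite partial isomorphism be extended to any further point, on either side; the quantifier case of the
induction uses exactly this. Constants are admitted, if the partial isomorphism respects them, so that
the lemma applies both to formulas of the language itself and to formulas with parameters.\<close>

lemma back_and_forth:
  assumes gen: "generic N" "generic N'" and L: "rsyms L = {0}" "rarity L 0 = 3"
    and "wf_fm L \<phi>" "piso N N' P" "finite P"
    "\<forall>f\<in>fsyms L. farity L f = 0 \<and> (fint N f [], fint N' f []) \<in> P"
    "\<And>v. v \<in> fv \<phi> \<Longrightarrow> (e v, e' v) \<in> P"
  shows "sat N e \<phi> \<longleftrightarrow> sat N' e' \<phi>"
  using assms(5-)
proof (induction \<phi> arbitrary: e e' P)
  case (Eq s t)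
  have "(tval N e s, tval N' e' s) \<in> P" "(tval N e t, tval N' e' t) \<in> P"
    using Eq by (auto intro!: tval_piso[of L])
  then show ?case using piso_eq[OF Eq(2)] by simp
next
  case (Rel r ts)
  then have "length ts = 3" "r = 0" using L by auto
  then obtain t1 t2 t3 where ts: "ts = [t1, t2, t3]"
    by (metis (no_types, opaque_lifting) length_0_conv length_Suc_conv numeral_3_eq_3)
  have "(tval N e t, tval N' e' t) \<in> P" if "t \<in> set ts" for t
    using Rel that by (intro tval_piso[of L]) (auto simp: list_all_iff)
  then show ?case using piso_rint[OF Rel(2)] by (simp add: ts \<open>r = 0\<close>)
next
  case (Neg \<phi>)
  have "sat N e \<phi> \<longleftrightarrow> sat N' e' \<phi>" by (rule Neg.IH) (use Neg.prems in auto)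
  then show ?case by simp
next
  case (Conj \<phi> \<psi>)
  have "sat N e \<phi> \<longleftrightarrow> sat N' e' \<phi>" by (rule Conj.IH) (use Conj.prems in auto)
  moreover have "sat N e \<psi> \<longleftrightarrow> sat N' e' \<psi>" by (rule Conj.IH) (use Conj.prems in auto)
  ultimately show ?case by simp
next
  case (Ex n \<phi>)
  have IH: "sat N (e(n := a)) \<phi> \<longleftrightarrow> sat N' (e'(n := a')) \<phi>" if "piso N N' (insert (a, a') P)" for a a'
    by (rule Ex.IH[OF _ that]) (use Ex.prems in auto)
  have "\<exists>a'\<in>dom N'. piso N N' (insert (a, a') P)" if "a \<in> dom N" for a
    using piso_extend[OF Ex.prems(2,3) gen(2) that] .
  moreover have "\<exists>a\<in>dom N. piso N N' (insert (a, a') P)" if "a' \<in> dom N'" for a'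
  proof -
    have "finite (P\<inverse>)" using Ex.prems(3) by simp
    from piso_extend[OF piso_converse[OF Ex.prems(2)] this gen(1) that]
    obtain a where a: "a \<in> dom N" "piso N' N (insert (a', a) (P\<inverse>))" by blast
    have "(insert (a', a) (P\<inverse>))\<inverse> = insert (a, a') P" by auto
    then show ?thesis using a piso_converse[OF a(2)] by auto
  qed
  ultimately show ?case using IH by (simp del: fun_upd_apply) meson
qed

lemma piso_struct_par [simp]: "piso (struct_par U) (struct_par U) P \<longleftrightarrow> piso U U P"
  by (simp add: piso_def)

lemma generic_struct_par [simp]: "generic (struct_par U) \<longleftrightarrow> generic U"
  by (simp add: generic_def generic_over_def realizes_def)

lemma satp_piso:
  assumes "generic U" "piso U U P" "finite P" "\<phi> \<in> fms_over tern_lang C V"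
    "\<And>c. c \<in> C \<Longrightarrow> (c, c) \<in> P" "\<And>v. v \<in> V \<Longrightarrow> (e v, e' v) \<in> P"
  shows "satp U e \<phi> \<longleftrightarrow> satp U e' \<phi>"
proof (rule back_and_forth)
  show "wf_fm (lang_par tern_lang C) \<phi>" using assms(4) by (simp add: fms_over_def)
  show "piso (struct_par U) (struct_par U) P" using assms(2) by simp
  show "\<forall>f\<in>fsyms (lang_par tern_lang C). farity (lang_par tern_lang C) f = 0 \<and>
      (fint (struct_par U) f [], fint (struct_par U) f []) \<in> P" using assms(5) by auto
  show "(e v, e' v) \<in> P" if "v \<in> fv \<phi>" for v using that assms(4,6) by (auto simp: fms_over_def)
qed (use assms in simp_all)

section \<open>The coin-flipping measure\<close>

text \<open>The outcome of the coins is the relation \<open>\<omega>\<close>. A point \<open>x\<close> follows it over \<open>C\<close> if \<open>R(x,b,c)\<close> agrees with \<open>(b,c) \<in> \<omega>\<close> on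
\<open>C\<close> and \<open>R\<close> fails at the other triples involving \<open>x\<close> and points of \<open>C\<close>.\<close>

definition coin_pt ::
    "('f, nat, 'a) struct \<Rightarrow> 'a set \<Rightarrow> ('a \<times> 'a) set \<Rightarrow> 'a \<Rightarrow> bool" where
  "coin_pt U C \<omega> = realizes U C (\<lambda>u v w. u = None \<and> v \<noteq> None \<and> w \<noteq> None \<and> (the v, the w) \<in> \<omega>)"

lemma realizes_mono: "realizes U C G x \<Longrightarrow> D \<subseteq> C \<Longrightarrow> realizes U D G x"
  unfolding realizes_def by (meson insert_mono subsetD)

lemma realizesD: "realizes U C G x \<Longrightarrow> x \<in> dom U \<and> x \<notin> C"
  by (simp add: realizes_def)

lemma coin_pt_mono: "coin_pt U C \<omega> x \<Longrightarrow> D \<subseteq> C \<Longrightarrow> coin_pt U D \<omega> x"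
  unfolding coin_pt_def by (rule realizes_mono)

lemma coin_pt_rint:
  assumes "coin_pt U C \<omega> x" "b \<in> C" "c \<in> C"
  shows "rint U 0 [x, b, c] \<longleftrightarrow> (b, c) \<in> \<omega>"
proof -
  have "x \<notin> C" using assms(1) by (simp add: coin_pt_def realizes_def)
  then show ?thesis
    using realizes_rint[OF assms(1)[unfolded coin_pt_def], of x b c] assms(2,3)
    by (auto simp: new_pt_def)
qed

lemma coin_pt_piso:
  assumes P: "piso U U P" and x: "coin_pt U (Domain P) \<omega> x" and x': "coin_pt U (Range P) \<omega>' x'"
    and \<omega>: "\<And>b b' c c'. (b, b') \<in> P \<Longrightarrow> (c, c') \<in> P \<Longrightarrow> (b, c) \<in> \<omega> \<longleftrightarrow> (b', c') \<in> \<omega>'"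
  shows "piso U U (insert (x, x') P)"
proof (rule piso_insert[OF P x[unfolded coin_pt_def] x'[unfolded coin_pt_def]])
  have new: "x \<notin> Domain P" "x' \<notin> Range P"
    using x x' by (auto simp: coin_pt_def realizes_def)
  have eq: "x = a \<longleftrightarrow> x' = a'" if "(a, a') \<in> insert (x, x') P" for a a'
    using that new by auto
  fix a a' b b' c c'
  assume abc: "(a, a') \<in> insert (x, x') P" "(b, b') \<in> insert (x, x') P" "(c, c') \<in> insert (x, x') P"
  show "(new_pt x a = None \<and> new_pt x b \<noteq> None \<and> new_pt x c \<noteq> None \<and> (the (new_pt x b), the (new_pt x c)) \<in> \<omega>)
      \<longleftrightarrow> (new_pt x' a' = None \<and> new_pt x' b' \<noteq> None \<and> new_pt x' c' \<noteq> None
        \<and> (the (new_pt x' b'), the (new_pt x' c')) \<in> \<omega>')"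
    using eq[OF abc(1)] eq[OF abc(2)] eq[OF abc(3)] abc(2,3) \<omega>[of b b' c c'] by (auto simp: new_pt_def)
qed

lemma finite_Id_on: "finite C \<Longrightarrow> finite (Id_on C)"
  by (simp add: Id_on_def)

lemma piso_Id_on: "C \<subseteq> dom U \<Longrightarrow> piso U U (Id_on C)"
  by (rule pisoI) auto

text \<open>The probability of \<open>Q\<close> for a random subset of the finite set \<open>D\<close>.\<close>

definition freq :: "'b set \<Rightarrow> ('b set \<Rightarrow> bool) \<Rightarrow> real" where
  "freq D Q = real (card {S \<in> Pow D. Q S}) / 2 ^ card D"

text \<open>Coins that do not influence the event may be left out.\<close>

lemma freq_restrict:
  assumes D: "finite D'" "D \<subseteq> D'" and Q: "\<And>S. S \<subseteq> D' \<Longrightarrow> Q S \<longleftrightarrow> Q (S \<inter> D)"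
  shows "freq D' Q = freq D Q"
proof -
  have bij: "bij_betw (\<lambda>(S, R). S \<union> R) ({S \<in> Pow D. Q S} \<times> Pow (D' - D)) {S \<in> Pow D'. Q S}"
  proof (rule bij_betw_byWitness[where f' = "\<lambda>S. (S \<inter> D, S - D)"])
    show "(\<lambda>(S, R). S \<union> R) ` ({S \<in> Pow D. Q S} \<times> Pow (D' - D)) \<subseteq> {S \<in> Pow D'. Q S}"
    proof (rule image_subsetI, clarsimp)
      fix S R assume S: "S \<subseteq> D" "Q S" and R: "R \<subseteq> D' - D"
      have "(S \<union> R) \<inter> D = S" using S R by auto
      then have "Q (S \<union> R)" using Q[of "S \<union> R"] S R D(2) by auto
      then show "S \<subseteq> D' \<and> R \<subseteq> D' \<and> Q (S \<union> R)" using S R D(2) by auto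
    qed
    show "(\<lambda>S. (S \<inter> D, S - D)) ` {S \<in> Pow D'. Q S} \<subseteq> {S \<in> Pow D. Q S} \<times> Pow (D' - D)"
      using Q by auto
  qed auto
  have fin: "finite D" using D finite_subset by blast
  have "card {S \<in> Pow D'. Q S} = card {S \<in> Pow D. Q S} * 2 ^ card (D' - D)"
    using bij_betw_same_card[OF bij] D(1) by (simp add: card_cartesian_product card_Pow)
  moreover have "card D' = card D + card (D' - D)"
    using card_Diff_subset[OF fin D(2)] card_mono[OF D] by simp
  ultimately show ?thesis by (simp add: freq_def power_add)
qed

lemma freq_bounds: "finite D \<Longrightarrow> 0 \<le> freq D Q \<and> freq D Q \<le> 1"
proof -
  assume D: "finite D"
  have "card {S \<in> Pow D. Q S} \<le> card (Pow D)" using D by (intro card_mono) auto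
  then have "real (card {S \<in> Pow D. Q S}) \<le> 2 ^ card D"
    using D of_nat_mono[where 'a = real] by (fastforce simp: card_Pow)
  then show ?thesis by (simp add: freq_def)
qed

context
  fixes U :: "(nat, nat, 'a) struct"
  assumes gen: "generic U"
begin

lemma coin_pt_exists:
  assumes "finite C" "C \<subseteq> dom U"
  obtains x where "coin_pt U C \<omega> x"
proof -
  have "generic_over U C" using gen assms by (simp add: generic_def)
  then have "\<exists>x. coin_pt U C \<omega> x" by (simp add: generic_over_def coin_pt_def)
  with that show thesis by blast
qed

text \<open>The truth value of \<open>\<phi>\<close> at an ideal point following \<open>\<omega>\<close> over the whole model. A point following \<open>\<omega>\<close> over
the finitely many parameters of \<open>\<phi>\<close> decides it, and by back-and-forth the choice of
that point and of the finite set is irrelevant.\<close>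

definition coin_val :: "(nat + 'a, nat) fm \<Rightarrow> ('a \<times> 'a) set \<Rightarrow> bool" where
  "coin_val \<phi> \<omega> \<longleftrightarrow> (\<exists>C x. finite C \<and> C \<subseteq> dom U \<and> \<phi> \<in> fms_over tern_lang C {0} \<and>
     coin_pt U C \<omega> x \<and> satp U (\<lambda>_. x) \<phi>)"

lemma coin_val_eq:
  assumes C: "finite C" "C \<subseteq> dom U" and \<phi>: "\<phi> \<in> fms_over tern_lang C {0}" and x: "coin_pt U C \<omega> x"
  shows "coin_val \<phi> \<omega> \<longleftrightarrow> satp U (\<lambda>_. x) \<phi>"
proof -
  have same: "satp U (\<lambda>_. y) \<phi> \<longleftrightarrow> satp U (\<lambda>_. z) \<phi>"
    if "finite D" "D \<subseteq> dom U" "\<phi> \<in> fms_over tern_lang D {0}" "coin_pt U D \<omega> y" "coin_pt U D \<omega> z" for D y z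
  proof (rule satp_piso[OF gen])
    show "piso U U (insert (y, z) (Id_on D))"
      by (rule coin_pt_piso[OF piso_Id_on]) (use that in auto)
    show "\<phi> \<in> fms_over tern_lang D {0}" by fact
  qed (use that finite_Id_on in auto)
  show ?thesis
  proof
    assume "coin_val \<phi> \<omega>"
    then obtain D y where D: "finite D" "D \<subseteq> dom U" "\<phi> \<in> fms_over tern_lang D {0}"
      "coin_pt U D \<omega> y" "satp U (\<lambda>_. y) \<phi>" unfolding coin_val_def by blast
    obtain z where z: "coin_pt U (C \<union> D) \<omega> z" using coin_pt_exists[of "C \<union> D"] C D by auto
    have zD: "coin_pt U D \<omega> z" and zC: "coin_pt U C \<omega> z" using z by (auto intro: coin_pt_mono)
    show "satp U (\<lambda>_. x) \<phi>"
      using same[OF D(1-4) zD] D(5) same[OF C \<phi> x zC] by simp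
  next
    assume "satp U (\<lambda>_. x) \<phi>"
    then show "coin_val \<phi> \<omega>" unfolding coin_val_def using assms by blast
  qed
qed

lemma coin_val_restrict:
  assumes C: "finite C" "C \<subseteq> dom U" and \<phi>: "\<phi> \<in> fms_over tern_lang C {0}"
    and "\<omega> \<inter> C \<times> C = \<omega>' \<inter> C \<times> C"
  shows "coin_val \<phi> \<omega> \<longleftrightarrow> coin_val \<phi> \<omega>'"
proof -
  obtain x where x: "coin_pt U C \<omega> x" by (rule coin_pt_exists[OF C])
  obtain x' where x': "coin_pt U C \<omega>' x'" by (rule coin_pt_exists[OF C])
  have "satp U (\<lambda>_. x) \<phi> \<longleftrightarrow> satp U (\<lambda>_. x') \<phi>"
  proof (rule satp_piso[OF gen])
    show "piso U U (insert (x, x') (Id_on C))"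
      by (rule coin_pt_piso[OF piso_Id_on[OF C(2)]]) (use x x' assms(4) in auto)
    show "\<phi> \<in> fms_over tern_lang C {0}" by fact
  qed (use C finite_Id_on in auto)
  then show ?thesis using coin_val_eq[OF C \<phi> x] coin_val_eq[OF C \<phi> x'] by simp
qed

definition coin_measure :: "(nat + 'a, nat) fm \<Rightarrow> real" where
  "coin_measure \<phi> = (let C = SOME C. finite C \<and> C \<subseteq> dom U \<and> \<phi> \<in> fms_over tern_lang C {0}
     in freq (C \<times> C) (coin_val \<phi>))"

lemma coin_measure_eq:
  assumes C: "finite C" "C \<subseteq> dom U" and \<phi>: "\<phi> \<in> fms_over tern_lang C {0}"
  shows "coin_measure \<phi> = freq (C \<times> C) (coin_val \<phi>)"
proof -
  define D where "D = (SOME C. finite C \<and> C \<subseteq> dom U \<and> \<phi> \<in> fms_over tern_lang C {0})"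
  have D: "finite D \<and> D \<subseteq> dom U \<and> \<phi> \<in> fms_over tern_lang D {0}"
    unfolding D_def using assms by (intro someI_ex[where P = "\<lambda>C. finite C \<and> C \<subseteq> dom U \<and> \<phi> \<in> fms_over tern_lang C {0}"]) blast
  have "freq ((C \<union> D) \<times> (C \<union> D)) (coin_val \<phi>) = freq (B \<times> B) (coin_val \<phi>)"
    if "B \<subseteq> C \<union> D" "finite B" "B \<subseteq> dom U" "\<phi> \<in> fms_over tern_lang B {0}" for B
  proof (rule freq_restrict)
    show "coin_val \<phi> S \<longleftrightarrow> coin_val \<phi> (S \<inter> B \<times> B)" for S
      by (rule coin_val_restrict[OF that(2-4)]) auto
  qed (use that C(1) D in auto)
  from this[of C] this[of D] show ?thesis
    using C \<phi> D by (simp add: coin_measure_def Let_def flip: D_def)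
qed

text \<open>Hence the formulas with \<open>coin_val \<phi> \<omega>\<close> behave like the type of a point of the model as far as finitely many of them
are concerned. All Boolean properties of \<open>coin_val\<close> are instances.\<close>

lemma coin_val_realized:
  assumes "finite \<Delta>" "\<Delta> \<subseteq> fms_over tern_lang (dom U) {0}"
  obtains a where "a \<in> {0} \<rightarrow>\<^sub>E dom U" "\<forall>\<phi>\<in>\<Delta>. coin_val \<phi> \<omega> \<longleftrightarrow> satp U a \<phi>"
proof -
  obtain C where C: "finite C" "C \<subseteq> dom U" "\<Delta> \<subseteq> fms_over tern_lang C {0}"
    by (rule finite_parameters_set[OF assms])
  obtain x where x: "coin_pt U C \<omega> x" by (rule coin_pt_exists[OF C(1,2)])
  let ?a = "restrict (\<lambda>_. x) {0 :: nat}"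
  have "coin_val \<phi> \<omega> \<longleftrightarrow> satp U ?a \<phi>" if "\<phi> \<in> \<Delta>" for \<phi>
  proof -
    have \<phi>: "\<phi> \<in> fms_over tern_lang C {0}" using C(3) that by blast
    have "satp U (\<lambda>_. x) \<phi> \<longleftrightarrow> satp U ?a \<phi>" using \<phi> by (intro sat_cong) (auto simp: fms_over_def)
    then show ?thesis using coin_val_eq[OF C(1,2) \<phi> x] by simp
  qed
  moreover have "?a \<in> {0} \<rightarrow>\<^sub>E dom U" using x by (simp add: coin_pt_def realizes_def)
  ultimately show thesis by (intro that[of ?a]) auto
qed

lemma keisler_coin_measure: "keisler tern_lang U {0} coin_measure"
  unfolding keisler_def
proof (intro conjI ballI impI)
  let ?D = "fms_over tern_lang (dom U) {0}"
  fix \<phi> assume \<phi>: "\<phi> \<in> ?D"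
  obtain C where C: "finite C" "C \<subseteq> dom U" "\<phi> \<in> fms_over tern_lang C {0}"
    by (rule finite_parameters[OF \<phi>])
  show "0 \<le> coin_measure \<phi>" using freq_bounds[of "C \<times> C"] C(1) by (simp add: coin_measure_eq[OF C])
  show "coin_measure \<phi> = 1" if valid: "\<forall>a\<in>{0} \<rightarrow>\<^sub>E dom U. satp U a \<phi>"
  proof -
    have "coin_val \<phi> S" for S
      by (rule coin_val_realized[of "{\<phi>}" S]) (use \<phi> valid in auto)
    then have "{S \<in> Pow (C \<times> C). coin_val \<phi> S} = Pow (C \<times> C)" by auto
    then show ?thesis using C(1) by (simp add: coin_measure_eq[OF C] freq_def card_Pow)
  qed
next
  let ?D = "fms_over tern_lang (dom U) {0}"
  fix \<phi> \<psi> assume \<phi>: "\<phi> \<in> ?D" and \<psi>: "\<psi> \<in> ?D"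
  then have "Conj \<phi> \<psi> \<in> ?D" by simp
  then obtain C where C: "finite C" "C \<subseteq> dom U" "Conj \<phi> \<psi> \<in> fms_over tern_lang C {0}"
    by (rule finite_parameters)
  have \<mu>: "coin_measure \<phi> = freq (C \<times> C) (coin_val \<phi>)" "coin_measure \<psi> = freq (C \<times> C) (coin_val \<psi>)"
    "coin_measure (Disj \<phi> \<psi>) = freq (C \<times> C) (coin_val (Disj \<phi> \<psi>))"
    using C(3) by (auto intro!: coin_measure_eq C(1,2))
  show "coin_measure \<phi> = coin_measure \<psi>" if eq: "\<forall>a\<in>{0} \<rightarrow>\<^sub>E dom U. satp U a \<phi> \<longleftrightarrow> satp U a \<psi>"
  proof -
    have "coin_val \<phi> S \<longleftrightarrow> coin_val \<psi> S" for S
      by (rule coin_val_realized[of "{\<phi>, \<psi>}" S]) (use \<phi> \<psi> eq in auto)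
    then show ?thesis by (simp add: \<mu> freq_def)
  qed
  show "coin_measure (Disj \<phi> \<psi>) = coin_measure \<phi> + coin_measure \<psi>"
    if disj: "\<forall>a\<in>{0} \<rightarrow>\<^sub>E dom U. \<not> satp U a (Conj \<phi> \<psi>)"
  proof -
    have *: "(coin_val (Disj \<phi> \<psi>) S \<longleftrightarrow> coin_val \<phi> S \<or> coin_val \<psi> S) \<and> \<not> (coin_val \<phi> S \<and> coin_val \<psi> S)" for S
      by (rule coin_val_realized[of "{\<phi>, \<psi>, Disj \<phi> \<psi>}" S]) (use \<phi> \<psi> disj in auto)
    then have "{S \<in> Pow (C \<times> C). coin_val \<phi> S} \<inter> {S \<in> Pow (C \<times> C). coin_val \<psi> S} = {}" by blast
    moreover have "{S \<in> Pow (C \<times> C). coin_val (Disj \<phi> \<psi>) S}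
        = {S \<in> Pow (C \<times> C). coin_val \<phi> S} \<union> {S \<in> Pow (C \<times> C). coin_val \<psi> S}"
      using * by blast
    ultimately have "card {S \<in> Pow (C \<times> C). coin_val (Disj \<phi> \<psi>) S}
        = card {S \<in> Pow (C \<times> C). coin_val \<phi> S} + card {S \<in> Pow (C \<times> C). coin_val \<psi> S}"
      using C(1) by (simp add: card_Un_disjoint)
    then show ?thesis by (simp add: \<mu> freq_def add_divide_distrib)
  qed
qed

definition coin_type :: "('a \<times> 'a) set \<Rightarrow> (nat + 'a, nat) fm set" where
  "coin_type \<omega> = {\<phi> \<in> fms_over tern_lang (dom U) {0}. coin_val \<phi> \<omega>}"

text \<open>The formula \<open>\<phi>\<close> holds at the outcome \<open>\<omega>\<close>, and only the finitely many coins on the parameters of \<open>\<phi>\<close> matter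
for it; so it holds with positive probability.\<close>

lemma coin_type_in_support: "coin_type \<omega> \<in> support tern_lang U {0} coin_measure"
proof -
  let ?D = "fms_over tern_lang (dom U) {0}"
  have "fin_sat U {0} (coin_type \<omega>)"
    unfolding fin_sat_def
  proof (intro allI impI)
    fix \<Delta> assume \<Delta>: "finite \<Delta> \<and> \<Delta> \<subseteq> coin_type \<omega>"
    then have "finite \<Delta>" "\<Delta> \<subseteq> ?D" by (auto simp: coin_type_def)
    then obtain a where a: "a \<in> {0} \<rightarrow>\<^sub>E dom U" "\<forall>\<phi>\<in>\<Delta>. coin_val \<phi> \<omega> \<longleftrightarrow> satp U a \<phi>"
      by (rule coin_val_realized)
    have "\<forall>\<phi>\<in>\<Delta>. satp U a \<phi>" using \<Delta> a(2) unfolding coin_type_def by blast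
    with a(1) show "\<exists>a\<in>{0} \<rightarrow>\<^sub>E dom U. \<forall>\<phi>\<in>\<Delta>. satp U a \<phi>" by blast
  qed
  moreover have "\<phi> \<in> coin_type \<omega> \<or> Neg \<phi> \<in> coin_type \<omega>" if "\<phi> \<in> ?D" for \<phi>
  proof -
    have "coin_val (Neg \<phi>) \<omega> \<longleftrightarrow> \<not> coin_val \<phi> \<omega>"
      by (rule coin_val_realized[of "{\<phi>, Neg \<phi>}" \<omega>]) (use that in auto)
    with that show ?thesis by (auto simp: coin_type_def)
  qed
  moreover have "coin_measure \<phi> > 0" if \<phi>: "\<phi> \<in> coin_type \<omega>" for \<phi>
  proof -
    have \<phi>': "\<phi> \<in> ?D" "coin_val \<phi> \<omega>" using \<phi> by (auto simp: coin_type_def)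
    obtain C where C: "finite C" "C \<subseteq> dom U" "\<phi> \<in> fms_over tern_lang C {0}"
      by (rule finite_parameters[OF \<phi>'(1)])
    have "coin_val \<phi> (\<omega> \<inter> C \<times> C)" using coin_val_restrict[OF C, of \<omega> "\<omega> \<inter> C \<times> C"] \<phi>'(2) by auto
    then have "{S \<in> Pow (C \<times> C). coin_val \<phi> S} \<noteq> {}" by blast
    then have "card {S \<in> Pow (C \<times> C). coin_val \<phi> S} > 0" using C(1) by (simp add: card_gt_0_iff)
    then show ?thesis by (simp add: coin_measure_eq[OF C] freq_def)
  qed
  ultimately show ?thesis by (auto simp: support_def types_def coin_type_def)
qed

lemma coin_type_rel:
  assumes "b \<in> dom U" "c \<in> dom U"
  shows "Rel 0 [Var 0, App (Inr b) [], App (Inr c) []] \<in> coin_type \<omega> \<longleftrightarrow> (b, c) \<in> \<omega>"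
proof -
  let ?\<phi> = "Rel 0 [Var 0, App (Inr b) [], App (Inr c) []]"
  have C: "finite {b, c}" "{b, c} \<subseteq> dom U" "?\<phi> \<in> fms_over tern_lang {b, c} {0}"
    using assms by (auto simp: fms_over_def)
  obtain x where x: "coin_pt U {b, c} \<omega> x" by (rule coin_pt_exists[OF C(1,2)])
  have "?\<phi> \<in> fms_over tern_lang (dom U) {0}" using C(2,3) by (elim fms_over_mono) auto
  then show ?thesis
    using coin_val_eq[OF C x] coin_pt_rint[OF x, of b c] by (simp add: coin_type_def)
qed

text \<open>The isomorphism between the parameters of the two formulas transports outcomes to outcomes, and by
back-and-forth it preserves the truth of \<open>\<phi>\<close>.\<close>

lemma coin_measure_inst_cong:
  assumes C0: "finite C0" "C0 \<subseteq> dom U" and \<phi>: "\<phi> \<in> fms_over tern_lang C0 ({0} \<union> Y)" and Y: "finite Y" "0 \<notin> Y"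
    and P: "piso U U P" "P = Id_on C0 \<union> (\<lambda>y. (b y, b' y)) ` Y"
  shows "coin_measure (inst Y b \<phi>) = coin_measure (inst Y b' \<phi>)"
proof -
  define C where "C = Domain P"
  define h where "h c = (SOME c'. (c, c') \<in> P)" for c
  have hP: "h c = c'" if "(c, c') \<in> P" for c c'
  proof -
    have "(c, h c) \<in> P" unfolding h_def using that by (rule someI)
    then show ?thesis using piso_eq[OF P(1)] that by blast
  qed
  have finP: "finite P" using C0 Y P(2) by (simp add: Id_on_def)
  have inj: "inj_on h C"
    unfolding inj_on_def C_def using hP piso_eq[OF P(1)] by (metis DomainE)
  have R: "Range P = h ` C" using hP by (force simp: C_def image_iff)
  have fin: "finite C" "finite (h ` C)" using finP by (auto simp: C_def finite_Domain)
  have "Domain P \<subseteq> dom U" "Range P \<subseteq> dom U" using piso_dom[OF P(1)] by blast+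
  then have sub: "C \<subseteq> dom U" "h ` C \<subseteq> dom U" using R by (simp_all add: C_def)
  have C0C: "C0 \<subseteq> C" "C0 \<subseteq> h ` C" "b ` Y \<subseteq> C" "b' ` Y \<subseteq> h ` C"
    unfolding R[symmetric] unfolding C_def P(2) by auto
  have inst: "inst Y b \<phi> \<in> fms_over tern_lang C {0}" "inst Y b' \<phi> \<in> fms_over tern_lang (h ` C) {0}"
    using C0C \<phi> by (auto intro!: inst_in_fms_over[where A = C0])
  let ?H = "\<lambda>S. map_prod h h ` S"
  have injH: "inj_on (map_prod h h) (C \<times> C)" by (rule map_prod_inj_on[OF inj inj])
  have val: "coin_val (inst Y b \<phi>) S \<longleftrightarrow> coin_val (inst Y b' \<phi>) (?H S)" if S: "S \<subseteq> C \<times> C" for S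
  proof -
    obtain x where x: "coin_pt U C S x" by (rule coin_pt_exists[OF fin(1) sub(1)])
    obtain x' where x': "coin_pt U (h ` C) (?H S) x'" by (rule coin_pt_exists[OF fin(2) sub(2)])
    have "piso U U (insert (x, x') P)"
    proof (rule coin_pt_piso[OF P(1)])
      show "coin_pt U (Domain P) S x" using x by (simp add: C_def)
      show "coin_pt U (Range P) (?H S) x'" using x' by (simp add: R)
      fix u u' v v' assume uv: "(u, u') \<in> P" "(v, v') \<in> P"
      then have "u \<in> C" "v \<in> C" "u' = h u" "v' = h v" using hP by (auto simp: C_def)
      then show "(u, v) \<in> S \<longleftrightarrow> (u', v') \<in> ?H S"
        using inj_on_image_mem_iff[OF injH _ S, of "(u, v)"] by simp
    qed
    then have "satp U (override_on (\<lambda>_. x) b Y) \<phi> \<longleftrightarrow> satp U (override_on (\<lambda>_. x') b' Y) \<phi>"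
      using finP P(2) by (intro satp_piso[OF gen _ _ \<phi>, of "insert (x, x') P"]) (auto simp: override_on_def)
    then show ?thesis
      unfolding coin_val_eq[OF fin(1) sub(1) inst(1) x] coin_val_eq[OF fin(2) sub(2) inst(2) x'] satp_inst .
  qed
  have im: "?H ` {S \<in> Pow (C \<times> C). coin_val (inst Y b \<phi>) S} = {S \<in> Pow (h ` C \<times> h ` C). coin_val (inst Y b' \<phi>) S}"
  proof -
    have "?H ` Pow (C \<times> C) = Pow (h ` C \<times> h ` C)"
      by (simp add: image_Pow_surj map_prod_surj_on[OF refl refl])
    moreover have "?H ` {S \<in> Pow (C \<times> C). coin_val (inst Y b \<phi>) S} = {S \<in> ?H ` Pow (C \<times> C). coin_val (inst Y b' \<phi>) S}"
      (is "?l = ?r")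
    proof
      show "?l \<subseteq> ?r" using val by blast
      show "?r \<subseteq> ?l" using val by blast
    qed
    ultimately show ?thesis by (simp only:)
  qed
  have "inj_on ?H {S \<in> Pow (C \<times> C). coin_val (inst Y b \<phi>) S}"
    by (rule inj_on_subset[OF inj_on_image_Pow[OF injH]]) auto
  from card_image[OF this] have "card {S \<in> Pow (h ` C \<times> h ` C). coin_val (inst Y b' \<phi>) S}
      = card {S \<in> Pow (C \<times> C). coin_val (inst Y b \<phi>) S}" unfolding im .
  moreover have "card (h ` C) = card C" by (rule card_image[OF inj])
  ultimately show ?thesis
    by (simp add: coin_measure_eq[OF fin(1) sub(1) inst(1)] coin_measure_eq[OF fin(2) sub(2) inst(2)]
        freq_def card_cartesian_product)
qed

end

section \<open>Definability of the coin-flipping measure\<close>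

text \<open>The language has no function symbols, so with constants for \<open>C\<close> these are all terms in the variables \<open>Y\<close>, and finite \<open>Y\<close>, \<open>C\<close> leave
only finitely many atomic formulas.\<close>

definition pterms :: "nat set \<Rightarrow> 'a set \<Rightarrow> (nat + 'a) trm set" where
  "pterms Y C = Var ` Y \<union> (\<lambda>c. App (Inr c) []) ` C"

definition atoms :: "nat set \<Rightarrow> 'a set \<Rightarrow> (nat + 'a, nat) fm set" where
  "atoms Y C = (\<lambda>(s, t). Eq s t) ` (pterms Y C \<times> pterms Y C) \<union>
     (\<lambda>(s, t, u). Rel 0 [s, t, u]) ` (pterms Y C \<times> pterms Y C \<times> pterms Y C)"

lemma finite_atoms: "finite Y \<Longrightarrow> finite C \<Longrightarrow> finite (atoms Y C)"
  by (simp add: atoms_def pterms_def)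

lemma Eq_in_atoms: "s \<in> pterms Y C \<Longrightarrow> t \<in> pterms Y C \<Longrightarrow> Eq s t \<in> atoms Y C"
  by (auto simp: atoms_def)

lemma Rel_in_atoms:
  "s \<in> pterms Y C \<Longrightarrow> t \<in> pterms Y C \<Longrightarrow> u \<in> pterms Y C \<Longrightarrow> Rel 0 [s, t, u] \<in> atoms Y C"
  by (force simp: atoms_def)

lemma atoms_cases:
  assumes "\<theta> \<in> atoms Y C"
  obtains s t where "s \<in> pterms Y C" "t \<in> pterms Y C" "\<theta> = Eq s t"
    | s t u where "s \<in> pterms Y C" "t \<in> pterms Y C" "u \<in> pterms Y C" "\<theta> = Rel 0 [s, t, u]"
  using assms unfolding atoms_def by auto

lemma pterms_mono: "Y \<subseteq> Y' \<Longrightarrow> C \<subseteq> C' \<Longrightarrow> pterms Y C \<subseteq> pterms Y' C'"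
  by (auto simp: pterms_def)

lemma atoms_fms: "\<theta> \<in> atoms Y C \<Longrightarrow> \<theta> \<in> fms_over tern_lang C Y"
  by (auto simp: atoms_def pterms_def fms_over_def)

lemma piso_of_atoms:
  fixes U :: "(nat, nat, 'a) struct"
  assumes C: "C \<subseteq> dom U" and b: "\<And>y. y \<in> Y \<Longrightarrow> b y \<in> dom U" "\<And>y. y \<in> Y \<Longrightarrow> b' y \<in> dom U"
    and agree: "\<And>\<theta>. \<theta> \<in> atoms Y C \<Longrightarrow> satp U b \<theta> \<longleftrightarrow> satp U b' \<theta>"
  shows "piso U U (Id_on C \<union> (\<lambda>y. (b y, b' y)) ` Y)"
proof -
  let ?f = "\<lambda>t. (tval (struct_par U) b t, tval (struct_par U) b' t)"
  have eq: "Id_on C \<union> (\<lambda>y. (b y, b' y)) ` Y = ?f ` pterms Y C"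
    by (auto simp: pterms_def image_Un image_image Id_on_def)
  have "piso U U (?f ` pterms Y C)"
  proof (rule pisoI)
    fix a a' assume "(a, a') \<in> ?f ` pterms Y C"
    then show "a \<in> dom U \<and> a' \<in> dom U" using C b by (auto simp: pterms_def)
  next
    fix a a' c c' assume "(a, a') \<in> ?f ` pterms Y C" "(c, c') \<in> ?f ` pterms Y C"
    then obtain s t where st: "s \<in> pterms Y C" "t \<in> pterms Y C" "(a, a') = ?f s" "(c, c') = ?f t" by blast
    then show "a = c \<longleftrightarrow> a' = c'" using agree[OF Eq_in_atoms[OF st(1,2)]] by simp
  next
    fix a a' c c' d d'
    assume "(a, a') \<in> ?f ` pterms Y C" "(c, c') \<in> ?f ` pterms Y C" "(d, d') \<in> ?f ` pterms Y C"
    then obtain s t u where st: "s \<in> pterms Y C" "t \<in> pterms Y C" "u \<in> pterms Y C"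
      "(a, a') = ?f s" "(c, c') = ?f t" "(d, d') = ?f u" by blast
    then show "rint U 0 [a, c, d] \<longleftrightarrow> rint U 0 [a', c', d']"
      using agree[OF Rel_in_atoms[OF st(1-3)]] by simp
  qed
  then show ?thesis by (simp only: eq)
qed

lemma coin_measure_atoms_cong:
  fixes U :: "(nat, nat, 'a) struct"
  assumes gen: "generic U" and C: "finite C" "C \<subseteq> dom U" and \<phi>: "\<phi> \<in> fms_over tern_lang C ({0} \<union> Y)"
    and Y: "finite Y" "{0} \<inter> Y = {}" and b: "b \<in> Y \<rightarrow>\<^sub>E dom U" "b' \<in> Y \<rightarrow>\<^sub>E dom U"
    and agree: "\<And>\<theta>. \<theta> \<in> atoms Y C \<Longrightarrow> satp U b \<theta> \<longleftrightarrow> satp U b' \<theta>"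
  shows "coin_measure U (inst Y b \<phi>) = coin_measure U (inst Y b' \<phi>)"
proof (rule coin_measure_inst_cong[OF gen C \<phi> Y(1)])
  show "0 \<notin> Y" using Y(2) by simp
  show "piso U U (Id_on C \<union> (\<lambda>y. (b y, b' y)) ` Y)"
    by (rule piso_of_atoms[OF C(2) _ _ agree]) (use b in auto)
qed simp

lemma coin_measure_invariant:
  fixes U :: "(nat, nat, 'a) struct"
  assumes gen: "generic U" and M: "M \<subseteq> dom U"
  shows "invariant_over tern_lang U {0} M (coin_measure U)"
  unfolding invariant_over_def
proof (intro allI impI, elim conjE)
  fix Y \<phi> b b'
  assume Y: "finite Y" "{0} \<inter> Y = {}" and \<phi>: "\<phi> \<in> fms_over tern_lang M ({0} \<union> Y)"
    and b: "b \<in> Y \<rightarrow>\<^sub>E dom U" "b' \<in> Y \<rightarrow>\<^sub>E dom U" and tp: "tp tern_lang U M Y b = tp tern_lang U M Y b'"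
  obtain C where C: "finite C" "C \<subseteq> M" "\<phi> \<in> fms_over tern_lang C ({0} \<union> Y)"
    by (rule finite_parameters[OF \<phi>])
  have CU: "C \<subseteq> dom U" using C(2) M by simp
  have "satp U b \<theta> \<longleftrightarrow> satp U b' \<theta>" if "\<theta> \<in> atoms Y C" for \<theta>
  proof -
    have "\<theta> \<in> fms_over tern_lang M Y" using fms_over_mono[OF atoms_fms[OF that] C(2)] by simp
    then have "satp U b \<theta> \<longleftrightarrow> \<theta> \<in> tp tern_lang U M Y b" "satp U b' \<theta> \<longleftrightarrow> \<theta> \<in> tp tern_lang U M Y b'"
      by (simp_all add: tp_def)
    then show ?thesis using tp by simp
  qed
  then show "coin_measure U (inst Y b \<phi>) = coin_measure U (inst Y b' \<phi>)"
    by (rule coin_measure_atoms_cong[OF gen C(1) CU C(3) Y b])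
qed

lemma topspace_type_space: "topspace (type_space L U A Y) = types L U A Y"
proof -
  have "\<exists>\<psi>\<in>fms_over L A Y. \<psi> \<in> q" if q: "q \<in> types L U A Y" for q
  proof -
    have "Top \<in> fms_over L A Y" by (simp add: fms_over_def Top_def)
    then have "Top \<in> q \<or> Neg Top \<in> q" using q by (simp add: types_def)
    then show ?thesis using \<open>Top \<in> fms_over L A Y\<close> fms_simps(1) by blast
  qed
  then show ?thesis unfolding type_space_def by (auto simp: topology_generated_by_topspace)
qed

lemma openin_type_space: "\<psi> \<in> fms_over L A Y \<Longrightarrow> openin (type_space L U A Y) {q \<in> types L U A Y. \<psi> \<in> q}"
  unfolding type_space_def by (intro topology_generated_by_Basis) blast

text \<open>Functions that are locally constant on the type space are continuous.\<close>

lemma continuous_map_type_space: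
  assumes "\<And>q. q \<in> types L U A Y \<Longrightarrow> \<exists>\<psi>\<in>q. \<forall>q'\<in>types L U A Y. \<psi> \<in> q' \<longrightarrow> F q' = F q"
    and "\<And>q. q \<in> types L U A Y \<Longrightarrow> F q \<in> S"
  shows "continuous_map (type_space L U A Y) (top_of_set S) F"
  unfolding continuous_map_def topspace_type_space
proof (intro conjI allI impI)
  show "F \<in> types L U A Y \<rightarrow> topspace (top_of_set S)" using assms(2) by auto
  fix V
  show "openin (type_space L U A Y) {q \<in> types L U A Y. F q \<in> V}"
  proof (subst openin_subopen, intro ballI)
    fix q assume "q \<in> {q \<in> types L U A Y. F q \<in> V}"
    then have q: "q \<in> types L U A Y" "F q \<in> V" by auto
    obtain \<psi> where \<psi>: "\<psi> \<in> q" "\<forall>q'\<in>types L U A Y. \<psi> \<in> q' \<longrightarrow> F q' = F q" using assms(1)[OF q(1)] by blast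
    have "\<psi> \<in> fms_over L A Y" using \<psi>(1) q(1) by (auto simp: types_def)
    then have "openin (type_space L U A Y) {q \<in> types L U A Y. \<psi> \<in> q}" by (rule openin_type_space)
    moreover have "{q \<in> types L U A Y. \<psi> \<in> q} \<subseteq> {q \<in> types L U A Y. F q \<in> V}" using \<psi>(2) q(2) by auto
    ultimately show "\<exists>T. openin (type_space L U A Y) T \<and> q \<in> T \<and> T \<subseteq> {q \<in> types L U A Y. F q \<in> V}"
      using q(1) \<psi>(1) by blast
  qed
qed

lemma coin_measure_bounds:
  assumes gen: "generic U" and \<phi>: "\<phi> \<in> fms_over tern_lang (dom U) {0}"
  shows "coin_measure U \<phi> \<in> {0..1}"
proof -
  obtain C where C: "finite C" "C \<subseteq> dom U" "\<phi> \<in> fms_over tern_lang C {0}"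
    by (rule finite_parameters[OF \<phi>])
  then show ?thesis using freq_bounds[of "C \<times> C"] by (simp add: coin_measure_eq[OF gen C])
qed

text \<open>For a formula \<open>\<phi>(x;y)\<close> with parameters \<open>C\<close> the conjunction of all atomic and negated atomic formulas over \<open>C\<close>
that \<open>b\<close> satisfies fixes the measure of \<open>\<phi>(x;b)\<close>; so the measure is locally constant in the
type of \<open>b\<close>. By saturation each type over \<open>M\<close> is the type of some \<open>b\<close>, so that the map is defined everywhere.\<close>

lemma coin_measure_continuous:
  fixes U :: "(nat, nat, 'a) struct"
  assumes gen: "generic U" and sat: "saturated \<kappa> tern_lang U" and M: "M \<subseteq> dom U" "|M| <o \<kappa>"
    and Y: "finite Y" "{0} \<inter> Y = {}" and \<phi>: "\<phi> \<in> fms_over tern_lang M ({0} \<union> Y)"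
  shows "\<exists>F. continuous_map (type_space tern_lang U M Y) (top_of_set {0..1}) F \<and>
    (\<forall>b \<in> Y \<rightarrow>\<^sub>E dom U. F (tp tern_lang U M Y b) = coin_measure U (inst Y b \<phi>))"
proof -
  obtain C where C: "finite C" "C \<subseteq> M" "\<phi> \<in> fms_over tern_lang C ({0} \<union> Y)"
    by (rule finite_parameters[OF \<phi>])
  have CU: "C \<subseteq> dom U" using C(2) M(1) by simp
  have real: "\<exists>b \<in> Y \<rightarrow>\<^sub>E dom U. tp tern_lang U M Y b = q" if "q \<in> types tern_lang U M Y" for q
    using sat[unfolded saturated_def, rule_format, of M Y q] M Y(1) that by simp
  define pick where "pick q = (SOME b. b \<in> Y \<rightarrow>\<^sub>E dom U \<and> tp tern_lang U M Y b = q)" for q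
  have pick: "pick (tp tern_lang U M Y b) \<in> Y \<rightarrow>\<^sub>E dom U \<and> tp tern_lang U M Y (pick (tp tern_lang U M Y b)) = tp tern_lang U M Y b"
    if "b \<in> Y \<rightarrow>\<^sub>E dom U" for b
    unfolding pick_def using that
    by (intro someI[where P = "\<lambda>c. c \<in> Y \<rightarrow>\<^sub>E dom U \<and> tp tern_lang U M Y c = tp tern_lang U M Y b"]) simp
  define F where "F q = coin_measure U (inst Y (pick q) \<phi>)" for q
  have F: "F (tp tern_lang U M Y b) = coin_measure U (inst Y b \<phi>)" if b: "b \<in> Y \<rightarrow>\<^sub>E dom U" for b
    unfolding F_def
    by (rule coin_measure_invariant[OF gen M(1), unfolded invariant_over_def, rule_format])
      (use Y \<phi> b pick[OF b] in simp)
  obtain \<theta>s where \<theta>s: "set \<theta>s = atoms Y C" using finite_list[OF finite_atoms[OF Y(1) C(1)]] by auto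
  have "continuous_map (type_space tern_lang U M Y) (top_of_set {0..1}) F"
  proof (rule continuous_map_type_space)
    fix q assume "q \<in> types tern_lang U M Y"
    then obtain b where b: "b \<in> Y \<rightarrow>\<^sub>E dom U" "tp tern_lang U M Y b = q" using real by blast
    have in_DX: "inst Y b \<phi> \<in> fms_over tern_lang (dom U) {0}"
      using \<phi> M(1) b(1) by (intro inst_in_fms_over[where A = M]) auto
    show "F q \<in> {0..1}" using coin_measure_bounds[OF gen in_DX] F[OF b(1)] b(2) by simp
    define \<psi> where "\<psi> = conjs (map (\<lambda>\<theta>. if satp U b \<theta> then \<theta> else Neg \<theta>) \<theta>s)"
    have \<psi>: "satp U c \<psi> \<longleftrightarrow> (\<forall>\<theta>\<in>atoms Y C. satp U b \<theta> \<longleftrightarrow> satp U c \<theta>)" for c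
    proof -
      have "satp U c (if satp U b \<theta> then \<theta> else Neg \<theta>) \<longleftrightarrow> (satp U b \<theta> \<longleftrightarrow> satp U c \<theta>)" for \<theta> by simp
      then show ?thesis unfolding \<psi>_def sat_conjs set_map \<theta>s by blast
    qed
    have "\<theta> \<in> fms_over tern_lang M Y" if "\<theta> \<in> atoms Y C" for \<theta>
      using fms_over_mono[OF atoms_fms[OF that] C(2)] by simp
    then have \<psi>M: "\<psi> \<in> fms_over tern_lang M Y" using \<theta>s by (auto simp: \<psi>_def fms_over_def)
    show "\<exists>\<psi>\<in>q. \<forall>q'\<in>types tern_lang U M Y. \<psi> \<in> q' \<longrightarrow> F q' = F q"
    proof (intro bexI ballI impI)
      show "\<psi> \<in> q" using b(2) \<psi>M by (auto simp: tp_def \<psi>)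
      fix q' assume "q' \<in> types tern_lang U M Y" "\<psi> \<in> q'"
      then obtain b' where b': "b' \<in> Y \<rightarrow>\<^sub>E dom U" "tp tern_lang U M Y b' = q'" using real by blast
      then have "satp U b' \<psi>" using \<open>\<psi> \<in> q'\<close> by (auto simp: tp_def)
      then have "satp U b \<theta> \<longleftrightarrow> satp U b' \<theta>" if "\<theta> \<in> atoms Y C" for \<theta> using that \<psi> by blast
      then have "coin_measure U (inst Y b \<phi>) = coin_measure U (inst Y b' \<phi>)"
        by (rule coin_measure_atoms_cong[OF gen C(1) CU C(3) Y b(1) b'(1)])
      then show "F q' = F q" using F[OF b(1)] F[OF b'(1)] b(2) b'(2) by simp
    qed
  qed
  with F show ?thesis by blast
qed

text \<open>A countable generic substructure is the closure of the empty set under a choice of witnesses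
for all finite sets of points and all patterns on them. It is the set of values of the terms below: a term
consists of terms for the points and a list of the triples of positions at which the relation is to hold.\<close>

datatype witness = Witness "witness list" "(nat \<times> nat \<times> nat) list"

instance witness :: countable
  by countable_datatype

lemma countable_generic_substructure:
  fixes U :: "(nat, nat, 'a) struct"
  assumes gen: "generic U"
  obtains M where "countable M" "M \<subseteq> dom U" "M \<noteq> {}" "generic (U\<lparr>dom := M\<rparr>)"
proof -
  \<comment> \<open>The position \<open>length cs\<close> refers to the new point.\<close>
  define idx :: "'a list \<Rightarrow> 'a option \<Rightarrow> nat \<Rightarrow> bool" where
    "idx cs u i \<longleftrightarrow> (case u of None \<Rightarrow> i = length cs | Some c \<Rightarrow> i < length cs \<and> cs ! i = c)" for cs u i
  define pat where "pat cs g u v w \<longleftrightarrow> (\<exists>i j k. (i, j, k) \<in> set g \<and> idx cs u i \<and> idx cs v j \<and> idx cs w k)"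
    for cs and g :: "(nat \<times> nat \<times> nat) list" and u v w
  define wit where "wit cs g = (SOME x. x \<in> dom U \<and> (set cs \<subseteq> dom U \<longrightarrow> realizes U (set cs) (pat cs g) x))" for cs g
  have wit: "wit cs g \<in> dom U \<and> (set cs \<subseteq> dom U \<longrightarrow> realizes U (set cs) (pat cs g) (wit cs g))" for cs g
  proof -
    have ex: "\<exists>x. realizes U C (pat cs g) x" if "finite C" "C \<subseteq> dom U" for C
      using gen that by (simp add: generic_def generic_over_def)
    have "\<exists>x. x \<in> dom U \<and> (set cs \<subseteq> dom U \<longrightarrow> realizes U (set cs) (pat cs g) x)"
    proof (cases "set cs \<subseteq> dom U")
      case True
      then obtain x where x: "realizes U (set cs) (pat cs g) x" using ex[of "set cs"] by auto
      then show ?thesis using realizesD[OF x] by (intro exI[of _ x]) simp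
    next
      case False
      obtain x where x: "realizes U {} (pat cs g) x" using ex[of "{}"] by auto
      then show ?thesis using False realizesD[OF x] by (intro exI[of _ x]) simp
    qed
    then show ?thesis unfolding wit_def by (rule someI_ex)
  qed
  define ev where "ev = rec_witness (\<lambda>ts g. wit (map snd ts) g)"
  have ev: "ev (Witness ts g) = wit (map ev ts) g" for ts g
    by (simp add: ev_def comp_def)
  have ev_dom: "ev t \<in> dom U" for t using wit ev by (cases t) simp
  have "\<exists>x. realizes (U\<lparr>dom := range ev\<rparr>) C G x" if C: "finite C" "C \<subseteq> range ev" for C G
  proof -
    obtain cs where cs: "set cs = C" using finite_list[OF C(1)] by auto
    then obtain ts where ts: "cs = map ev ts" using C(2) by (metis ex_map_conv subset_iff rangeE)
    let ?nm = "\<lambda>i. if i = length cs then None else Some (cs ! i)"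
    let ?g = "{(i, j, k). i \<le> length cs \<and> j \<le> length cs \<and> k \<le> length cs \<and> G (?nm i) (?nm j) (?nm k)}"
    have "finite ?g"
      by (rule finite_subset[of _ "{..length cs} \<times> {..length cs} \<times> {..length cs}"]) auto
    then obtain g where g: "set g = ?g" using finite_list by blast
    let ?x = "ev (Witness ts g)"
    have x: "realizes U C (pat cs g) ?x" using wit[of cs g] cs ev_dom unfolding ev ts by auto
    have pat: "pat cs g (new_pt ?x a) (new_pt ?x b) (new_pt ?x c) \<longleftrightarrow> G (new_pt ?x a) (new_pt ?x b) (new_pt ?x c)"
      if abc: "a \<in> insert ?x C" "b \<in> insert ?x C" "c \<in> insert ?x C" for a b c
    proof -
      have idx_ex: "\<exists>i. idx cs (new_pt ?x a) i" if "a \<in> insert ?x C" for a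
        using that cs by (auto simp: idx_def new_pt_def in_set_conv_nth split: option.split)
      have idx_nm: "i \<le> length cs \<and> ?nm i = u" if "idx cs u i" for u i
        using that by (auto simp: idx_def split: option.splits)
      obtain i j k where ijk: "idx cs (new_pt ?x a) i" "idx cs (new_pt ?x b) j" "idx cs (new_pt ?x c) k"
        using idx_ex[OF abc(1)] idx_ex[OF abc(2)] idx_ex[OF abc(3)] by blast
      show ?thesis
      proof
        assume "pat cs g (new_pt ?x a) (new_pt ?x b) (new_pt ?x c)"
        then obtain i j k where *: "(i, j, k) \<in> ?g" "idx cs (new_pt ?x a) i" "idx cs (new_pt ?x b) j" "idx cs (new_pt ?x c) k"
          unfolding pat_def g by blast
        then have "G (?nm i) (?nm j) (?nm k)" by simp
        then show "G (new_pt ?x a) (new_pt ?x b) (new_pt ?x c)"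
          using idx_nm[OF *(2)] idx_nm[OF *(3)] idx_nm[OF *(4)] by simp
      next
        assume "G (new_pt ?x a) (new_pt ?x b) (new_pt ?x c)"
        then have "(i, j, k) \<in> ?g" using idx_nm[OF ijk(1)] idx_nm[OF ijk(2)] idx_nm[OF ijk(3)] by simp
        then show "pat cs g (new_pt ?x a) (new_pt ?x b) (new_pt ?x c)" unfolding pat_def g using ijk by blast
      qed
    qed
    have "realizes (U\<lparr>dom := range ev\<rparr>) C G ?x"
      unfolding realizes_def
    proof (intro conjI ballI impI)
      show "?x \<notin> C" using x by (simp add: realizes_def)
      fix a b c assume abc: "a \<in> insert ?x C" "b \<in> insert ?x C" "c \<in> insert ?x C" "?x \<in> {a, b, c}"
      then have "?x = a \<or> ?x = b \<or> ?x = c" by blast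
      from realizes_rint[OF x abc(1-3) this] pat[OF abc(1-3)]
      show "rint (U\<lparr>dom := range ev\<rparr>) 0 [a, b, c] \<longleftrightarrow> G (new_pt ?x a) (new_pt ?x b) (new_pt ?x c)" by simp
    qed simp
    then show ?thesis by blast
  qed
  then have "generic (U\<lparr>dom := range ev\<rparr>)" by (simp add: generic_def generic_over_def)
  then show thesis using ev_dom by (intro that[of "range ev"]) auto
qed

text \<open>The identity on finitely many points of \<open>M\<close> is a partial isomorphism between two generic structures.\<close>

lemma generic_substructure_elementary:
  fixes U :: "(nat, nat, 'a) struct"
  assumes gen: "generic U" "generic (U\<lparr>dom := M\<rparr>)" and M: "M \<subseteq> dom U" "M \<noteq> {}"
  shows "elem_sub tern_lang M U"
  unfolding elem_sub_def
proof (intro conjI allI impI ballI)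
  show "is_struct tern_lang (U\<lparr>dom := M\<rparr>)" using M by (simp add: is_struct_def)
  fix \<phi> :: "(nat, nat) fm" and e assume \<phi>: "wf_fm tern_lang \<phi>" and e: "e \<in> fv \<phi> \<rightarrow>\<^sub>E M"
  have fin_t: "finite (fvt t)" for t :: "nat trm" by (induction t) auto
  have fin: "finite (fv \<psi>)" for \<psi> :: "(nat, nat) fm" by (induction \<psi>) (auto simp: fin_t)
  show "sat (U\<lparr>dom := M\<rparr>) e \<phi> \<longleftrightarrow> sat U e \<phi>"
  proof (rule back_and_forth[OF gen(2,1) _ _ \<phi>])
    show "piso (U\<lparr>dom := M\<rparr>) U (Id_on (e ` fv \<phi>))"
      by (rule pisoI) (use e M in auto)
    show "finite (Id_on (e ` fv \<phi>))" using fin by (intro finite_Id_on) simp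
  qed auto
qed (fact M)

lemma coin_measure_definable:
  fixes U :: "(nat, nat, 'a) struct"
  assumes gen: "generic U" and \<kappa>: "natLeq <o \<kappa>" and sat: "saturated \<kappa> tern_lang U"
  shows "definable \<kappa> tern_lang U {0} (coin_measure U)"
proof -
  obtain M where M: "countable M" "M \<subseteq> dom U" "M \<noteq> {}" "generic (U\<lparr>dom := M\<rparr>)"
    by (rule countable_generic_substructure[OF gen])
  have small: "|M| <o \<kappa>" using \<kappa> M(1) by (rule countable_small)
  have "small_model \<kappa> tern_lang M U"
    using generic_substructure_elementary[OF gen M(4,2,3)] small by (simp add: small_model_def)
  moreover have "invariant_over tern_lang U {0} M (coin_measure U)" by (rule coin_measure_invariant[OF gen M(2)])
  ultimately show ?thesis
    unfolding definable_def using coin_measure_continuous[OF gen sat M(2) small] by blast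
qed

section \<open>A type in the support that is not invariant\<close>

text \<open>By genericity and compactness: finitely many of the conditions on \<open>x\<close> mention finitely many points of \<open>A\<close>.\<close>

lemma avoiding_point:
  fixes U :: "(nat, nat, 'a) struct"
  assumes gen: "generic U" and sat: "saturated \<kappa> tern_lang U" and A: "A \<subseteq> dom U" "|A| <o \<kappa>"
  shows "\<exists>x. realizes U A (\<lambda>_ _ _. False) x"
proof -
  let ?T = "pterms {0} A" and ?v = "Var 0 :: (nat + 'a) trm"
  define \<Gamma> :: "(nat + 'a, nat) fm set" where "\<Gamma> = (\<lambda>a. Neg (Eq ?v (App (Inr a) []))) ` A \<union>
    {Neg (Rel 0 [s, t, u]) | s t u. s \<in> ?T \<and> t \<in> ?T \<and> u \<in> ?T \<and> (s = ?v \<or> t = ?v \<or> u = ?v)}"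
  have \<Gamma>_fms: "\<Gamma> \<subseteq> fms_over tern_lang A {0}"
    by (auto simp: \<Gamma>_def pterms_def fms_over_def)
  have realized: "satp U a \<phi>"
    if C: "C \<subseteq> A" and x: "realizes U C (\<lambda>_ _ _. False) x" and \<phi>: "\<phi> \<in> \<Gamma>" "\<phi> \<in> fms_over tern_lang C {0}" and a: "a 0 = x"
    for C x \<phi> a
  proof -
    have tv: "tval (struct_par U) a s \<in> insert x C" if "s \<in> ?T" "wf_trm (lang_par tern_lang C) s" for s
      using that a by (auto simp: pterms_def)
    consider c where "c \<in> A" "\<phi> = Neg (Eq ?v (App (Inr c) []))"
      | s t u where "s \<in> ?T" "t \<in> ?T" "u \<in> ?T" "s = ?v \<or> t = ?v \<or> u = ?v" "\<phi> = Neg (Rel 0 [s, t, u])"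
      using \<phi>(1) unfolding \<Gamma>_def by blast
    then show ?thesis
    proof cases
      case 1
      then have "c \<in> C" using \<phi>(2) by (auto simp: fms_over_def)
      then show ?thesis using 1 realizesD[OF x] a by auto
    next
      case 2
      then have wf: "wf_trm (lang_par tern_lang C) s" "wf_trm (lang_par tern_lang C) t" "wf_trm (lang_par tern_lang C) u"
        using \<phi>(2) by (auto simp: fms_over_def)
      have "x = tval (struct_par U) a s \<or> x = tval (struct_par U) a t \<or> x = tval (struct_par U) a u"
        using 2(4) a by auto
      from realizes_rint[OF x tv[OF 2(1) wf(1)] tv[OF 2(2) wf(2)] tv[OF 2(3) wf(3)] this]
      show ?thesis by (simp add: 2(5))
    qed
  qed
  have finite_zero: "finite {0 :: nat}" by simp
  have "fin_sat U {0} \<Gamma>"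
    unfolding fin_sat_def
  proof (intro allI impI)
    fix \<Delta> assume \<Delta>: "finite \<Delta> \<and> \<Delta> \<subseteq> \<Gamma>"
    then have "finite \<Delta>" "\<Delta> \<subseteq> fms_over tern_lang A {0}" using \<Gamma>_fms by auto
    then obtain C where C: "finite C" "C \<subseteq> A" "\<Delta> \<subseteq> fms_over tern_lang C {0}"
      by (rule finite_parameters_set)
    have "generic_over U C" using gen C A(1) by (simp add: generic_def)
    then obtain x where x: "realizes U C (\<lambda>_ _ _. False) x" unfolding generic_over_def by blast
    let ?a = "restrict (\<lambda>_. x) {0 :: nat}"
    have "satp U ?a \<phi>" if "\<phi> \<in> \<Delta>" for \<phi>
      using \<Delta> C(3) that by (intro realized[OF C(2) x]) auto
    moreover have "?a \<in> {0} \<rightarrow>\<^sub>E dom U" using realizesD[OF x] by simp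
    ultimately show "\<exists>a\<in>{0} \<rightarrow>\<^sub>E dom U. \<forall>\<phi>\<in>\<Delta>. satp U a \<phi>" by blast
  qed
  then obtain a where a: "a \<in> {0} \<rightarrow>\<^sub>E dom U" "\<forall>\<phi>\<in>\<Gamma>. satp U a \<phi>"
    by (rule partial_type_realized[OF sat A finite_zero \<Gamma>_fms])
  let ?x = "a 0"
  have tval: "\<exists>s\<in>?T. tval (struct_par U) a s = c \<and> (c = ?x \<longrightarrow> s = ?v)" if "c \<in> insert ?x A" for c
    using that by (cases "c = ?x") (auto simp: pterms_def)
  have "realizes U A (\<lambda>_ _ _. False) ?x"
    unfolding realizes_def
  proof (intro conjI ballI impI)
    show "?x \<in> dom U" using a(1) by auto
    show "?x \<notin> A"
    proof
      assume "?x \<in> A"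
      then have "Neg (Eq ?v (App (Inr ?x) [])) \<in> \<Gamma>" by (simp add: \<Gamma>_def)
      from bspec[OF a(2) this] show False by simp
    qed
    fix b c d assume "b \<in> insert ?x A" "c \<in> insert ?x A" "d \<in> insert ?x A" and x: "?x \<in> {b, c, d}"
    then obtain s t u where stu: "s \<in> ?T" "t \<in> ?T" "u \<in> ?T"
      "tval (struct_par U) a s = b \<and> (b = ?x \<longrightarrow> s = ?v)"
      "tval (struct_par U) a t = c \<and> (c = ?x \<longrightarrow> t = ?v)"
      "tval (struct_par U) a u = d \<and> (d = ?x \<longrightarrow> u = ?v)" using tval by metis
    have v: "s = ?v \<or> t = ?v \<or> u = ?v" using x stu(4-6) by auto
    have "Neg (Rel 0 [s, t, u]) \<in> \<Gamma>"
      unfolding \<Gamma>_def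
      by (rule UnI2, rule CollectI, rule exI[of _ s], rule exI[of _ t], rule exI[of _ u])
        (use stu(1-3) v in simp)
    from bspec[OF a(2) this] show "rint U 0 [b, c, d] \<longleftrightarrow> False" using stu by simp
  qed
  then show ?thesis by blast
qed

text \<open>Take \<open>b\<close> unrelated to \<open>A\<close>, and then \<open>b'\<close> unrelated to \<open>A\<close> and \<open>b\<close>. The relation fails at every triple from
\<open>A \<union> {b, b'}\<close> that involves one of them, and exchanging them is a partial isomorphism.\<close>

lemma swappable_pair:
  fixes U :: "(nat, nat, 'a) struct"
  assumes gen: "generic U" and sat: "saturated \<kappa> tern_lang U" and \<kappa>: "Card_order \<kappa>" "natLeq <o \<kappa>"
    and A: "A \<subseteq> dom U" "|A| <o \<kappa>"
  obtains b b' where "b \<in> dom U" "b' \<in> dom U" "b \<noteq> b'"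
    "\<forall>C\<subseteq>A. piso U U (Id_on C \<union> {(b, b'), (b', b)})"
proof -
  obtain b where b: "realizes U A (\<lambda>_ _ _. False) b" using avoiding_point[OF gen sat A] by blast
  have "A \<union> {b} \<subseteq> dom U" using A(1) realizesD[OF b] by simp
  moreover have "|A \<union> {b}| <o \<kappa>" by (rule small_union_finite[OF \<kappa> A(2)]) simp
  ultimately obtain b' where b': "realizes U (A \<union> {b}) (\<lambda>_ _ _. False) b'"
    using avoiding_point[OF gen sat, of "A \<union> {b}"] by blast
  have dom: "b \<in> dom U" "b' \<in> dom U" "b \<notin> A" "b' \<notin> A" "b \<noteq> b'" using realizesD[OF b] realizesD[OF b'] by auto
  have no: "\<not> rint U 0 [c, d, e]"
    if "c \<in> A \<union> {b, b'}" "d \<in> A \<union> {b, b'}" "e \<in> A \<union> {b, b'}" "\<not> (c \<in> A \<and> d \<in> A \<and> e \<in> A)" for c d e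
  proof (cases "b' = c \<or> b' = d \<or> b' = e")
    case True
    then show ?thesis using realizes_rint[OF b', of c d e] that by auto
  next
    case False
    then show ?thesis using realizes_rint[OF b, of c d e] that by auto
  qed
  show thesis
  proof (rule that[OF dom(1,2,5)], intro allI impI)
    fix C assume C: "C \<subseteq> A"
    let ?P = "Id_on C \<union> {(b, b'), (b', b)}"
    have P: "c \<in> A \<union> {b, b'}" "c' \<in> A \<union> {b, b'}" "c \<in> A \<longleftrightarrow> c' \<in> A" "c \<in> A \<Longrightarrow> c = c'"
      if "(c, c') \<in> ?P" for c c' using that C dom by auto
    show "piso U U ?P"
    proof (rule pisoI)
      show "a \<in> dom U \<and> a' \<in> dom U" if "(a, a') \<in> ?P" for a a' using P(1,2)[OF that] A(1) dom by auto
      show "a = c \<longleftrightarrow> a' = c'" if "(a, a') \<in> ?P" "(c, c') \<in> ?P" for a a' c c'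
        using that C dom by auto
      fix a a' c c' d d' assume acd: "(a, a') \<in> ?P" "(c, c') \<in> ?P" "(d, d') \<in> ?P"
      show "rint U 0 [a, c, d] \<longleftrightarrow> rint U 0 [a', c', d']"
      proof (cases "a \<in> A \<and> c \<in> A \<and> d \<in> A")
        case True
        then have "a = a'" "c = c'" "d = d'" using P(4)[OF acd(1)] P(4)[OF acd(2)] P(4)[OF acd(3)] by blast+
        then show ?thesis by simp
      next
        case False
        then have "\<not> (a' \<in> A \<and> c' \<in> A \<and> d' \<in> A)"
          unfolding P(3)[OF acd(1)] P(3)[OF acd(2)] P(3)[OF acd(3)] .
        then have "\<not> rint U 0 [a', c', d']" by (rule no[OF P(2)[OF acd(1)] P(2)[OF acd(2)] P(2)[OF acd(3)]])
        moreover have "\<not> rint U 0 [a, c, d]"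
          using False by (rule no[OF P(1)[OF acd(1)] P(1)[OF acd(2)] P(1)[OF acd(3)]])
        ultimately show ?thesis by simp
      qed
    qed
  qed
qed

text \<open>The pairs \<open>(b,b')\<close> and \<open>(b',b)\<close> have the same type over \<open>A\<close>, but \<open>R(x,y\<^sub>1,y\<^sub>2)\<close> with these parameters is in the
type iff the pair is in \<open>r\<close>.\<close>

lemma coin_type_not_invariant:
  fixes U :: "(nat, nat, 'a) struct"
  assumes gen: "generic U" and sat: "saturated \<kappa> tern_lang U" and \<kappa>: "Card_order \<kappa>" "natLeq <o \<kappa>"
    and r: "\<And>b c. b \<noteq> c \<Longrightarrow> (b, c) \<in> r \<longleftrightarrow> (c, b) \<notin> r"
    and A: "A \<subseteq> dom U" "|A| <o \<kappa>"
  shows "\<not> type_invariant_over tern_lang U {0} A (coin_type U r)"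
proof
  assume inv: "type_invariant_over tern_lang U {0} A (coin_type U r)"
  obtain b b' where b: "b \<in> dom U" "b' \<in> dom U" "b \<noteq> b'"
    and piso: "\<forall>C\<subseteq>A. piso U U (Id_on C \<union> {(b, b'), (b', b)})"
    by (rule swappable_pair[OF gen sat \<kappa> A])
  let ?Y = "{2, 3 :: nat}" and ?\<phi> = "Rel 0 [Var 0, Var 2, Var 3] :: (nat + 'a, nat) fm"
  define e where "e u v = restrict (\<lambda>i. if i = 2 then u else v) ?Y" for u v :: 'a
  have e: "e u v 2 = u" "e u v 3 = v" for u v by (simp_all add: e_def)
  have e_dom: "e u v \<in> ?Y \<rightarrow>\<^sub>E dom U" if "u \<in> dom U" "v \<in> dom U" for u v
    using that by (auto simp: e_def)
  have "satp U (e b b') \<psi> \<longleftrightarrow> satp U (e b' b) \<psi>" if \<psi>: "\<psi> \<in> fms_over tern_lang A ?Y" for \<psi>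
  proof -
    obtain C where C: "finite C" "C \<subseteq> A" "\<psi> \<in> fms_over tern_lang C ?Y" by (rule finite_parameters[OF \<psi>])
    show ?thesis
      by (rule satp_piso[OF gen piso[rule_format, OF C(2)] _ C(3)]) (use C(1) finite_Id_on e in auto)
  qed
  then have tp: "tp tern_lang U A ?Y (e b b') = tp tern_lang U A ?Y (e b' b)" by (auto simp: tp_def)
  have \<phi>: "?\<phi> \<in> fms_over tern_lang A ({0} \<union> ?Y)" by (simp add: fms_over_def)
  have "inst ?Y (e b b') ?\<phi> \<in> coin_type U r \<longleftrightarrow> inst ?Y (e b' b) ?\<phi> \<in> coin_type U r"
    by (rule inv[unfolded type_invariant_over_def, rule_format]) (use \<phi> e_dom b tp in auto)
  moreover have "inst ?Y (e u v) ?\<phi> = Rel 0 [Var 0, App (Inr u) [], App (Inr v) []]" for u v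
    by (simp add: e)
  ultimately have "(b, b') \<in> r \<longleftrightarrow> (b', b) \<in> r"
    using coin_type_rel[OF gen b(1,2)] coin_type_rel[OF gen b(2,1)] by simp
  with r[OF b(3)] show False by simp
qed

lemma asymmetric_total_relation:
  obtains r :: "('a \<times> 'a) set" where "\<forall>b c. b \<noteq> c \<longrightarrow> ((b, c) \<in> r \<longleftrightarrow> (c, b) \<notin> r)"
proof -
  obtain r :: "('a \<times> 'a) set" where r: "well_order_on UNIV r" 
    using well_order_on[of UNIV] by (rule exE)
  then have "total_on UNIV r" "antisym r"
    by (simp_all add: order_on_defs)
  then show thesis by (intro that[of r]) (auto simp: total_on_def antisym_def)
qed

lemma generic_saturated_noninvariant_support:
  fixes U :: "(nat, nat, 'a) struct"
  assumes gen: "generic U" and sat: "saturated \<kappa> tern_lang U" and \<kappa>: "Card_order \<kappa>" "natLeq <o \<kappa>"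
  shows "definable_with_noninvariant_support \<kappa> tern_lang U"
proof -
  obtain r :: "('a \<times> 'a) set" where r: "\<forall>b c. b \<noteq> c \<longrightarrow> ((b, c) \<in> r \<longleftrightarrow> (c, b) \<notin> r)"
    by (rule asymmetric_total_relation)
  have noninv: "\<not> type_invariant_over tern_lang U {0} A (coin_type U r)" if "A \<subseteq> dom U" "|A| <o \<kappa>" for A
    by (rule coin_type_not_invariant[OF gen sat \<kappa> r[rule_format] that])
  show ?thesis
    unfolding definable_with_noninvariant_support_def
  proof (intro exI conjI allI impI)
    show "keisler tern_lang U {0} (coin_measure U)" by (rule keisler_coin_measure[OF gen])
    show "definable \<kappa> tern_lang U {0} (coin_measure U)" by (rule coin_measure_definable[OF gen \<kappa>(2) sat])
    show "coin_type U r \<in> support tern_lang U {0} (coin_measure U)" by (rule coin_type_in_support[OF gen])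
    show "\<not> type_invariant_over tern_lang U {0} A (coin_type U r)" if "A \<subseteq> dom U \<and> |A| <o \<kappa>" for A
      using that by (intro noninv) auto
  qed simp
qed

section \<open>Axioms\<close>

definition distinct_vars :: "nat \<Rightarrow> (nat, nat) fm" where
  "distinct_vars n = conjs (map (\<lambda>(i, j). Neg (Eq (Var i) (Var j)))
     (filter (\<lambda>(i, j). i \<noteq> j) (List.product [0..<n] [0..<n])))"

definition new_triples :: "nat \<Rightarrow> (nat \<times> nat \<times> nat) list" where
  "new_triples n = filter (\<lambda>(i, j, k). i = n \<or> j = n \<or> k = n)
     (List.product [0..<Suc n] (List.product [0..<Suc n] [0..<Suc n]))"

definition triple_literal :: "(nat \<times> nat \<times> nat) set \<Rightarrow> nat \<times> nat \<times> nat \<Rightarrow> (nat, nat) fm" where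
  "triple_literal g t = (case t of (i, j, k) \<Rightarrow>
     if t \<in> g then Rel 0 [Var i, Var j, Var k] else Neg (Rel 0 [Var i, Var j, Var k]))"

definition diagram_fm :: "nat \<Rightarrow> (nat \<times> nat \<times> nat) set \<Rightarrow> (nat, nat) fm" where
  "diagram_fm n g = conjs (map (triple_literal g) (new_triples n))"

text \<open>Any \<open>n\<close> distinct points \<open>v\<^sub>0, \<dots>, v\<^sub>n\<^sub>-\<^sub>1\<close> have a further point \<open>v\<^sub>n\<close> such that, among the triples from
\<open>v\<^sub>0, \<dots>, v\<^sub>n\<close> involving \<open>v\<^sub>n\<close>, the relation holds precisely at those listed in \<open>g\<close>.\<close>

definition extension_axiom :: "nat \<Rightarrow> (nat \<times> nat \<times> nat) set \<Rightarrow> (nat, nat) fm" where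
  "extension_axiom n g = Neg (exs [0..<n] (Conj (distinct_vars n)
     (Neg (Ex n (Conj (distinct_vars (Suc n)) (diagram_fm n g))))))"

definition generic_theory :: "(nat, nat) fm set" where
  "generic_theory = range (\<lambda>(n, g). extension_axiom n g)"

lemma sat_distinct_vars: "sat N e (distinct_vars n) \<longleftrightarrow> inj_on e {..<n}"
  by (auto simp: distinct_vars_def inj_on_def)

lemma set_new_triples:
  "(i, j, k) \<in> set (new_triples n) \<longleftrightarrow> i \<le> n \<and> j \<le> n \<and> k \<le> n \<and> (i = n \<or> j = n \<or> k = n)"
  unfolding new_triples_def by (auto simp: less_Suc_eq_le simp del: upt_Suc)

lemma sat_triple_literal:
  "sat N e (triple_literal g (i, j, k)) \<longleftrightarrow> (rint N 0 [e i, e j, e k] \<longleftrightarrow> (i, j, k) \<in> g)"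
  by (simp add: triple_literal_def)

lemma sat_diagram_fm:
  "sat N e (diagram_fm n g) \<longleftrightarrow> (\<forall>i\<le>n. \<forall>j\<le>n. \<forall>k\<le>n. i = n \<or> j = n \<or> k = n \<longrightarrow>
     (rint N 0 [e i, e j, e k] \<longleftrightarrow> (i, j, k) \<in> g))"
proof -
  have "sat N e (diagram_fm n g) \<longleftrightarrow>
      (\<forall>i j k. (i, j, k) \<in> set (new_triples n) \<longrightarrow> (rint N 0 [e i, e j, e k] \<longleftrightarrow> (i, j, k) \<in> g))"
    unfolding diagram_fm_def sat_conjs set_map ball_simps by (simp add: sat_triple_literal Ball_def)
  then show ?thesis unfolding set_new_triples by blast
qed

lemma is_theory_generic_theory: "is_theory tern_lang generic_theory"
proof -
  have "v < n" if "v \<in> fv (distinct_vars n)" for v n using that by (auto simp: distinct_vars_def)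
  then have 1: "fv (distinct_vars n) \<subseteq> {..<n}" "fv (distinct_vars (Suc n)) \<subseteq> {..<Suc n}" for n by blast+
  have "fv (triple_literal g t) \<subseteq> {..<Suc n}" if "t \<in> set (new_triples n)" for g t n
  proof -
    obtain i j k where t: "t = (i, j, k)" by (metis prod_cases3)
    then have "i < Suc n" "j < Suc n" "k < Suc n" using that by (simp_all add: set_new_triples)
    then show ?thesis by (simp add: t triple_literal_def)
  qed
  then have 2: "fv (diagram_fm n g) \<subseteq> {..<Suc n}" for n g
    unfolding diagram_fm_def fv_conjs set_map by blast
  have "fv (extension_axiom n g) = {}" for n g
    using 1[of n] 2[of n g] by (fastforce simp: extension_axiom_def)
  moreover have "wf_fm tern_lang (triple_literal g t)" for g t by (cases t) (simp add: triple_literal_def)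
  then have "wf_fm tern_lang (extension_axiom n g)" for n g
    by (auto simp: extension_axiom_def distinct_vars_def diagram_fm_def)
  ultimately show ?thesis by (auto simp: is_theory_def generic_theory_def)
qed

lemma sat_extension_axiom:
  "sat N e (extension_axiom n g) \<longleftrightarrow>
     (\<forall>a. a \<in> {..<n} \<rightarrow> dom N \<and> inj_on a {..<n} \<longrightarrow>
        (\<exists>x\<in>dom N. x \<notin> a ` {..<n} \<and> (\<forall>i\<le>n. \<forall>j\<le>n. \<forall>k\<le>n. i = n \<or> j = n \<or> k = n \<longrightarrow>
           (rint N 0 [(a(n := x)) i, (a(n := x)) j, (a(n := x)) k] \<longleftrightarrow> (i, j, k) \<in> g))))"
proof -
  have inj: "inj_on (override_on e a {..<n}) {..<n} \<longleftrightarrow> inj_on a {..<n}" for a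
    by (rule inj_on_cong) simp
  have inj_Suc: "inj_on ((override_on e a {..<n})(n := x)) {..<Suc n} \<longleftrightarrow> inj_on a {..<n} \<and> x \<notin> a ` {..<n}" for a x
  proof -
    have "inj_on ((override_on e a {..<n})(n := x)) {..<Suc n} \<longleftrightarrow> inj_on (a(n := x)) (insert n {..<n})"
      unfolding lessThan_Suc by (rule inj_on_cong) auto
    also have "\<dots> \<longleftrightarrow> inj_on (a(n := x)) {..<n} \<and> (a(n := x)) n \<notin> (a(n := x)) ` {..<n}"
      by (subst inj_on_insert) auto
    also have "inj_on (a(n := x)) {..<n} \<longleftrightarrow> inj_on a {..<n}" by (rule inj_on_cong) auto
    also have "(a(n := x)) ` {..<n} = a ` {..<n}" by (rule image_cong) auto
    also have "(a(n := x)) n = x" by simp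
    finally show ?thesis .
  qed
  have val: "((override_on e a {..<n})(n := x)) i = (a(n := x)) i" if "i \<le> n" for a x i
    using that by auto
  have diag: "sat N ((override_on e a {..<n})(n := x)) (diagram_fm n g) \<longleftrightarrow>
      (\<forall>i\<le>n. \<forall>j\<le>n. \<forall>k\<le>n. i = n \<or> j = n \<or> k = n \<longrightarrow>
           (rint N 0 [(a(n := x)) i, (a(n := x)) j, (a(n := x)) k] \<longleftrightarrow> (i, j, k) \<in> g))" for a x
    unfolding sat_diagram_fm using val[of _ a x] by (simp only: cong: imp_cong)
  have set: "set [0..<n] = {..<n}" by auto
  show ?thesis
    unfolding extension_axiom_def sat.simps sat_exs set sat_distinct_vars inj inj_Suc diag by blast
qed

lemma generic_if_models:
  assumes "models tern_lang N generic_theory"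
  shows "generic N"
  unfolding generic_def generic_over_def
proof (intro allI impI)
  fix C G assume C: "finite C \<and> C \<subseteq> dom N"
  obtain cs where cs: "set cs = C" "distinct cs" using finite_distinct_list C by blast
  define n where "n = length cs"
  let ?nm = "\<lambda>i. if i = n then None else Some (cs ! i)"
  let ?g = "{(i, j, k). G (?nm i) (?nm j) (?nm k)}"
  have im: "(!) cs ` {..<n} = C" using cs(1) by (auto simp: n_def in_set_conv_nth)
  have "sat N undefined (extension_axiom n ?g)"
    using assms by (auto simp: models_def generic_theory_def)
  then have ax: "\<forall>a. a \<in> {..<n} \<rightarrow> dom N \<and> inj_on a {..<n} \<longrightarrow>
        (\<exists>x\<in>dom N. x \<notin> a ` {..<n} \<and> (\<forall>i\<le>n. \<forall>j\<le>n. \<forall>k\<le>n. i = n \<or> j = n \<or> k = n \<longrightarrow>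
           (rint N 0 [(a(n := x)) i, (a(n := x)) j, (a(n := x)) k] \<longleftrightarrow> (i, j, k) \<in> ?g)))"
    by (rule sat_extension_axiom[THEN iffD1])
  have "(!) cs \<in> {..<n} \<rightarrow> dom N" using im C by blast
  moreover have "inj_on ((!) cs) {..<n}" using cs(2) by (simp add: n_def inj_on_nth)
  ultimately obtain x where x: "x \<in> dom N" "x \<notin> C" and rel: "\<forall>i\<le>n. \<forall>j\<le>n. \<forall>k\<le>n. i = n \<or> j = n \<or> k = n \<longrightarrow>
      (rint N 0 [(((!) cs)(n := x)) i, (((!) cs)(n := x)) j, (((!) cs)(n := x)) k] \<longleftrightarrow> (i, j, k) \<in> ?g)"
    using ax[THEN spec, of "(!) cs"] unfolding im by auto
  have code: "\<exists>i\<le>n. (((!) cs)(n := x)) i = a \<and> ?nm i = new_pt x a \<and> (a = x \<longrightarrow> i = n)" if "a \<in> insert x C" for a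
  proof (cases "a = x")
    case True
    then show ?thesis by (intro exI[of _ n]) (simp add: new_pt_def)
  next
    case False
    then have "a \<in> (!) cs ` {..<n}" using that im by simp
    then obtain i where "i < n" "cs ! i = a" by auto
    then show ?thesis using False by (intro exI[of _ i]) (simp add: new_pt_def)
  qed
  have "realizes N C G x"
    unfolding realizes_def
  proof (intro conjI ballI impI x)
    fix a b c assume abc: "a \<in> insert x C" "b \<in> insert x C" "c \<in> insert x C" "x \<in> {a, b, c}"
    obtain i j k where ijk: "i \<le> n \<and> (((!) cs)(n := x)) i = a \<and> ?nm i = new_pt x a \<and> (a = x \<longrightarrow> i = n)"
      "j \<le> n \<and> (((!) cs)(n := x)) j = b \<and> ?nm j = new_pt x b \<and> (b = x \<longrightarrow> j = n)"
      "k \<le> n \<and> (((!) cs)(n := x)) k = c \<and> ?nm k = new_pt x c \<and> (c = x \<longrightarrow> k = n)"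
      using code[OF abc(1)] code[OF abc(2)] code[OF abc(3)] by blast
    have "i = n \<or> j = n \<or> k = n" using abc(4) ijk by blast
    then have "rint N 0 [a, b, c] \<longleftrightarrow> (i, j, k) \<in> ?g" using rel ijk by blast
    also have "\<dots> \<longleftrightarrow> G (new_pt x a) (new_pt x b) (new_pt x c)" using ijk by simp
    finally show "rint N 0 [a, b, c] \<longleftrightarrow> G (new_pt x a) (new_pt x b) (new_pt x c)" .
  qed
  then show "\<exists>x. realizes N C G x" by blast
qed

lemma models_if_generic:
  assumes gen: "generic N"
  shows "models tern_lang N generic_theory"
proof -
  have "sat N e (extension_axiom n g)" for e n g
    unfolding sat_extension_axiom
  proof (intro allI impI, elim conjE)
    fix a assume a: "a \<in> {..<n} \<rightarrow> dom N" "inj_on a {..<n}"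
    define ix where "ix u = (case u of None \<Rightarrow> n | Some c \<Rightarrow> inv_into {..<n} a c)" for u
    have "generic_over N (a ` {..<n})" using gen a(1) by (auto simp: generic_def)
    then obtain x where x: "realizes N (a ` {..<n}) (\<lambda>u v w. (ix u, ix v, ix w) \<in> g) x"
      unfolding generic_over_def by blast
    have ix: "ix (new_pt x ((a(n := x)) i)) = i" if "i \<le> n" for i
      using that a(2) realizesD[OF x] by (auto simp: ix_def new_pt_def)
    show "\<exists>x\<in>dom N. x \<notin> a ` {..<n} \<and> (\<forall>i\<le>n. \<forall>j\<le>n. \<forall>k\<le>n. i = n \<or> j = n \<or> k = n \<longrightarrow>
           (rint N 0 [(a(n := x)) i, (a(n := x)) j, (a(n := x)) k] \<longleftrightarrow> (i, j, k) \<in> g))"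
    proof (intro bexI[of _ x] conjI allI impI)
      fix i j k assume ijk: "i \<le> n" "j \<le> n" "k \<le> n" "i = n \<or> j = n \<or> k = n"
      have mem: "(a(n := x)) i \<in> insert x (a ` {..<n})" if "i \<le> n" for i using that by auto
      have "x = (a(n := x)) i \<or> x = (a(n := x)) j \<or> x = (a(n := x)) k" using ijk(4) by auto
      from realizes_rint[OF x mem[OF ijk(1)] mem[OF ijk(2)] mem[OF ijk(3)] this]
      show "rint N 0 [(a(n := x)) i, (a(n := x)) j, (a(n := x)) k] \<longleftrightarrow> (i, j, k) \<in> g"
        unfolding ix[OF ijk(1)] ix[OF ijk(2)] ix[OF ijk(3)] .
    qed (use realizesD[OF x] in auto)
  qed
  moreover have "dom N \<noteq> {}"
  proof -
    have "generic_over N {}" using gen by (simp add: generic_def)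
    then obtain x where "realizes N {} (\<lambda>_ _ _. False) x" unfolding generic_over_def by blast
    from realizesD[OF this] show ?thesis by blast
  qed
  ultimately show ?thesis by (auto simp: models_def generic_theory_def is_struct_def)
qed

section \<open>Saturation\<close>

lemma type_imp:
  assumes p: "p \<in> types L U A X" and \<Delta>: "finite \<Delta>" "\<Delta> \<subseteq> p" "\<phi> \<in> p"
    and \<psi>: "\<psi> \<in> fms_over L A X"
    and imp: "\<And>e. e \<in> X \<rightarrow>\<^sub>E dom U \<Longrightarrow> \<forall>\<theta>\<in>\<Delta>. satp U e \<theta> \<Longrightarrow> satp U e \<phi> \<Longrightarrow> satp U e \<psi>"
  shows "\<psi> \<in> p"
proof (rule type_deductively_closed[OF p _ _ \<psi>, of "insert \<phi> \<Delta>"])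
  fix e assume e: "e \<in> X \<rightarrow>\<^sub>E dom U" and sat: "\<And>\<theta>. \<theta> \<in> insert \<phi> \<Delta> \<Longrightarrow> satp U e \<theta>"
  have "\<forall>\<theta>\<in>\<Delta>. satp U e \<theta>" using sat by blast
  then show "satp U e \<psi>" using sat by (intro imp[OF e]) blast+
qed (use \<Delta> in auto)

lemma type_iff:
  assumes p: "p \<in> types L U A X" and \<Delta>: "finite \<Delta>" "\<Delta> \<subseteq> p"
    and fms: "\<phi> \<in> fms_over L A X" "\<psi> \<in> fms_over L A X"
    and eq: "\<And>e. e \<in> X \<rightarrow>\<^sub>E dom U \<Longrightarrow> \<forall>\<theta>\<in>\<Delta>. satp U e \<theta> \<Longrightarrow> satp U e \<phi> \<longleftrightarrow> satp U e \<psi>"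
  shows "\<phi> \<in> p \<longleftrightarrow> \<psi> \<in> p"
proof
  show "\<psi> \<in> p" if "\<phi> \<in> p" by (rule type_imp[OF p \<Delta> that fms(2)]) (simp add: eq)
  show "\<phi> \<in> p" if "\<psi> \<in> p" by (rule type_imp[OF p \<Delta> that fms(1)]) (simp add: eq)
qed

text \<open>The variables get their values one at a time. If the type identifies the next variable \<open>x\<close> with a term that
already has a value, this is the value of \<open>x\<close>; otherwise a new point is required, and its relation to \<open>A\<close> and the values
found so far is read off from the type.\<close>

lemma realize_quantifier_free_type:
  fixes U :: "(nat, nat, 'a) struct"
  assumes \<kappa>: "Card_order \<kappa>" "natLeq <o \<kappa>"
    and gen: "\<And>B. B \<subseteq> dom U \<Longrightarrow> |B| <o \<kappa> \<Longrightarrow> generic_over U B"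
    and A: "A \<subseteq> dom U" "|A| <o \<kappa>" and p: "p \<in> types tern_lang U A X"
    and F: "finite F" "F \<subseteq> X"
  shows "\<exists>a. (\<forall>x\<in>F. a x \<in> dom U) \<and> (\<forall>\<theta>\<in>atoms F A. \<theta> \<in> p \<longleftrightarrow> satp U a \<theta>)"
  using F
proof (induction F rule: finite_induct)
  case empty
  have "\<theta> \<in> p \<longleftrightarrow> satp U a \<theta>" if \<theta>: "\<theta> \<in> atoms {} A" for \<theta> a
  proof -
    have fms: "\<theta> \<in> fms_over tern_lang A X" "fv \<theta> = {}"
      using atoms_fms[OF \<theta>] by (auto simp: fms_over_def)
    have sat: "satp U e \<theta> \<longleftrightarrow> satp U a \<theta>" for e using fms(2) by (intro sat_cong) simp
    have "Top \<in> fms_over tern_lang A X" by (simp add: fms_over_def Top_def)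
    then have "satp U a \<theta> \<Longrightarrow> \<theta> \<in> p" "\<not> satp U a \<theta> \<Longrightarrow> Neg \<theta> \<in> p"
      using fms(1) sat by (auto intro!: type_deductively_closed[OF p, of "{}"])
    then show ?thesis using Neg_in_type[OF p fms(1)] by blast
  qed
  then show ?case by blast
next
  case (insert x F)
  then obtain a where a_dom: "\<And>y. y \<in> F \<Longrightarrow> a y \<in> dom U"
    and a: "\<And>\<theta>. \<theta> \<in> atoms F A \<Longrightarrow> \<theta> \<in> p \<longleftrightarrow> satp U a \<theta>" by auto
  let ?T = "pterms F A" and ?T' = "pterms (insert x F) A"
  let ?tv = "tval (struct_par U)"
  have T': "s \<in> ?T' \<longleftrightarrow> s = Var x \<or> s \<in> ?T" for s by (auto simp: pterms_def)
  have xT: "Var x \<notin> ?T" using insert.hyps(2) by (auto simp: pterms_def)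
  have fms: "\<theta> \<in> fms_over tern_lang A X" if "\<theta> \<in> atoms (insert x F) A" for \<theta>
    using fms_over_mono[OF atoms_fms[OF that] order_refl insert.prems] .
  have tv_dom: "?tv a s \<in> dom U" if "s \<in> ?T" for s using that a_dom A(1) by (auto simp: pterms_def)
  have tv_upd: "?tv (a(x := v)) s = ?tv a s" if "s \<in> ?T" for s v
    using that insert.hyps(2) by (auto simp: pterms_def)
  have eq_subst: "Eq s t \<in> p \<longleftrightarrow> Eq s' t' \<in> p"
    if "s \<in> ?T'" "t \<in> ?T'" "s' \<in> ?T'" "t' \<in> ?T'" "Eq s s' \<in> p" "Eq t t' \<in> p" for s t s' t'
    by (rule type_iff[OF p, of "{Eq s s', Eq t t'}"]) (use that in \<open>auto intro!: fms Eq_in_atoms\<close>)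
  have rel_subst: "Rel 0 [s, t, u] \<in> p \<longleftrightarrow> Rel 0 [s', t', u'] \<in> p"
    if "s \<in> ?T'" "t \<in> ?T'" "u \<in> ?T'" "s' \<in> ?T'" "t' \<in> ?T'" "u' \<in> ?T'"
      "Eq s s' \<in> p" "Eq t t' \<in> p" "Eq u u' \<in> p" for s t u s' t' u'
    by (rule type_iff[OF p, of "{Eq s s', Eq t t', Eq u u'}"]) (use that in \<open>auto intro!: fms Rel_in_atoms\<close>)
  have refl: "Eq s s \<in> p" if "s \<in> ?T'" for s
    by (rule type_deductively_closed[OF p, of "{}"]) (use that in \<open>auto intro!: fms Eq_in_atoms\<close>)
  have sym: "Eq s t \<in> p \<longleftrightarrow> Eq t s \<in> p" if "s \<in> ?T'" "t \<in> ?T'" for s t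
    by (rule type_iff[OF p, of "{}"]) (use that in \<open>auto intro!: fms Eq_in_atoms\<close>)
  have eqF: "Eq s t \<in> p \<longleftrightarrow> ?tv a s = ?tv a t" if "s \<in> ?T" "t \<in> ?T" for s t
    using a[OF Eq_in_atoms[OF that]] by simp
  have relF: "Rel 0 [s, t, u] \<in> p \<longleftrightarrow> rint U 0 [?tv a s, ?tv a t, ?tv a u]"
    if "s \<in> ?T" "t \<in> ?T" "u \<in> ?T" for s t u
    using a[OF Rel_in_atoms[OF that]] by simp
  have finish: ?case
    if v: "v \<in> dom U" and eq: "\<And>s t. s \<in> ?T' \<Longrightarrow> t \<in> ?T' \<Longrightarrow> Eq s t \<in> p \<longleftrightarrow> ?tv (a(x := v)) s = ?tv (a(x := v)) t"
      and rel: "\<And>s t u. s \<in> ?T' \<Longrightarrow> t \<in> ?T' \<Longrightarrow> u \<in> ?T' \<Longrightarrow> Rel 0 [s, t, u] \<in> p \<longleftrightarrow>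
        rint U 0 [?tv (a(x := v)) s, ?tv (a(x := v)) t, ?tv (a(x := v)) u]" for v
  proof (intro exI[of _ "a(x := v)"] conjI ballI)
    show "(a(x := v)) y \<in> dom U" if "y \<in> insert x F" for y using that v a_dom by auto
    fix \<theta> assume "\<theta> \<in> atoms (insert x F) A"
    then show "\<theta> \<in> p \<longleftrightarrow> satp U (a(x := v)) \<theta>"
    proof (cases rule: atoms_cases)
      case (1 s t)
      show ?thesis unfolding 1(3) using eq[OF 1(1,2)] by (simp only: sat.simps)
    next
      case (2 s t u)
      show ?thesis unfolding 2(4) using rel[OF 2(1-3)] by (simp only: sat.simps list.map struct_par_simps)
    qed
  qed
  show ?case
  proof (cases "\<exists>t\<in>?T. Eq (Var x) t \<in> p")
    case True
    then obtain t where t: "t \<in> ?T" "Eq (Var x) t \<in> p" by blast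
    \<comment> \<open>The terms \<open>s\<close> and \<open>\<rho> s\<close> are equal according to the type, and \<open>\<rho> s\<close> does not contain \<open>x\<close>.\<close>
    define \<rho> where "\<rho> s = (if s = Var x then t else s)" for s
    have \<rho>: "\<rho> s \<in> ?T" "\<rho> s \<in> ?T'" "Eq s (\<rho> s) \<in> p" "?tv (a(x := ?tv a t)) s = ?tv a (\<rho> s)" if "s \<in> ?T'" for s
      using that t tv_upd refl[OF that] by (auto simp: \<rho>_def T')
    show ?thesis
    proof (rule finish[of "?tv a t"])
      show "?tv a t \<in> dom U" by (rule tv_dom[OF t(1)])
      show "Eq s u \<in> p \<longleftrightarrow> ?tv (a(x := ?tv a t)) s = ?tv (a(x := ?tv a t)) u" if "s \<in> ?T'" "u \<in> ?T'" for s u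
        using eq_subst[OF that \<rho>(2)[OF that(1)] \<rho>(2)[OF that(2)] \<rho>(3)[OF that(1)] \<rho>(3)[OF that(2)]]
          eqF[OF \<rho>(1)[OF that(1)] \<rho>(1)[OF that(2)]] \<rho>(4)[OF that(1)] \<rho>(4)[OF that(2)] by (simp only:)
      show "Rel 0 [s, u, w] \<in> p \<longleftrightarrow> rint U 0 [?tv (a(x := ?tv a t)) s, ?tv (a(x := ?tv a t)) u, ?tv (a(x := ?tv a t)) w]"
        if "s \<in> ?T'" "u \<in> ?T'" "w \<in> ?T'" for s u w
        using rel_subst[OF that \<rho>(2)[OF that(1)] \<rho>(2)[OF that(2)] \<rho>(2)[OF that(3)] \<rho>(3)[OF that(1)] \<rho>(3)[OF that(2)] \<rho>(3)[OF that(3)]]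
          relF[OF \<rho>(1)[OF that(1)] \<rho>(1)[OF that(2)] \<rho>(1)[OF that(3)]] \<rho>(4)[OF that(1)] \<rho>(4)[OF that(2)] \<rho>(4)[OF that(3)]
        by (simp only:)
    qed
  next
    case False
    define B where "B = ?tv a ` ?T"
    have "B = A \<union> a ` F" by (auto simp: B_def pterms_def image_Un image_image)
    then have B: "B \<subseteq> dom U" "|B| <o \<kappa>"
      using A(1) a_dom small_union_finite[OF \<kappa> A(2), of "a ` F"] insert.hyps(1) by auto
    \<comment> \<open>A term for each point of \<open>B\<close>; the placeholder for the new point is named by \<open>x\<close>.\<close>
    define nm where "nm u = (case u of None \<Rightarrow> Var x | Some c \<Rightarrow> (SOME t. t \<in> ?T \<and> ?tv a t = c))" for u
    obtain v where v: "realizes U B (\<lambda>u v w. Rel 0 [nm u, nm v, nm w] \<in> p) v"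
      using gen[OF B] unfolding generic_over_def by blast
    have vB: "v \<in> dom U" "v \<notin> B" using realizesD[OF v] by auto
    have nm: "nm (Some (?tv a s)) \<in> ?T \<and> ?tv a (nm (Some (?tv a s))) = ?tv a s" if "s \<in> ?T" for s
    proof -
      have "(SOME t. t \<in> ?T \<and> ?tv a t = ?tv a s) \<in> ?T \<and> ?tv a (SOME t. t \<in> ?T \<and> ?tv a t = ?tv a s) = ?tv a s"
        by (rule someI[where P = "\<lambda>t. t \<in> ?T \<and> ?tv a t = ?tv a s" and x = s]) (use that in simp)
      then show ?thesis by (simp add: nm_def)
    qed
    define \<sigma> where "\<sigma> s = nm (new_pt v (?tv (a(x := v)) s))" for s
    have tvB: "?tv (a(x := v)) s \<in> B" "?tv (a(x := v)) s \<noteq> v" if "s \<in> ?T" for s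
      using that tv_upd[OF that] vB by (auto simp: B_def)
    have \<sigma>: "\<sigma> s \<in> ?T' \<and> Eq s (\<sigma> s) \<in> p" if "s \<in> ?T'" for s
    proof (cases "s = Var x")
      case True
      then have "\<sigma> s = Var x" by (simp add: \<sigma>_def new_pt_def nm_def)
      then show ?thesis using True that refl[OF that] by simp
    next
      case False
      then have s: "s \<in> ?T" using that T' by simp
      then have "\<sigma> s = nm (Some (?tv a s))" using tvB[OF s] tv_upd[OF s] by (simp add: \<sigma>_def new_pt_def)
      then show ?thesis using nm[OF s] eqF[OF s] T' by simp
    qed
    show ?thesis
    proof (rule finish[OF vB(1)])
      show "Eq s t \<in> p \<longleftrightarrow> ?tv (a(x := v)) s = ?tv (a(x := v)) t" if st: "s \<in> ?T'" "t \<in> ?T'" for s t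
      proof -
        consider "s = Var x" "t = Var x" | "s = Var x" "t \<in> ?T" | "s \<in> ?T" "t = Var x" | "s \<in> ?T" "t \<in> ?T"
          using st T' by blast
        then show ?thesis
        proof cases
          case 1
          then show ?thesis using refl[OF st(1)] by simp
        next
          case 2
          then have "Eq s t \<notin> p" using False by blast
          moreover have "?tv (a(x := v)) t \<noteq> v" by (rule tvB[OF 2(2)])
          ultimately show ?thesis using 2(1) by auto
        next
          case 3
          then have "Eq s t \<notin> p" using False sym[OF st] by blast
          moreover have "?tv (a(x := v)) s \<noteq> v" by (rule tvB[OF 3(1)])
          ultimately show ?thesis using 3(2) by auto
        next
          case 4
          then show ?thesis using eqF[OF 4] tv_upd by simp
        qed
      qed
      show "Rel 0 [s, t, u] \<in> p \<longleftrightarrow> rint U 0 [?tv (a(x := v)) s, ?tv (a(x := v)) t, ?tv (a(x := v)) u]"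
        if stu: "s \<in> ?T'" "t \<in> ?T'" "u \<in> ?T'" for s t u
      proof (cases "s = Var x \<or> t = Var x \<or> u = Var x")
        case True
        have mem: "?tv (a(x := v)) s \<in> insert v B" if "s \<in> ?T'" for s
          using that T' tvB by (cases "s = Var x") auto
        have "v = ?tv (a(x := v)) s \<or> v = ?tv (a(x := v)) t \<or> v = ?tv (a(x := v)) u" using True by auto
        from realizes_rint[OF v mem[OF stu(1)] mem[OF stu(2)] mem[OF stu(3)] this]
        have "rint U 0 [?tv (a(x := v)) s, ?tv (a(x := v)) t, ?tv (a(x := v)) u] \<longleftrightarrow> Rel 0 [\<sigma> s, \<sigma> t, \<sigma> u] \<in> p"
          unfolding \<sigma>_def .
        also have "\<dots> \<longleftrightarrow> Rel 0 [s, t, u] \<in> p"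
          using rel_subst[OF stu, of "\<sigma> s" "\<sigma> t" "\<sigma> u"] \<sigma>[OF stu(1)] \<sigma>[OF stu(2)] \<sigma>[OF stu(3)] by blast
        finally show ?thesis by blast
      next
        case False
        then have "s \<in> ?T" "t \<in> ?T" "u \<in> ?T" using stu T' by auto
        then show ?thesis using relF tv_upd by simp
      qed
    qed
  qed
qed

text \<open>By back-and-forth a tuple that satisfies the quantifier-free part of a type realizes the type.\<close>

lemma saturated_if_generic:
  fixes U :: "(nat, nat, 'a) struct"
  assumes \<kappa>: "Card_order \<kappa>" "natLeq <o \<kappa>"
    and gen: "\<And>B. B \<subseteq> dom U \<Longrightarrow> |B| <o \<kappa> \<Longrightarrow> generic_over U B"
  shows "generic U" "saturated \<kappa> tern_lang U"
proof -
  show genU: "generic U"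
    unfolding generic_def
  proof (intro allI impI)
    fix C assume C: "finite C \<and> C \<subseteq> dom U"
    have "|C| <o \<kappa>" by (rule countable_small[OF \<kappa>(2)]) (simp add: C countable_finite)
    then show "generic_over U C" using C by (intro gen) auto
  qed
  show "saturated \<kappa> tern_lang U"
    unfolding saturated_def
  proof (intro allI impI ballI, elim conjE)
    fix A X p assume A: "A \<subseteq> dom U" "|A| <o \<kappa>" and X: "finite (X :: nat set)" and p: "p \<in> types tern_lang U A X"
    obtain a where a: "\<forall>x\<in>X. a x \<in> dom U" "\<forall>\<theta>\<in>atoms X A. \<theta> \<in> p \<longleftrightarrow> satp U a \<theta>"
      using realize_quantifier_free_type[OF \<kappa> gen A p X order_refl] by blast
    have true: "satp U a \<phi>" if \<phi>: "\<phi> \<in> p" for \<phi>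
    proof -
      have "\<phi> \<in> fms_over tern_lang A X" using \<phi> p by (auto simp: types_def)
      then obtain C where C: "finite C" "C \<subseteq> A" "\<phi> \<in> fms_over tern_lang C X" by (rule finite_parameters)
      have CU: "C \<subseteq> dom U" using C(2) A(1) by simp
      have at: "\<theta> \<in> fms_over tern_lang A X \<and> (\<theta> \<in> p \<longleftrightarrow> satp U a \<theta>)" if \<theta>: "\<theta> \<in> atoms X C" for \<theta>
      proof -
        have "\<theta> \<in> atoms X A" using \<theta> pterms_mono[OF order_refl C(2), of X] unfolding atoms_def by blast
        then show ?thesis using a(2) atoms_fms by blast
      qed
      let ?\<Delta> = "insert \<phi> ((\<lambda>\<theta>. if \<theta> \<in> p then \<theta> else Neg \<theta>) ` atoms X C)"
      have fin: "finite ?\<Delta>" using finite_atoms[OF X C(1)] by simp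
      have sub: "?\<Delta> \<subseteq> p" using \<phi> at Neg_in_type[OF p] by auto
      have "fin_sat U X p" using p by (simp add: types_def)
      from fin_satD[OF this fin sub] obtain c where c: "c \<in> X \<rightarrow>\<^sub>E dom U" "\<forall>\<psi>\<in>?\<Delta>. satp U c \<psi>"
        by (rule bexE)
      have agree: "satp U a \<theta> \<longleftrightarrow> satp U c \<theta>" if \<theta>: "\<theta> \<in> atoms X C" for \<theta>
      proof -
        have "satp U c (if \<theta> \<in> p then \<theta> else Neg \<theta>)" using \<theta> by (intro bspec[OF c(2)] insertI2 imageI)
        then show ?thesis using at[OF \<theta>] by (auto split: if_splits)
      qed
      have "piso U U (Id_on C \<union> (\<lambda>x. (a x, c x)) ` X)"
        by (rule piso_of_atoms[OF CU _ _ agree]) (use a(1) c(1) in auto)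
      then have "satp U a \<phi> \<longleftrightarrow> satp U c \<phi>"
        by (rule satp_piso[OF genU _ _ C(3)]) (use C(1) X finite_Id_on in auto)
      then show ?thesis using bspec[OF c(2) insertI1] by simp
    qed
    let ?a = "restrict a X"
    have restr: "satp U ?a \<phi> \<longleftrightarrow> satp U a \<phi>" if "\<phi> \<in> fms_over tern_lang A X" for \<phi>
      using that by (intro sat_cong) (auto simp: fms_over_def)
    have "\<phi> \<in> tp tern_lang U A X ?a \<longleftrightarrow> \<phi> \<in> p" if \<phi>: "\<phi> \<in> fms_over tern_lang A X" for \<phi>
    proof
      assume "\<phi> \<in> p"
      then show "\<phi> \<in> tp tern_lang U A X ?a" using true restr[OF \<phi>] \<phi> by (simp add: tp_def)
    next
      assume "\<phi> \<in> tp tern_lang U A X ?a"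
      then have "satp U a \<phi>" using restr[OF \<phi>] by (simp add: tp_def)
      then have "Neg \<phi> \<notin> p" using true by force
      then show "\<phi> \<in> p" using Neg_in_type[OF p \<phi>] by simp
    qed
    moreover have "tp tern_lang U A X ?a \<subseteq> fms_over tern_lang A X" "p \<subseteq> fms_over tern_lang A X"
      using p by (auto simp: tp_def types_def)
    ultimately have "tp tern_lang U A X ?a = p" by blast
    moreover have "?a \<in> X \<rightarrow>\<^sub>E dom U" using a(1) by auto
    ultimately show "\<exists>a\<in>X \<rightarrow>\<^sub>E dom U. tp tern_lang U A X a = p" by blast
  qed
qed

section \<open>A monster model\<close>

text \<open>Points of the model are sets of lists over the type that carries \<open>\<kappa>\<close>. As the set of lists is infinite, lists can be paired
injectively; so a point codes a family of points indexed by lists, its sections.\<close>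

definition list_pair :: "'k list \<times> 'k list \<Rightarrow> 'k list" where
  "list_pair = (SOME J. inj J)"

lemma inj_list_pair: "inj (list_pair :: 'k list \<times> 'k list \<Rightarrow> 'k list)"
proof -
  have "infinite (UNIV :: 'k list set)" by (rule infinite_UNIV_listI)
  then have "|(UNIV :: 'k list set) \<times> (UNIV :: 'k list set)| \<le>o |UNIV :: 'k list set|"
    by (intro ordIso_imp_ordLeq card_of_Times_same_infinite)
  then have "\<exists>J :: 'k list \<times> 'k list \<Rightarrow> 'k list. inj J"
    unfolding UNIV_Times_UNIV card_of_ordLeq[symmetric] by blast
  then show ?thesis unfolding list_pair_def by (rule someI_ex)
qed

lemma list_pair_eq [simp]: "list_pair (i, j) = list_pair (i', j') \<longleftrightarrow> i = i' \<and> j = j'"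
  using inj_list_pair by (auto simp: inj_def)

definition sect :: "'k list set \<Rightarrow> 'k list \<Rightarrow> 'k list set" where
  "sect v i = {j. list_pair (i, j) \<in> v}"

lemma sect_exists: "\<exists>v. \<forall>i. sect v i = f i"
  by (rule exI[of _ "{list_pair (i, j) | i j. j \<in> f i}"]) (auto simp: sect_def)

text \<open>A point \<open>v\<close> has three distinguished sections, at \<open>[]\<close>, at a singleton and at a list of length two. The last one codes a family of points,
which \<open>listed v\<close> enumerates together with \<open>v\<close> itself, whose index is the empty list. The second one
codes a ternary relation on the indices of this enumeration. The first one is arbitrary, which leaves enough points with
the same family and the same relation.\<close>

definition listed :: "'k list set \<Rightarrow> 'k list \<Rightarrow> 'k list set" where
  "listed v i = (case i of [] \<Rightarrow> v | _ # i' \<Rightarrow> sect (sect v [undefined, undefined]) i')"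

text \<open>A triple is governed by those of its entries \<open>v\<close> whose enumeration \<open>listed v\<close> contains the other entries.\<close>

definition coded_rel :: "'k list set \<Rightarrow> 'k list set \<Rightarrow> 'k list set \<Rightarrow> bool" where
  "coded_rel a b c \<longleftrightarrow> (\<exists>v\<in>{a, b, c}. \<exists>i j k. listed v i = a \<and> listed v j = b \<and> listed v k = c \<and>
     list_pair (i, list_pair (j, k)) \<in> sect v [undefined])"

definition coded_model :: "(nat, nat, 'k list set) struct" where
  "coded_model = \<lparr>dom = UNIV, fint = (\<lambda>_ _. {}), rint = (\<lambda>_ vs. coded_rel (vs ! 0) (vs ! 1) (vs ! 2))\<rparr>"

lemma coded_model_simps [simp]:
  "dom coded_model = UNIV" "rint coded_model r [a, b, c] = coded_rel a b c"
  by (simp_all add: coded_model_def)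

text \<open>Let \<open>x\<close> code the family \<open>h\<close> and the required relation. If \<open>x\<close> is enumerated by no point \<open>h i\<close>,
then \<open>x\<close> alone governs the triples between \<open>x\<close> and \<open>A\<close>, and the relation is as required. The free section of \<open>x\<close> is
chosen by Cantor's diagonal argument, so that \<open>x\<close> differs from all points enumerated by some \<open>h i\<close>.\<close>

lemma coded_model_generic_over:
  fixes h :: "'k list \<Rightarrow> 'k list set"
  assumes A: "A \<subseteq> range h"
  shows "generic_over coded_model A"
  unfolding generic_over_def
proof
  fix G
  define nm where "nm i = (case i of [] \<Rightarrow> None | _ # i' \<Rightarrow> Some (h i'))" for i :: "'k list"
  define tag where "tag = {list_pair (i, j) | i j. list_pair (i, j) \<notin> sect (listed (h i) j) []}"
  define pat where "pat = {list_pair (i, list_pair (j, k)) | i j k. G (nm i) (nm j) (nm k)}"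
  obtain w where w: "\<forall>i. sect w i = h i" using sect_exists by blast
  obtain x where x: "\<forall>i. sect x i = (if i = [] then tag else if i = [undefined] then pat else w)"
    using sect_exists[of "\<lambda>i. if i = [] then tag else if i = [undefined] then pat else w"] by blast
  have listed_x: "listed x [] = x" "listed x (q # i) = h i" for q i
    using w x by (simp_all add: listed_def)
  have avoid: "x \<noteq> listed (h i) j" for i j
  proof
    assume eq: "x = listed (h i) j"
    have "list_pair (i, j) \<in> sect x [] \<longleftrightarrow> list_pair (i, j) \<notin> sect (listed (h i) j) []"
      using x by (auto simp: tag_def)
    then show False using eq by simp
  qed
  have avoid_h: "x \<noteq> h i" for i using avoid[of i "[]"] by (simp add: listed_def)
  have nm: "nm i = new_pt x (listed x i)" for i
    using avoid_h listed_x by (cases i) (auto simp: nm_def new_pt_def)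
  have listed_ex: "\<exists>i. listed x i = a" if "a \<in> insert x A" for a
    using that A listed_x by blast
  have pat: "list_pair (i, list_pair (j, k)) \<in> sect x [undefined] \<longleftrightarrow> G (nm i) (nm j) (nm k)" for i j k
    using x by (auto simp: pat_def)
  have "realizes coded_model A G x"
    unfolding realizes_def
  proof (intro conjI ballI impI)
    show "x \<notin> A" using A avoid_h by blast
    fix a b c assume abc: "a \<in> insert x A" "b \<in> insert x A" "c \<in> insert x A" "x \<in> {a, b, c}"
    have "coded_rel a b c \<longleftrightarrow> G (new_pt x a) (new_pt x b) (new_pt x c)"
    proof
      assume "coded_rel a b c"
      then obtain v i j k where v: "v \<in> {a, b, c}" "listed v i = a" "listed v j = b" "listed v k = c"
        "list_pair (i, list_pair (j, k)) \<in> sect v [undefined]" unfolding coded_rel_def by blast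
      have "v = x"
      proof (rule ccontr)
        assume "v \<noteq> x"
        then have "v \<in> A" using v(1) abc(1-3) by blast
        then obtain i0 where "v = h i0" using A by blast
        then show False using avoid[of i0] v(2-4) abc(4) by auto
      qed
      then have "G (nm i) (nm j) (nm k)" using v(5) pat by simp
      then show "G (new_pt x a) (new_pt x b) (new_pt x c)" using nm v(2-4) \<open>v = x\<close> by simp
    next
      assume G: "G (new_pt x a) (new_pt x b) (new_pt x c)"
      obtain i j k where ijk: "listed x i = a" "listed x j = b" "listed x k = c"
        using listed_ex[OF abc(1)] listed_ex[OF abc(2)] listed_ex[OF abc(3)] by blast
      have "G (nm i) (nm j) (nm k)" using G nm ijk by simp
      then show "coded_rel a b c" unfolding coded_rel_def
        by (intro bexI[OF _ abc(4)] exI[of _ i] exI[of _ j] exI[of _ k]) (simp add: ijk pat)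
    qed
    then show "rint coded_model 0 [a, b, c] \<longleftrightarrow> G (new_pt x a) (new_pt x b) (new_pt x c)" by simp
  qed simp
  then show "\<exists>x. realizes coded_model A G x" by blast
qed

text \<open>Lists of length one already number as many as the field of \<open>\<kappa>\<close>. So in the model of sets of lists every
small set is a family that a point can code.\<close>

lemma small_subset_of_range:
  fixes \<kappa> :: "'k rel"
  assumes \<kappa>: "Card_order \<kappa>" and A: "|A| <o \<kappa>"
  obtains h :: "'k list \<Rightarrow> 'b" where "A \<subseteq> range h"
proof (cases "A = {}")
  case True
  then show thesis by (intro that[of "\<lambda>_. undefined"]) simp
next
  case False
  have "|Field \<kappa>| \<le>o |UNIV :: 'k list set|"
    by (rule card_of_ordLeqI[of "\<lambda>x. [x]"]) (auto simp: inj_on_def)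
  moreover have "\<kappa> =o |Field \<kappa>|" using card_of_Field_ordIso[OF \<kappa>] ordIso_symmetric by blast
  ultimately have "|A| \<le>o |UNIV :: 'k list set|"
    using A ordIso_ordLeq_trans ordLess_imp_ordLeq ordLeq_transitive by blast
  then obtain h :: "'k list \<Rightarrow> 'b" where "h ` UNIV = A"
    using card_of_ordLeq2[OF False, of "UNIV :: 'k list set"] by blast
  then show thesis by (intro that[of h]) simp
qed

lemma coded_model_monster:
  fixes \<kappa> :: "'k rel"
  assumes \<kappa>: "large_for \<kappa> tern_lang"
  shows "monster \<kappa> tern_lang generic_theory (coded_model :: (nat, nat, 'k list set) struct)"
    and "generic (coded_model :: (nat, nat, 'k list set) struct)"
proof -
  have \<kappa>': "Card_order \<kappa>" "natLeq <o \<kappa>" using \<kappa> by (auto simp: large_for_def)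
  have gen: "generic_over coded_model A" if A: "|A| <o \<kappa>" for A :: "'k list set set"
  proof -
    obtain h :: "'k list \<Rightarrow> 'k list set" where "A \<subseteq> range h" by (rule small_subset_of_range[OF \<kappa>'(1) A])
    then show ?thesis by (rule coded_model_generic_over)
  qed
  show "generic (coded_model :: (nat, nat, 'k list set) struct)"
    by (rule saturated_if_generic(1)[OF \<kappa>' gen])
  moreover have "saturated \<kappa> tern_lang (coded_model :: (nat, nat, 'k list set) struct)"
    by (rule saturated_if_generic(2)[OF \<kappa>' gen])
  ultimately show "monster \<kappa> tern_lang generic_theory (coded_model :: (nat, nat, 'k list set) struct)"
    using \<kappa> is_theory_generic_theory models_if_generic by (simp add: monster_def)
qed

section \<open>Comparison of the properties of measures\<close>

lemma monster_generic_noninvariant_support: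
  fixes U :: "(nat, nat, 'a) struct"
  assumes "monster \<kappa> tern_lang generic_theory U"
  shows "definable_with_noninvariant_support \<kappa> tern_lang U"
proof (rule generic_saturated_noninvariant_support)
  show "generic U" using assms by (auto simp: monster_def intro: generic_if_models)
qed (use assms in \<open>auto simp: monster_def large_for_def\<close>)

theorem lemma2p10:
  shows
   "(\<forall>(\<kappa> :: 'k rel) (L :: ('f, 'r) lang) T (U :: ('f, 'r, 'a) struct) X \<mu>.
       monster \<kappa> L T U \<and> finite X \<and> keisler L U X \<mu> \<longrightarrow>
         (finitely_satisfiable \<kappa> L U X \<mu> \<longrightarrow> invariantly_supported \<kappa> L U X \<mu>) \<and>
         (invariantly_supported \<kappa> L U X \<mu> \<longrightarrow> invariant \<kappa> L U X \<mu>) \<and>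
         (nip TYPE('a) L T \<longrightarrow> (invariant \<kappa> L U X \<mu> \<longleftrightarrow> invariantly_supported \<kappa> L U X \<mu>))) \<and>
    (\<exists>(L :: (nat, nat) lang) T. is_theory L T \<and>
       (\<forall>\<kappa> :: 'k rel. large_for \<kappa> L \<longrightarrow>
          (\<exists>U :: (nat, nat, 'k list set) struct.
             monster \<kappa> L T U \<and> definable_with_noninvariant_support \<kappa> L U) \<and>
          (\<forall>U :: (nat, nat, 'a) struct.
             monster \<kappa> L T U \<longrightarrow> definable_with_noninvariant_support \<kappa> L U)))"
proof (rule conjI, goal_cases)
  case 1
  show ?case
  proof (intro allI impI, elim conjE, intro conjI impI iffI)
    fix \<kappa> :: "'k rel" and L :: "('f, 'r) lang" and T and U :: "('f, 'r, 'a) struct" and X \<mu>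
    assume U: "monster \<kappa> L T U" and X: "finite X" and \<mu>: "keisler L U X \<mu>"
    show "invariantly_supported \<kappa> L U X \<mu>" if "finitely_satisfiable \<kappa> L U X \<mu>"
      by (rule finitely_satisfiable_imp_invariantly_supported[OF \<mu> that])
    show "invariant \<kappa> L U X \<mu>" if "invariantly_supported \<kappa> L U X \<mu>"
      by (rule invariantly_supported_imp_invariant[OF \<mu> that])
    then show "invariant \<kappa> L U X \<mu>" if "invariantly_supported \<kappa> L U X \<mu>" using that by blast
    show "invariantly_supported \<kappa> L U X \<mu>" if "nip TYPE('a) L T" "invariant \<kappa> L U X \<mu>"
      by (rule nip_invariant_imp_invariantly_supported[OF that(1) U X \<mu> that(2)])
  qed
next
  case 2
  show ?case
  proof (intro exI[of _ tern_lang] exI[of _ generic_theory] conjI allI impI is_theory_generic_theory)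
    fix \<kappa> :: "'k rel" assume "large_for \<kappa> tern_lang"
    then have m: "monster \<kappa> tern_lang generic_theory (coded_model :: (nat, nat, 'k list set) struct)"
      by (rule coded_model_monster)
    then show "\<exists>U :: (nat, nat, 'k list set) struct.
        monster \<kappa> tern_lang generic_theory U \<and> definable_with_noninvariant_support \<kappa> tern_lang U"
      using monster_generic_noninvariant_support[OF m] by blast
    show "definable_with_noninvariant_support \<kappa> tern_lang U" if "monster \<kappa> tern_lang generic_theory U"
      for U :: "(nat, nat, 'a) struct" using that by (rule monster_generic_noninvariant_support)
  qed
qed

end
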